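(* Let $X\subset\mathbb{R}^d$ be open and $H\in\mathcal{G}_{C\,ln}(X^2)$. For $n\ge1$, denote by $L_n$ the kernel of $\widehat H^n:\mathcal{G}(X)\to\mathcal{G}_C(X)$ (with $L_1=H$), and by $(L_{n,\varepsilon})_\varepsilon$ a representative of $L_n$. For all $\varepsilon\in(0,1]$, the series $\sum_{n\ge1}\frac{L_{n,\varepsilon}}{n!}$ converges for the usual topology of $\mathcal{C}^\infty(X^2)$. Its sum, denoted by $S_\varepsilon$, defines an element $(S_\varepsilon)_\varepsilon$ of $\mathcal{E}_M(X^2)$. Furthermore, $S=Cl(S_\varepsilon)_\varepsilon$ defines a compactly supported element of $\mathcal{G}(X^2)$ depending only on $H$. The well defined operator $e^{\widehat H}=\widehat S+Id$, where $Id$ is the identity operator, is called the exponential of $\widehat H$.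
   Context: For $\Omega\subset\mathbb{R}^d$ open, $K\Subset\Omega$ means that $K$ is a compact subset of $\Omega$, and $p_{K,l}(f)=\sup_{x\in K,|\alpha|\le l}|\partial^\alpha f(x)|$ for $l\in\mathbb{N}$, $f\in\mathcal{C}^\infty(\Omega)$; these seminorms define the usual topology of $\mathcal{C}^\infty(\Omega)$. $\mathcal{E}_M(\Omega)$ is the set of nets $(u_\varepsilon)_{\varepsilon\in(0,1]}$ in $\mathcal{C}^\infty(\Omega)$ such that for all $K\Subset\Omega$, $l\in\mathbb{N}$ there is $n\in\mathbb{N}$ with $p_{K,l}(u_\varepsilon)=O(\varepsilon^{-n})$ as $\varepsilon\to0$; $\mathcal{I}(\Omega)$ is the set of nets such that for all $K,l,n$, $p_{K,l}(u_\varepsilon)=O(\varepsilon^{n})$. $\mathcal{G}(\Omega)=\mathcal{E}_M(\Omega)/\mathcal{I}(\Omega)$; $Cl(u_\varepsilon)_\varepsilon$ is the class. The support of $u\in\mathcal{G}(\Omega)$ is the complement of the largest open subset on which $u$ restricts to $0$; $\mathcal{G}_C(\Omega)$ is the set of elements with compact support. $\mathcal{H}_{ln}(\Omega)$ is the set of nets $(u_\varepsilon)_\varepsilon$ in $\mathcal{C}^\infty(\Omega)$ such that for all $K\Subset\Omega$ and $l\in\mathbb{N}$, $p_{K,l}(u_\varepsilon)=O(|\ln\varepsilon|)$ as $\varepsilon\to0$; $\mathcal{G}_{ln}(\Omega)=\mathcal{H}_{ln}(\Omega)/\mathcal{I}(\Omega)$ and $\mathcal{G}_{C\,ln}(\Omega)=\mathcal{G}_{ln}(\Omega)\cap\mathcal{G}_C(\Omega)$.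 For $H\in\mathcal{G}_C(X^2)$ with $\mathrm{supp}\,H\subset(\mathring K)^2$, $K\Subset X$, the generalized integral operator $\widehat H:\mathcal{G}(X)\to\mathcal{G}_C(X)$ is $\widehat H(f)=Cl\big(x\mapsto\int_K H_\varepsilon(x,y)f_\varepsilon(y)\,\mathrm{d}y\big)_\varepsilon$, where $(H_\varepsilon)_\varepsilon$ and $(f_\varepsilon)_\varepsilon$ are any representatives of $H$ and $f$; $H$ is called its kernel. $\widehat H^n$ is the $n$-fold composition of $\widehat H$ with itself; for $n\ge2$ it is a generalized integral operator whose kernel is the element $L_n\in\mathcal{G}_C(X^2)$ given by $$L_n(\cdot_1,\cdot_2)=\int_{K^{n-1}}H(\cdot_1,\xi_1)H(\xi_1,\xi_2)\cdots H(\xi_{n-1},\cdot_2)\,\mathrm{d}\xi_1\cdots\mathrm{d}\xi_{n-1},$$ i.e. the class of the net obtained by replacing $H$ by $H_\varepsilon$ in this formula.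
   Formalization: The representatives L_{n,ε} are the nets obtained by putting one arbitrary representative H_ε of H (and one admissible compact K) into the integral formula for L_n; with arbitrary unrelated representatives of each L_n the series may diverge. *)

theory Defs
  imports "HOL-Analysis.Analysis" "HOL-Library.Landau_Symbols"
begin

text \<open>
  Functions on an open set \<open>\<Omega>\<close> are total functions of which only the values on \<open>\<Omega>\<close> matter, and nets
  \<open>(u\<^sub>\<epsilon>)\<close> are functions of a real \<open>\<epsilon>\<close> of which only the values for \<open>\<epsilon> \<in> {0<..1}\<close> matter; two nets
  agreeing there always differ by a null net. The type \<open>'k\<close> of scalars covers both \<open>real\<close> and
  \<open>complex\<close>.
\<close>

definition partial_deriv ::
  "'a::euclidean_space \<Rightarrow> ('a \<Rightarrow> 'k::{real_normed_field,euclidean_space}) \<Rightarrow> 'a \<Rightarrow> 'k" where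
  "partial_deriv b f x = vector_derivative (\<lambda>t. f (x + t *\<^sub>R b)) (at 0)"

text \<open>
  A partial derivative of order \<open>k\<close> is indexed by a list of \<open>k\<close> basis vectors. As partial derivatives of
  smooth functions commute, lists of length at most \<open>l\<close> give the same derivatives as the
  multi-indices \<open>\<alpha>\<close> with \<open>|\<alpha>| \<le> l\<close>.
\<close>

fun partials ::
  "'a::euclidean_space list \<Rightarrow> ('a \<Rightarrow> 'k::{real_normed_field,euclidean_space}) \<Rightarrow> 'a \<Rightarrow> 'k" where
  "partials [] f = f"
| "partials (b # bs) f = partial_deriv b (partials bs f)"

definition smooth_on ::
  "'a::euclidean_space set \<Rightarrow> ('a \<Rightarrow> 'k::{real_normed_field,euclidean_space}) \<Rightarrow> bool" where
  "smooth_on \<Omega> f \<longleftrightarrow>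
     (\<forall>bs. set bs \<subseteq> Basis \<longrightarrow>
        continuous_on \<Omega> (partials bs f) \<and>
        (\<forall>x\<in>\<Omega>. \<forall>b\<in>Basis. (\<lambda>t. partials bs f (x + t *\<^sub>R b)) differentiable (at 0)))"

text \<open>Inserting \<open>0\<close> only matters for empty \<open>K\<close>, where the supremum has to be \<open>0\<close>.\<close>

definition seminorm ::
  "'a::euclidean_space set \<Rightarrow> nat \<Rightarrow> ('a \<Rightarrow> 'k::{real_normed_field,euclidean_space}) \<Rightarrow> real" where
  "seminorm K l f =
     Sup (insert 0 {norm (partials bs f x) | x bs. x \<in> K \<and> set bs \<subseteq> Basis \<and> length bs \<le> l})"

definition smooth_limit ::
  "'a::euclidean_space set \<Rightarrow> (nat \<Rightarrow> 'a \<Rightarrow> 'k::{real_normed_field,euclidean_space}) \<Rightarrow> ('a \<Rightarrow> 'k) \<Rightarrow> bool"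
  where
  "smooth_limit \<Omega> s g \<longleftrightarrow>
     (\<forall>N. smooth_on \<Omega> (s N)) \<and> smooth_on \<Omega> g \<and>
     (\<forall>K l. compact K \<and> K \<subseteq> \<Omega> \<longrightarrow> (\<lambda>N. seminorm K l (\<lambda>x. s N x - g x)) \<longlonglongrightarrow> 0)"

type_synonym ('a, 'k) net = "real \<Rightarrow> 'a \<Rightarrow> 'k"

definition smooth_nets ::
  "'a::euclidean_space set \<Rightarrow> ('a, 'k::{real_normed_field,euclidean_space}) net set" where
  "smooth_nets \<Omega> = {u. \<forall>\<epsilon>\<in>{0<..1}. smooth_on \<Omega> (u \<epsilon>)}"

definition moderate_nets ::
  "'a::euclidean_space set \<Rightarrow> ('a, 'k::{real_normed_field,euclidean_space}) net set" where
  "moderate_nets \<Omega> = {u \<in> smooth_nets \<Omega>. \<forall>K l. compact K \<and> K \<subseteq> \<Omega> \<longrightarrow>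
     (\<exists>n::nat. (\<lambda>\<epsilon>. seminorm K l (u \<epsilon>)) \<in> O[at_right 0](\<lambda>\<epsilon>. 1 / \<epsilon> ^ n))}"

definition null_nets ::
  "'a::euclidean_space set \<Rightarrow> ('a, 'k::{real_normed_field,euclidean_space}) net set" where
  "null_nets \<Omega> = {u \<in> smooth_nets \<Omega>. \<forall>K l. compact K \<and> K \<subseteq> \<Omega> \<longrightarrow>
     (\<forall>n::nat. (\<lambda>\<epsilon>. seminorm K l (u \<epsilon>)) \<in> O[at_right 0](\<lambda>\<epsilon>. \<epsilon> ^ n))}"

definition ln_nets ::
  "'a::euclidean_space set \<Rightarrow> ('a, 'k::{real_normed_field,euclidean_space}) net set" where
  "ln_nets \<Omega> = {u \<in> smooth_nets \<Omega>. \<forall>K l. compact K \<and> K \<subseteq> \<Omega> \<longrightarrow>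
     (\<lambda>\<epsilon>. seminorm K l (u \<epsilon>)) \<in> O[at_right 0](\<lambda>\<epsilon>. \<bar>ln \<epsilon>\<bar>)}"

definition net_rel ::
  "'a::euclidean_space set \<Rightarrow>
     (('a, 'k::{real_normed_field,euclidean_space}) net \<times> ('a, 'k) net) set" where
  "net_rel \<Omega> = {(u, v). u \<in> moderate_nets \<Omega> \<and> v \<in> moderate_nets \<Omega> \<and>
     (\<lambda>\<epsilon> x. u \<epsilon> x - v \<epsilon> x) \<in> null_nets \<Omega>}"

definition Cl ::
  "'a::euclidean_space set \<Rightarrow> ('a, 'k::{real_normed_field,euclidean_space}) net \<Rightarrow> ('a, 'k) net set"
  where "Cl \<Omega> u = net_rel \<Omega> `` {u}"

definition colombeau ::
  "'a::euclidean_space set \<Rightarrow> ('a, 'k::{real_normed_field,euclidean_space}) net set set" where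
  "colombeau \<Omega> = moderate_nets \<Omega> // net_rel \<Omega>"

text \<open>
  Null nets are of logarithmic type and these are moderate, so the classes of the quotient of
  \<open>ln_nets \<Omega>\<close> by \<open>null_nets \<Omega>\<close> are the classes in \<open>colombeau \<Omega>\<close> of the elements of \<open>ln_nets \<Omega>\<close>.
\<close>

definition colombeau_ln ::
  "'a::euclidean_space set \<Rightarrow> ('a, 'k::{real_normed_field,euclidean_space}) net set set" where
  "colombeau_ln \<Omega> = ln_nets \<Omega> // net_rel \<Omega>"

definition gen_add ::
  "'a::euclidean_space set \<Rightarrow> ('a, 'k::{real_normed_field,euclidean_space}) net set \<Rightarrow>
     ('a, 'k) net set \<Rightarrow> ('a, 'k) net set" where
  "gen_add \<Omega> U V = (\<Union>u\<in>U. \<Union>v\<in>V. Cl \<Omega> (\<lambda>\<epsilon> x. u \<epsilon> x + v \<epsilon> x))"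

definition gen_restrict ::
  "'a::euclidean_space set \<Rightarrow> ('a, 'k::{real_normed_field,euclidean_space}) net set \<Rightarrow>
     ('a, 'k) net set" where
  "gen_restrict V U = (\<Union>u\<in>U. Cl V u)"

definition gen_supp ::
  "'a::euclidean_space set \<Rightarrow> ('a, 'k::{real_normed_field,euclidean_space}) net set \<Rightarrow> 'a set" where
  "gen_supp \<Omega> U = \<Omega> - \<Union>{V. open V \<and> V \<subseteq> \<Omega> \<and> gen_restrict V U = Cl V (\<lambda>\<epsilon> x. 0)}"

definition colombeau_C ::
  "'a::euclidean_space set \<Rightarrow> ('a, 'k::{real_normed_field,euclidean_space}) net set set" where
  "colombeau_C \<Omega> = {U \<in> colombeau \<Omega>. compact (gen_supp \<Omega> U)}"

definition colombeau_C_ln ::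
  "'a::euclidean_space set \<Rightarrow> ('a, 'k::{real_normed_field,euclidean_space}) net set set" where
  "colombeau_C_ln \<Omega> = colombeau_ln \<Omega> \<inter> colombeau_C \<Omega>"

text \<open>The compact sets over which the integrals defined by the kernel \<open>H\<close> may be taken.\<close>

definition integration_domain ::
  "'a::euclidean_space set \<Rightarrow> ('a \<times> 'a, 'k::{real_normed_field,euclidean_space}) net set \<Rightarrow>
     'a set \<Rightarrow> bool" where
  "integration_domain X H K \<longleftrightarrow>
     compact K \<and> K \<subseteq> X \<and> gen_supp (X \<times> X) H \<subseteq> interior K \<times> interior K"

definition int_op_net ::
  "'a::euclidean_space set \<Rightarrow> ('a \<times> 'a, 'k::{real_normed_field,euclidean_space}) net \<Rightarrow>
     ('a, 'k) net \<Rightarrow> ('a, 'k) net" where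
  "int_op_net K h f \<epsilon> x = (LINT y:K|lborel. h \<epsilon> (x, y) * f \<epsilon> y)"

definition int_op ::
  "'a::euclidean_space set \<Rightarrow> ('a \<times> 'a, 'k::{real_normed_field,euclidean_space}) net set \<Rightarrow>
     ('a, 'k) net set \<Rightarrow> ('a, 'k) net set" where
  "int_op X H F =
     (THE G. \<forall>K h f. integration_domain X H K \<and> h \<in> H \<and> f \<in> F \<longrightarrow> G = Cl X (int_op_net K h f))"

definition is_kernel ::
  "'a::euclidean_space set \<Rightarrow> (('a, 'k::{real_normed_field,euclidean_space}) net set \<Rightarrow>
     ('a, 'k) net set) \<Rightarrow> ('a \<times> 'a, 'k) net set \<Rightarrow> bool" where
  "is_kernel X T L \<longleftrightarrow> L \<in> colombeau_C (X \<times> X) \<and> (\<forall>F\<in>colombeau X. T F = int_op X L F)"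

text \<open>
  With \<open>\<zeta> = (x, \<xi>\<^sub>1, \<dots>, \<xi>\<^bsub>n-1\<^esub>, y)\<close>, the integrand is the product of the \<open>h\<^sub>\<epsilon> (\<zeta>\<^sub>i, \<zeta>\<^bsub>i+1\<^esub>)\<close> for \<open>i < n\<close>.
  For \<open>n = 1\<close> the integral is over a single point of mass one and the result is \<open>h\<^sub>\<epsilon> (x, y)\<close>.
\<close>

definition iter_kernel_net ::
  "'a::euclidean_space set \<Rightarrow> ('a \<times> 'a, 'k::{real_normed_field,euclidean_space}) net \<Rightarrow> nat \<Rightarrow>
     ('a \<times> 'a, 'k) net" where
  "iter_kernel_net K h n \<epsilon> = (\<lambda>(x, y).
     LINT \<xi>:({1..<n} \<rightarrow>\<^sub>E K)|(\<Pi>\<^sub>M i\<in>{1..<n}. lborel).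
       (let \<zeta> = \<xi>(0 := x, n := y) in \<Prod>i<n. h \<epsilon> (\<zeta> i, \<zeta> (Suc i))))"

definition iter_kernel ::
  "'a::euclidean_space set \<Rightarrow> ('a \<times> 'a, 'k::{real_normed_field,euclidean_space}) net set \<Rightarrow> nat \<Rightarrow>
     ('a \<times> 'a, 'k) net set" where
  "iter_kernel X H n =
     (THE L. \<forall>K h. integration_domain X H K \<and> h \<in> H \<longrightarrow> L = Cl (X \<times> X) (iter_kernel_net K h n))"

definition exp_partial_sum ::
  "'a::euclidean_space set \<Rightarrow> ('a \<times> 'a, 'k::{real_normed_field,euclidean_space}) net \<Rightarrow> real \<Rightarrow>
     nat \<Rightarrow> 'a \<times> 'a \<Rightarrow> 'k" where
  "exp_partial_sum K h \<epsilon> N z = (\<Sum>n=1..N. iter_kernel_net K h n \<epsilon> z / fact n)"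

definition is_exp_sum ::
  "'a::euclidean_space set \<Rightarrow> 'a set \<Rightarrow> ('a \<times> 'a, 'k::{real_normed_field,euclidean_space}) net \<Rightarrow>
     ('a \<times> 'a, 'k) net \<Rightarrow> bool" where
  "is_exp_sum X K h s \<longleftrightarrow> (\<forall>\<epsilon>\<in>{0<..1}. smooth_limit (X \<times> X) (exp_partial_sum K h \<epsilon>) (s \<epsilon>))"

definition exp_kernel ::
  "'a::euclidean_space set \<Rightarrow> ('a \<times> 'a, 'k::{real_normed_field,euclidean_space}) net set \<Rightarrow>
     ('a \<times> 'a, 'k) net set" where
  "exp_kernel X H =
     (THE S. \<forall>K h s. integration_domain X H K \<and> h \<in> H \<and> is_exp_sum X K h s \<longrightarrow> S = Cl (X \<times> X) s)"

definition exp_op ::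
  "'a::euclidean_space set \<Rightarrow> ('a \<times> 'a, 'k::{real_normed_field,euclidean_space}) net set \<Rightarrow>
     ('a, 'k) net set \<Rightarrow> ('a, 'k) net set" where
  "exp_op X H F = gen_add X (int_op X (exp_kernel X H) F) F"

end

theory Submission imports Defs begin

text \<open>
  Write \<open>f \<star> g\<close> for the composition \<open>\<integral>\<^sub>K f(x,\<xi>) g(\<xi>,y) d\<xi>\<close> of smooth kernels. A derivative in \<open>x\<close> falls on \<open>f\<close> only
  and one in \<open>y\<close> on \<open>g\<close> only, so for a compact \<open>Q \<supseteq> K\<close> the seminorms \<open>p\<close> over \<open>Q \<times> Q\<close> satisfy
  \<open>p(f \<star> g) \<le> v p(f) p(g)\<close> with \<open>v\<close> the volume of \<open>K\<close>. Since the \<open>n\<close>-th iterated kernel is a \<open>\<star>\<close>-power of \<open>h\<^sub>\<epsilon>\<close>,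
  its seminorms are at most \<open>v\<^bsup>n-1\<^esup> p(h\<^sub>\<epsilon>)\<^bsup>n\<^esup>\<close>, hence the exponential series converges and its sum is bounded by
  \<open>p(h\<^sub>\<epsilon>) exp (v p(h\<^sub>\<epsilon>))\<close>, which is moderate because \<open>p(h\<^sub>\<epsilon>) = O(|ln \<epsilon>|)\<close>. Telescoping a difference of two \<open>\<star>\<close>-powers
  bounds the effect of changing \<open>h\<close> or \<open>K\<close> by a negligible factor times such an exponential. Taking the seminorm of
  the first (last) factor over \<open>R \<times> Q\<close> (\<open>Q \<times> R\<close>) with \<open>R\<close> off a projection of the support of \<open>H\<close> shows that the support of
  the sum lies in the product of these two projections.
\<close>

section \<open>Partial derivatives and smooth functions\<close>

text \<open>Convergence for fixed \<open>\<epsilon>\<close> needs no growth condition on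
  \<open>H\<close>. The logarithmic type matters only when \<open>exp (v * p(h))\<close> is bounded
  in \<open>\<epsilon>\<close>: for a merely moderate kernel this exponential may outgrow every
  power of \<open>1 / \<epsilon>\<close>. The main obstacle is independence of choices:
  \<open>int_op\<close>, \<open>iter_kernel\<close> and \<open>exp_kernel\<close> are defined by
  \<open>THE\<close> over all integration domains \<open>K\<close> and all representatives. Two
  domains need not be nested, so each is compared with the union \<open>K \<union> K'\<close>. The
  extra region \<open>K' - K\<close> need not be compact; its seminorms are taken over
  \<open>K' - interior K\<close>, which is compact and misses both projections of the support.
  Smoothness is stated with directional derivatives indexed by lists of basis vectors. Integrals and
  series are therefore handled by naming a candidate for every such derivative and differentiating
  along lines, without Frechet derivatives or commuting partials. Since each derivative of a
  composed kernel hits one factor only, the bounds at order \<open>l\<close> involve order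
  \<open>l\<close> alone, without Leibniz constants.\<close>

lemma eventually_line_in_open:
  fixes x b :: "'a::real_normed_vector"
  assumes "open \<Omega>" "x \<in> \<Omega>"
  shows "eventually (\<lambda>t. x + t *\<^sub>R b \<in> \<Omega>) (nhds 0)"
proof -
  have "((\<lambda>t. x + t *\<^sub>R b) \<longlongrightarrow> x + 0 *\<^sub>R b) (nhds 0)"
    by (intro tendsto_intros filterlim_ident)
  then show ?thesis
    using topological_tendstoD[OF _ \<open>open \<Omega>\<close>, of _ "x + 0 *\<^sub>R b"] assms by simp
qed

text \<open>Functions are total but meaningful only on \<Omega>; a derivative sees only values near
  the point, and these stay inside the open set \<Omega>.\<close>

lemma partials_cong:
  assumes "open \<Omega>" "\<And>x. x \<in> \<Omega> \<Longrightarrow> f x = g x" "x \<in> \<Omega>"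
  shows "partials bs f x = partials bs g x"
  using assms(3)
proof (induction bs arbitrary: x)
  case Nil
  then show ?case using assms by simp
next
  case (Cons b bs)
  have "eventually (\<lambda>t. x + t *\<^sub>R b \<in> \<Omega>) (nhds 0)"
    by (rule eventually_line_in_open[OF assms(1) Cons.prems])
  then have "eventually (\<lambda>t. t \<in> UNIV \<longrightarrow> partials bs f (x + t *\<^sub>R b) = partials bs g (x + t *\<^sub>R b)) (nhds 0)"
    by (rule eventually_mono) (simp add: Cons.IH)
  then show ?case
    unfolding partials.simps partial_deriv_def by (intro vector_derivative_cong_eq) auto
qed

lemma smooth_on_has_derivative:
  assumes "smooth_on \<Omega> f" "set bs \<subseteq> Basis" "b \<in> Basis" "x \<in> \<Omega>"
  shows "((\<lambda>t. partials bs f (x + t *\<^sub>R b)) has_vector_derivative partials (b # bs) f x) (at 0)"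
  using assms unfolding smooth_on_def partials.simps partial_deriv_def
  by (auto simp: vector_derivative_works)

lemma smooth_on_continuous_partials:
  "smooth_on \<Omega> f \<Longrightarrow> set bs \<subseteq> Basis \<Longrightarrow> continuous_on \<Omega> (partials bs f)"
  unfolding smooth_on_def by blast

lemma smooth_on_imp_continuous_on: "smooth_on \<Omega> f \<Longrightarrow> continuous_on \<Omega> f"
  using smooth_on_continuous_partials[of \<Omega> f "[]"] by simp

lemma smooth_on_subset: "smooth_on \<Omega> f \<Longrightarrow> V \<subseteq> \<Omega> \<Longrightarrow> smooth_on V f"
  unfolding smooth_on_def by (meson continuous_on_subset subsetD)

text \<open>To show smoothness it suffices to guess all the partial derivatives.\<close>

lemma partials_eq_family:
  fixes D :: "'a::euclidean_space list \<Rightarrow> 'a \<Rightarrow> 'k::{real_normed_field,euclidean_space}"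
  assumes "open \<Omega>" and f: "\<And>x. x \<in> \<Omega> \<Longrightarrow> f x = D [] x"
    and der: "\<And>bs b x. set bs \<subseteq> Basis \<Longrightarrow> b \<in> Basis \<Longrightarrow> x \<in> \<Omega> \<Longrightarrow>
      ((\<lambda>t. D bs (x + t *\<^sub>R b)) has_vector_derivative D (b # bs) x) (at 0)"
    and "set bs \<subseteq> Basis" "x \<in> \<Omega>"
  shows "partials bs f x = D bs x"
  using assms(4,5)
proof (induction bs arbitrary: x)
  case Nil
  then show ?case using f by simp
next
  case (Cons b bs)
  have "eventually (\<lambda>t. t \<in> UNIV \<longrightarrow> partials bs f (x + t *\<^sub>R b) = D bs (x + t *\<^sub>R b)) (nhds 0)"
    using eventually_line_in_open[OF \<open>open \<Omega>\<close> Cons.prems(2)]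
    by (rule eventually_mono) (use Cons in auto)
  then have "partials (b # bs) f x = vector_derivative (\<lambda>t. D bs (x + t *\<^sub>R b)) (at 0)"
    unfolding partials.simps partial_deriv_def by (intro vector_derivative_cong_eq) auto
  also have "\<dots> = D (b # bs) x"
    using der[of bs b x] Cons.prems by (intro vector_derivative_at) auto
  finally show ?case .
qed

lemma smooth_on_family:
  fixes D :: "'a::euclidean_space list \<Rightarrow> 'a \<Rightarrow> 'k::{real_normed_field,euclidean_space}"
  assumes "open \<Omega>" and f: "\<And>x. x \<in> \<Omega> \<Longrightarrow> f x = D [] x"
    and cont: "\<And>bs. set bs \<subseteq> Basis \<Longrightarrow> continuous_on \<Omega> (D bs)"
    and der: "\<And>bs b x. set bs \<subseteq> Basis \<Longrightarrow> b \<in> Basis \<Longrightarrow> x \<in> \<Omega> \<Longrightarrow>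
      ((\<lambda>t. D bs (x + t *\<^sub>R b)) has_vector_derivative D (b # bs) x) (at 0)"
  shows "smooth_on \<Omega> f"
  unfolding smooth_on_def
proof (intro allI impI conjI ballI)
  fix bs :: "'a list" assume bs: "set bs \<subseteq> Basis"
  have eq: "partials bs f x = D bs x" if "set bs \<subseteq> Basis" "x \<in> \<Omega>" for bs x
    by (rule partials_eq_family[OF assms(1) f der that])
  show "continuous_on \<Omega> (partials bs f)"
    using cont[OF bs] by (rule continuous_on_eq) (simp add: eq bs)
  fix x b :: 'a assume x: "x \<in> \<Omega>" and b: "b \<in> Basis"
  have "eventually (\<lambda>t. t \<in> UNIV \<longrightarrow> partials bs f (x + t *\<^sub>R b) = D bs (x + t *\<^sub>R b)) (nhds 0)"
    using eventually_line_in_open[OF \<open>open \<Omega>\<close> x, of b] by (rule eventually_mono) (simp add: eq bs)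
  then have "((\<lambda>t. partials bs f (x + t *\<^sub>R b)) has_vector_derivative D (b # bs) x) (at 0)"
    using der[OF bs b x] eq[OF bs x] by (subst has_vector_derivative_cong_ev) auto
  then show "(\<lambda>t. partials bs f (x + t *\<^sub>R b)) differentiable (at 0)"
    by (rule differentiableI_vector)
qed

lemma smooth_on_cong:
  assumes "open \<Omega>" "\<And>x. x \<in> \<Omega> \<Longrightarrow> f x = g x" "smooth_on \<Omega> g"
  shows "smooth_on \<Omega> f"
  by (rule smooth_on_family[where D = "\<lambda>bs. partials bs g"])
     (use assms in \<open>auto intro: smooth_on_has_derivative smooth_on_continuous_partials
        simp del: partials.simps(2)\<close>)

section \<open>Linear operations on smooth functions\<close>

lemma
  assumes "open \<Omega>" "smooth_on \<Omega> f" "smooth_on \<Omega> g"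
  shows smooth_on_add: "smooth_on \<Omega> (\<lambda>x. f x + g x)"
    and partials_add: "\<And>bs x. set bs \<subseteq> Basis \<Longrightarrow> x \<in> \<Omega> \<Longrightarrow>
      partials bs (\<lambda>x. f x + g x) x = partials bs f x + partials bs g x"
proof -
  define D where "D = (\<lambda>bs x. partials bs f x + partials bs g x)"
  have der: "((\<lambda>t. D bs (x + t *\<^sub>R b)) has_vector_derivative D (b # bs) x) (at 0)"
    if "set bs \<subseteq> Basis" "b \<in> Basis" "x \<in> \<Omega>" for bs b x
    unfolding D_def using assms that
    by (intro has_vector_derivative_add smooth_on_has_derivative) auto
  show "smooth_on \<Omega> (\<lambda>x. f x + g x)"
    by (rule smooth_on_family[where D = D])
       (use assms der in \<open>auto simp: D_def intro!: continuous_intros smooth_on_continuous_partials\<close>)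
  show "partials bs (\<lambda>x. f x + g x) x = partials bs f x + partials bs g x"
    if "set bs \<subseteq> Basis" "x \<in> \<Omega>" for bs x
    using partials_eq_family[OF assms(1) _ der that, of "\<lambda>x. f x + g x"] by (simp add: D_def)
qed

lemma
  assumes "open \<Omega>" "smooth_on \<Omega> f"
  shows smooth_on_cmult: "smooth_on \<Omega> (\<lambda>x. c * f x)"
    and partials_cmult: "\<And>bs x. set bs \<subseteq> Basis \<Longrightarrow> x \<in> \<Omega> \<Longrightarrow>
      partials bs (\<lambda>x. c * f x) x = c * partials bs f x"
proof -
  define D where "D = (\<lambda>bs x. c * partials bs f x)"
  have der: "((\<lambda>t. D bs (x + t *\<^sub>R b)) has_vector_derivative D (b # bs) x) (at 0)"
    if "set bs \<subseteq> Basis" "b \<in> Basis" "x \<in> \<Omega>" for bs b x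
    unfolding D_def using assms that
    by (intro has_vector_derivative_mult_right smooth_on_has_derivative) auto
  show "smooth_on \<Omega> (\<lambda>x. c * f x)"
    by (rule smooth_on_family[where D = D])
       (use assms der in \<open>auto simp: D_def intro!: continuous_intros smooth_on_continuous_partials\<close>)
  show "partials bs (\<lambda>x. c * f x) x = c * partials bs f x"
    if "set bs \<subseteq> Basis" "x \<in> \<Omega>" for bs x
    using partials_eq_family[OF assms(1) _ der that, of "\<lambda>x. c * f x"] by (simp add: D_def)
qed

lemma
  assumes "open \<Omega>" "smooth_on \<Omega> f" "smooth_on \<Omega> g"
  shows smooth_on_diff: "smooth_on \<Omega> (\<lambda>x. f x - g x)"
    and partials_diff: "\<And>bs x. set bs \<subseteq> Basis \<Longrightarrow> x \<in> \<Omega> \<Longrightarrow>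
      partials bs (\<lambda>x. f x - g x) x = partials bs f x - partials bs g x"
  using smooth_on_add[OF assms(1,2) smooth_on_cmult[OF assms(1,3), of "-1"]]
    partials_add[OF assms(1,2) smooth_on_cmult[OF assms(1,3), of "-1"]]
    partials_cmult[OF assms(1,3), of _ _ "-1"] by auto

lemma partials_zero: "partials bs (\<lambda>x. 0 :: 'k::{real_normed_field,euclidean_space}) x = 0"
proof (induction bs arbitrary: x)
  case (Cons b bs)
  then have "partials bs (\<lambda>x. 0::'k) = (\<lambda>x. 0)" by blast
  then show ?case by (simp add: partial_deriv_def)
qed simp

lemma smooth_on_zero: "smooth_on \<Omega> (\<lambda>x. 0)"
proof -
  have "partials bs (\<lambda>x. 0::'b) = (\<lambda>x. 0)" for bs :: "'a list"
    using partials_zero by auto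
  then show ?thesis by (simp add: smooth_on_def)
qed

lemma
  assumes "open \<Omega>" "\<And>i. i \<in> I \<Longrightarrow> smooth_on \<Omega> (f i)"
  shows smooth_on_sum: "smooth_on \<Omega> (\<lambda>x. \<Sum>i\<in>I. f i x)"
    and partials_sum: "\<And>bs x. set bs \<subseteq> Basis \<Longrightarrow> x \<in> \<Omega> \<Longrightarrow>
      partials bs (\<lambda>x. \<Sum>i\<in>I. f i x) x = (\<Sum>i\<in>I. partials bs (f i) x)"
proof -
  have "smooth_on \<Omega> (\<lambda>x. \<Sum>i\<in>I. f i x) \<and> (\<forall>bs x. set bs \<subseteq> Basis \<longrightarrow> x \<in> \<Omega> \<longrightarrow>
      partials bs (\<lambda>x. \<Sum>i\<in>I. f i x) x = (\<Sum>i\<in>I. partials bs (f i) x))"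
    using assms(2)
  proof (induction I rule: infinite_finite_induct)
    case (insert i I)
    then show ?case
      using smooth_on_add[OF assms(1), of "f i" "\<lambda>x. \<Sum>i\<in>I. f i x"]
        partials_add[OF assms(1), of "f i" "\<lambda>x. \<Sum>i\<in>I. f i x"] by simp
  qed (auto simp: smooth_on_zero partials_zero)
  then show "smooth_on \<Omega> (\<lambda>x. \<Sum>i\<in>I. f i x)"
    and "\<And>bs x. set bs \<subseteq> Basis \<Longrightarrow> x \<in> \<Omega> \<Longrightarrow>
      partials bs (\<lambda>x. \<Sum>i\<in>I. f i x) x = (\<Sum>i\<in>I. partials bs (f i) x)" by auto
qed

section \<open>Seminorms\<close>

text \<open>Because 0 is inserted into the supremum, an upper bound has to be nonnegative even when
  \<open>K\<close> is empty.\<close>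

lemma seminorm_leI:
  assumes "0 \<le> B"
    and "\<And>x bs. x \<in> K \<Longrightarrow> set bs \<subseteq> Basis \<Longrightarrow> length bs \<le> l \<Longrightarrow> norm (partials bs f x) \<le> B"
  shows "seminorm K l f \<le> B"
  unfolding seminorm_def using assms by (intro cSup_least) auto

text \<open>A supremum of reals says something only for a bounded set. Here it is bounded: there are
  finitely many lists of length at most \<open>l\<close>, and each derivative is continuous on the
  compact \<open>K\<close>.\<close>

lemma bdd_above_seminorm:
  assumes "compact K" "K \<subseteq> \<Omega>" "smooth_on \<Omega> f"
  shows "bdd_above (insert 0 {norm (partials bs f x) | x bs. x \<in> K \<and> set bs \<subseteq> Basis \<and> length bs \<le> l})"
proof -
  have "{norm (partials bs f x) | x bs. x \<in> K \<and> set bs \<subseteq> Basis \<and> length bs \<le> l}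
      = (\<Union>bs\<in>{bs. set bs \<subseteq> Basis \<and> length bs \<le> l}. (\<lambda>x. norm (partials bs f x)) ` K)" by auto
  also have "bdd_above \<dots>"
  proof (subst bdd_above_UN)
    show "finite {bs. set bs \<subseteq> (Basis::'a set) \<and> length bs \<le> l}"
      by (intro finite_lists_length_le finite_Basis)
    show "\<forall>bs\<in>{bs. set bs \<subseteq> Basis \<and> length bs \<le> l}. bdd_above ((\<lambda>x. norm (partials bs f x)) ` K)"
      using assms by (auto intro!: bounded_imp_bdd_above compact_imp_bounded compact_continuous_image
          continuous_intros continuous_on_subset[OF smooth_on_continuous_partials])
  qed
  finally show ?thesis by simp
qed

lemma norm_partials_le_seminorm:
  assumes "compact K" "K \<subseteq> \<Omega>" "smooth_on \<Omega> f" "x \<in> K" "set bs \<subseteq> Basis" "length bs \<le> l"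
  shows "norm (partials bs f x) \<le> seminorm K l f"
  unfolding seminorm_def using assms
  by (intro cSup_upper bdd_above_seminorm[OF assms(1-3)]) auto

lemma norm_le_seminorm:
  assumes "compact K" "K \<subseteq> \<Omega>" "smooth_on \<Omega> f" "x \<in> K"
  shows "norm (f x) \<le> seminorm K l f"
  using norm_partials_le_seminorm[OF assms, of "[]" l] by simp

lemma seminorm_nonneg:
  assumes "compact K" "K \<subseteq> \<Omega>" "smooth_on \<Omega> f"
  shows "0 \<le> seminorm K l f"
  unfolding seminorm_def by (intro cSup_upper bdd_above_seminorm[OF assms(1-3)]) auto

lemma seminorm_mono:
  assumes "compact K" "K \<subseteq> \<Omega>" "smooth_on \<Omega> f" "K' \<subseteq> K"
  shows "seminorm K' l f \<le> seminorm K l f"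
  using assms by (intro seminorm_leI seminorm_nonneg[OF assms(1-3)] norm_partials_le_seminorm) auto

lemma seminorm_cong:
  assumes "open \<Omega>" "K \<subseteq> \<Omega>" "\<And>x. x \<in> \<Omega> \<Longrightarrow> f x = g x"
  shows "seminorm K l f = seminorm K l g"
proof -
  have "{norm (partials bs f x) | x bs. x \<in> K \<and> set bs \<subseteq> Basis \<and> length bs \<le> l} =
     {norm (partials bs g x) | x bs. x \<in> K \<and> set bs \<subseteq> Basis \<and> length bs \<le> l}"
    by (intro Collect_cong ex_cong1) (use partials_cong[OF assms(1,3)] assms(2) in \<open>auto simp: subset_iff\<close>)
  then show ?thesis by (simp add: seminorm_def)
qed

lemma seminorm_zero: "seminorm K l (\<lambda>x. 0) = 0"
proof -
  have "insert 0 {norm (partials bs (\<lambda>x. 0::'b) x) | x bs. x \<in> K \<and> set bs \<subseteq> Basis \<and> length bs \<le> l} = {0}"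
    by (auto simp: partials_zero)
  then show ?thesis unfolding seminorm_def by (simp only: cSup_singleton)
qed

lemma seminorm_add:
  assumes "open \<Omega>" "compact K" "K \<subseteq> \<Omega>" "smooth_on \<Omega> f" "smooth_on \<Omega> g"
  shows "seminorm K l (\<lambda>x. f x + g x) \<le> seminorm K l f + seminorm K l g"
proof (rule seminorm_leI)
  show "0 \<le> seminorm K l f + seminorm K l g"
    using assms by (intro add_nonneg_nonneg seminorm_nonneg) auto
  fix x bs assume *: "x \<in> K" "set bs \<subseteq> (Basis::'a set)" "length bs \<le> l"
  have "norm (partials bs (\<lambda>x. f x + g x) x) \<le> norm (partials bs f x) + norm (partials bs g x)"
    using partials_add[OF assms(1,4,5) *(2), of x] * assms(3) by (auto simp: subset_iff norm_triangle_ineq)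
  also have "\<dots> \<le> seminorm K l f + seminorm K l g"
    using assms * by (intro add_mono norm_partials_le_seminorm)
  finally show "norm (partials bs (\<lambda>x. f x + g x) x) \<le> seminorm K l f + seminorm K l g" .
qed

lemma seminorm_cmult:
  assumes "open \<Omega>" "compact K" "K \<subseteq> \<Omega>" "smooth_on \<Omega> f"
  shows "seminorm K l (\<lambda>x. c * f x) \<le> norm c * seminorm K l f"
proof (rule seminorm_leI)
  show "0 \<le> norm c * seminorm K l f"
    using assms by (intro mult_nonneg_nonneg seminorm_nonneg) auto
  fix x bs assume *: "x \<in> K" "set bs \<subseteq> (Basis::'a set)" "length bs \<le> l"
  have "norm (partials bs (\<lambda>x. c * f x) x) = norm c * norm (partials bs f x)"
    using partials_cmult[OF assms(1,4) *(2), of x] * assms(3) by (auto simp: norm_mult)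
  also have "\<dots> \<le> norm c * seminorm K l f"
    using assms * by (intro mult_left_mono norm_partials_le_seminorm) auto
  finally show "norm (partials bs (\<lambda>x. c * f x) x) \<le> norm c * seminorm K l f" .
qed

lemma seminorm_diff:
  assumes "open \<Omega>" "compact K" "K \<subseteq> \<Omega>" "smooth_on \<Omega> f" "smooth_on \<Omega> g"
  shows "seminorm K l (\<lambda>x. f x - g x) \<le> seminorm K l f + seminorm K l g"
  using seminorm_add[OF assms(1-4) smooth_on_cmult[OF assms(1,5), of "-1"], of l]
    seminorm_cmult[OF assms(1-3,5), of l "-1"] by auto

lemma seminorm_sum:
  assumes "open \<Omega>" "compact K" "K \<subseteq> \<Omega>" "\<And>i. i \<in> I \<Longrightarrow> smooth_on \<Omega> (f i)"
  shows "seminorm K l (\<lambda>x. \<Sum>i\<in>I. f i x) \<le> (\<Sum>i\<in>I. seminorm K l (f i))"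
  using assms(4)
proof (induction I rule: infinite_finite_induct)
  case (insert i I)
  then show ?case
    using seminorm_add[OF assms(1-3), of "f i" "\<lambda>x. \<Sum>i\<in>I. f i x" l] smooth_on_sum[OF assms(1), of I f]
    by fastforce
qed (auto simp: seminorm_zero)

text \<open>Carries estimates from partial sums over to their limits. It serves both for the
  difference of two exponential sums and, with the zero sequence as \<open>s'\<close>, for the size
  of one of them.\<close>

lemma seminorm_of_limit_le:
  assumes "open \<Omega>" "compact K" "K \<subseteq> \<Omega>" "smooth_limit \<Omega> s g" "smooth_limit \<Omega> s' g'"
    and le: "\<And>N. seminorm K l (\<lambda>x. s N x - s' N x) \<le> B"
  shows "seminorm K l (\<lambda>x. g x - g' x) \<le> B"
proof -
  have sm: "smooth_on \<Omega> (s N)" "smooth_on \<Omega> g" "smooth_on \<Omega> (s' N)" "smooth_on \<Omega> g'" for N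
    using assms unfolding smooth_limit_def by auto
  have "(\<lambda>N. seminorm K l (\<lambda>x. s N x - g x) + seminorm K l (\<lambda>x. s' N x - g' x) + B) \<longlonglongrightarrow> 0 + 0 + B"
    using assms unfolding smooth_limit_def by (intro tendsto_intros) auto
  moreover have "seminorm K l (\<lambda>x. g x - g' x)
      \<le> seminorm K l (\<lambda>x. s N x - g x) + seminorm K l (\<lambda>x. s' N x - g' x) + B" for N
  proof -
    have "seminorm K l (\<lambda>x. g x - g' x) = seminorm K l (\<lambda>x. ((s' N x - g' x) - (s N x - g x)) + (s N x - s' N x))"
      by (simp add: algebra_simps)
    also have "\<dots> \<le> seminorm K l (\<lambda>x. (s' N x - g' x) - (s N x - g x)) + seminorm K l (\<lambda>x. s N x - s' N x)"
      by (intro seminorm_add[OF assms(1-3)] smooth_on_diff assms sm)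
    also have "seminorm K l (\<lambda>x. (s' N x - g' x) - (s N x - g x)) \<le> seminorm K l (\<lambda>x. s' N x - g' x) + seminorm K l (\<lambda>x. s N x - g x)"
      by (intro seminorm_diff[OF assms(1-3)] smooth_on_diff assms sm)
    finally show ?thesis using le[of N] by linarith
  qed
  ultimately show ?thesis
    by (intro LIMSEQ_le_const[where X = "\<lambda>N. _ N"]) auto
qed

section \<open>Integrals and series depending on a parameter\<close>

text \<open>The derivative hypotheses concern the parameter value 0 only. Moving the base point to
  \<open>x + s *\<^sub>R b\<close> turns them into a derivative at every \<open>s\<close>, as the
  mean value inequality requires.\<close>

lemma has_vector_derivative_along_line:
  fixes f :: "'a::real_normed_vector \<Rightarrow> 'b::real_normed_vector"
  assumes "((\<lambda>t. f ((x + s *\<^sub>R b) + t *\<^sub>R b)) has_vector_derivative D) (at 0)"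
  shows "((\<lambda>t. f (x + t *\<^sub>R b)) has_vector_derivative D) (at s)"
proof -
  have "((\<lambda>t. f ((x + s *\<^sub>R b) + t *\<^sub>R b)) has_vector_derivative D) (at (s - s))"
    using assms by simp
  then have "((\<lambda>t. f ((x + s *\<^sub>R b) + (t - s) *\<^sub>R b)) has_vector_derivative D) (at s)"
    using vector_diff_chain_at[of "\<lambda>t. t - s" 1 s "\<lambda>t. f ((x + s *\<^sub>R b) + t *\<^sub>R b)" D]
      has_vector_derivative_diff[OF has_vector_derivative_id has_vector_derivative_const[of s], of "at s"]
    by (simp add: o_def)
  then show ?thesis by (simp add: algebra_simps)
qed

section \<open>Integrals over Borel subsets of compact sets\<close>

lemma set_integrable_continuous_on:
  fixes f :: "'b::euclidean_space \<Rightarrow> 'k::euclidean_space"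
  assumes "compact K" "continuous_on K f" "A \<in> sets borel" "A \<subseteq> K"
  shows "set_integrable lborel A f"
proof -
  have "set_integrable lborel K f"
    using borel_integrable_compact[OF assms(1,2)] by (simp add: set_integrable_def)
  then show ?thesis by (rule set_integrable_subset) (use assms in auto)
qed

lemma measure_subset_compact_le:
  fixes K :: "'b::euclidean_space set"
  assumes "compact K" "A \<subseteq> K" "A \<in> sets borel"
  shows "measure lborel A \<le> measure lborel K" "emeasure lborel A < \<infinity>"
proof -
  have K: "emeasure lborel K < \<infinity>" by (rule emeasure_compact_finite[OF assms(1)])
  have "emeasure lborel A \<le> emeasure lborel K"
    using assms by (intro emeasure_mono) (auto simp: borel_compact)
  then show "emeasure lborel A < \<infinity>" using K by auto
  show "measure lborel A \<le> measure lborel K"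
    using assms K by (intro measure_mono_fmeasurable) (auto simp: fmeasurable_def borel_compact)
qed

lemma norm_set_integral_le:
  fixes f :: "'b::euclidean_space \<Rightarrow> 'k::euclidean_space"
  assumes "compact K" "A \<subseteq> K" "A \<in> sets borel" "set_integrable lborel A f"
    and "\<And>x. x \<in> A \<Longrightarrow> norm (f x) \<le> B"
  shows "norm (LINT x:A|lborel. f x) \<le> B * measure lborel A"
proof -
  have fin: "emeasure lborel A < \<infinity>" by (rule measure_subset_compact_le[OF assms(1-3)])
  have "norm (LINT x:A|lborel. f x) \<le> (LINT x:A|lborel. B)"
    unfolding set_lebesgue_integral_def
  proof (rule Bochner_Integration.integral_norm_bound_integral)
    show "integrable lborel (\<lambda>x. indicat_real A x *\<^sub>R f x)"
      using assms(4) by (simp add: set_integrable_def)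
    show "integrable lborel (\<lambda>x. indicat_real A x *\<^sub>R B)"
      using assms(3) fin by auto
  qed (use assms(5) in \<open>auto simp: indicator_def\<close>)
  then show ?thesis using fin assms by (simp add: mult.commute set_lebesgue_integral_def)
qed

text \<open>Uniform continuity on a closed ball times \<open>K\<close> gives a distance
  \<open>d\<close> that works for all \<open>\<xi>\<close> at once. This uniformity replaces
  dominated convergence in the continuity and differentiation of parametric integrals.\<close>

lemma uniformly_close_on_compact:
  fixes \<phi> :: "'p::euclidean_space \<Rightarrow> 'b::euclidean_space \<Rightarrow> 'k::real_normed_vector"
  assumes "open U" "compact K" "continuous_on (U \<times> K) (\<lambda>(p, \<xi>). \<phi> p \<xi>)" "p \<in> U" "0 < e"
  obtains d where "0 < d" "ball p d \<subseteq> U"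
    "\<And>q \<xi>. q \<in> ball p d \<Longrightarrow> \<xi> \<in> K \<Longrightarrow> norm (\<phi> q \<xi> - \<phi> p \<xi>) \<le> e"
proof -
  obtain r where r: "0 < r" "cball p r \<subseteq> U"
    using \<open>open U\<close> \<open>p \<in> U\<close> open_contains_cball by blast
  have "uniformly_continuous_on (cball p r \<times> K) (\<lambda>(p, \<xi>). \<phi> p \<xi>)"
    using r assms(2,3) by (intro compact_uniformly_continuous compact_Times)
      (auto intro: continuous_on_subset)
  then obtain d where d: "0 < d"
    "\<And>z z'. z \<in> cball p r \<times> K \<Longrightarrow> z' \<in> cball p r \<times> K \<Longrightarrow> dist z' z < d \<Longrightarrow>
        dist (case_prod \<phi> z') (case_prod \<phi> z) < e"
    unfolding uniformly_continuous_on_def using \<open>0 < e\<close> by metis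
  show thesis
  proof (rule that[of "min d r"])
    fix q \<xi> assume q: "q \<in> ball p (min d r)" and \<xi>: "\<xi> \<in> K"
    have "dist (q, \<xi>) (p, \<xi>) < d" using q by (simp add: dist_Pair_Pair dist_commute)
    then show "norm (\<phi> q \<xi> - \<phi> p \<xi>) \<le> e"
      using d(2)[of "(p, \<xi>)" "(q, \<xi>)"] q \<xi> r by (auto simp: dist_norm)
  qed (use d r in auto)
qed

lemma continuous_on_slice:
  assumes "continuous_on (U \<times> K) (\<lambda>(p, \<xi>). \<phi> p \<xi>)" "p \<in> U"
  shows "continuous_on K (\<phi> p)"
proof -
  have "continuous_on K (\<lambda>\<xi>. (\<lambda>(p, \<xi>). \<phi> p \<xi>) (p, \<xi>))"
    by (rule continuous_on_compose2[OF assms(1)]) (use assms(2) in \<open>auto intro!: continuous_intros\<close>)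
  then show ?thesis by simp
qed

text \<open>The integral runs over a Borel subset \<open>A\<close> of the compact \<open>K\<close>,
  because the comparison of two domains also integrates over a difference
  \<open>K' - K\<close>.\<close>

lemma continuous_on_parametric_integral:
  fixes \<phi> :: "'p::euclidean_space \<Rightarrow> 'b::euclidean_space \<Rightarrow> 'k::euclidean_space"
  assumes "open U" "compact K" "A \<in> sets borel" "A \<subseteq> K"
    and "continuous_on (U \<times> K) (\<lambda>(p, \<xi>). \<phi> p \<xi>)"
  shows "continuous_on U (\<lambda>p. LINT \<xi>:A|lborel. \<phi> p \<xi>)"
  unfolding continuous_on_iff
proof (intro ballI allI impI)
  fix p and e :: real assume p: "p \<in> U" and e: "0 < e"
  define m where "m = measure lborel A"
  have m: "m \<ge> 0" by (simp add: m_def)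
  \<comment> \<open>\<open>m + 1\<close> instead of \<open>m\<close> covers a set \<open>A\<close>
    of measure zero.\<close>
  have "e / (m + 1) > 0" using e m by simp
  from uniformly_close_on_compact[OF assms(1,2,5) p this]
  obtain d where d: "0 < d" "ball p d \<subseteq> U"
    "\<And>q \<xi>. q \<in> ball p d \<Longrightarrow> \<xi> \<in> K \<Longrightarrow> norm (\<phi> q \<xi> - \<phi> p \<xi>) \<le> e / (m + 1)" by blast
  have int: "set_integrable lborel A (\<phi> q)" if "q \<in> U" for q
    by (rule set_integrable_continuous_on[OF assms(2) continuous_on_slice[OF assms(5) that] assms(3,4)])
  show "\<exists>d>0. \<forall>q\<in>U. dist q p < d \<longrightarrow>
      dist (LINT \<xi>:A|lborel. \<phi> q \<xi>) (LINT \<xi>:A|lborel. \<phi> p \<xi>) < e"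
  proof (intro exI[of _ d] conjI ballI impI d(1))
    fix q assume q: "q \<in> U" "dist q p < d"
    have "norm (LINT \<xi>:A|lborel. \<phi> q \<xi> - \<phi> p \<xi>) \<le> e / (m + 1) * measure lborel A"
      using assms(4) d(3)[of q] q p
      by (intro norm_set_integral_le[OF assms(2,4,3)] set_integral_diff int) (auto simp: dist_commute)
    also have "\<dots> < e" using e m by (simp add: m_def[symmetric] field_simps)
    finally show "dist (LINT \<xi>:A|lborel. \<phi> q \<xi>) (LINT \<xi>:A|lborel. \<phi> p \<xi>) < e"
      using set_integral_diff(2)[OF int[OF q(1)] int[OF p]] by (simp add: dist_norm)
  qed
qed

text \<open>The mean value inequality bounds the linearization error of \<open>\<phi>\<close> by
  \<open>\<bar>t\<bar>\<close> times the oscillation of \<open>\<psi>\<close>, which is small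
  uniformly in \<xi>; integrating over \<open>A\<close> keeps the bound.\<close>

lemma has_vector_derivative_parametric_integral:
  fixes \<phi> :: "'p::euclidean_space \<Rightarrow> 'b::euclidean_space \<Rightarrow> 'k::euclidean_space"
  assumes "open U" "compact K" "A \<in> sets borel" "A \<subseteq> K"
    and cont: "continuous_on (U \<times> K) (\<lambda>(p, \<xi>). \<phi> p \<xi>)" "continuous_on (U \<times> K) (\<lambda>(p, \<xi>). \<psi> p \<xi>)"
    and der: "\<And>p \<xi>. p \<in> U \<Longrightarrow> \<xi> \<in> K \<Longrightarrow>
      ((\<lambda>t. \<phi> (p + t *\<^sub>R b) \<xi>) has_vector_derivative \<psi> p \<xi>) (at 0)"
    and p: "p \<in> U"
  shows "((\<lambda>t. LINT \<xi>:A|lborel. \<phi> (p + t *\<^sub>R b) \<xi>) has_vector_derivative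
      (LINT \<xi>:A|lborel. \<psi> p \<xi>)) (at 0)"
  unfolding has_vector_derivative_def has_derivative_at_alt
proof (intro conjI allI impI bounded_linear_scaleR_left)
  fix e :: real assume e: "0 < e"
  define m where "m = measure lborel A"
  have m: "m \<ge> 0" by (simp add: m_def)
  have em: "e / (m + 1) > 0" using e m by simp
  from uniformly_close_on_compact[OF assms(1,2) cont(2) p em]
  obtain d where d: "0 < d" "ball p d \<subseteq> U"
    "\<And>q \<xi>. q \<in> ball p d \<Longrightarrow> \<xi> \<in> K \<Longrightarrow> norm (\<psi> q \<xi> - \<psi> p \<xi>) \<le> e / (m + 1)" by blast
  \<comment> \<open>The summand 1 keeps the quotient meaningful for \<open>b = 0\<close>; for
    \<open>\<bar>t\<bar> < r\<close> the point \<open>p + t *\<^sub>R b\<close> stays within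
    distance \<open>d\<close> of \<open>p\<close>.\<close>
  define r where "r = d / (norm b + 1)"
  have r: "0 < r" using d(1) by (simp add: r_def add_nonneg_pos)
  have near: "p + t *\<^sub>R b \<in> ball p d" if "\<bar>t\<bar> < r" for t
  proof -
    have "\<bar>t\<bar> * norm b \<le> \<bar>t\<bar> * (norm b + 1)" by (simp add: mult_left_mono)
    also have "\<dots> < d" using that by (simp add: r_def pos_less_divide_eq add_nonneg_pos)
    finally show ?thesis by (simp add: dist_norm)
  qed
  have int: "set_integrable lborel A (\<phi> q)" "set_integrable lborel A (\<psi> q)" if "q \<in> U" for q
    using cont[THEN continuous_on_slice, OF that]
    by (auto intro: set_integrable_continuous_on[OF assms(2) _ assms(3,4)])
  have lin: "norm (\<phi> (p + t *\<^sub>R b) \<xi> - \<phi> p \<xi> - t *\<^sub>R \<psi> p \<xi>) \<le> \<bar>t\<bar> * (e / (m + 1))"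
    if t: "\<bar>t\<bar> < r" and \<xi>: "\<xi> \<in> K" for t \<xi>
  proof -
    have "norm (\<phi> (p + t *\<^sub>R b) \<xi> - \<phi> (p + 0 *\<^sub>R b) \<xi> - (t - 0) *\<^sub>R \<psi> (p + 0 *\<^sub>R b) \<xi>)
        \<le> norm (t - 0) * (e / (m + 1))"
    proof (rule vector_differentiable_bound_linearization[where S = "{-r<..<r}"
          and f = "\<lambda>t. \<phi> (p + t *\<^sub>R b) \<xi>" and f' = "\<lambda>t. \<psi> (p + t *\<^sub>R b) \<xi>" and ?x0.0 = 0])
      show "((\<lambda>t. \<phi> (p + t *\<^sub>R b) \<xi>) has_vector_derivative \<psi> (p + s *\<^sub>R b) \<xi>)
          (at s within {-r<..<r})" if "s \<in> {-r<..<r}" for s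
        by (rule has_vector_derivative_at_within, rule has_vector_derivative_along_line
            [of "\<lambda>q. \<phi> q \<xi>" p s b], rule der) (use near[of s] that d(2) \<xi> in auto)
      show "closed_segment 0 t \<subseteq> {-r<..<r}"
        using t r by (auto simp: closed_segment_eq_real_ivl split: if_splits)
      show "norm (\<psi> (p + s *\<^sub>R b) \<xi> - \<psi> (p + 0 *\<^sub>R b) \<xi>) \<le> e / (m + 1)" if "s \<in> {-r<..<r}" for s
        using d(3)[OF near \<xi>, of s] that by auto
    qed (use r in auto)
    then show ?thesis by simp
  qed
  show "\<exists>d>0. \<forall>t. norm (t - 0) < d \<longrightarrow>
      norm ((LINT \<xi>:A|lborel. \<phi> (p + t *\<^sub>R b) \<xi>) - (LINT \<xi>:A|lborel. \<phi> (p + 0 *\<^sub>R b) \<xi>)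
        - (t - 0) *\<^sub>R (LINT \<xi>:A|lborel. \<psi> p \<xi>)) \<le> e * norm (t - 0)"
  proof (intro exI[of _ r] conjI r allI impI)
    fix t :: real assume "norm (t - 0) < r"
    then have t: "\<bar>t\<bar> < r" by simp
    have q: "p + t *\<^sub>R b \<in> U" using near[OF t] d(2) by auto
    have "(LINT \<xi>:A|lborel. \<phi> (p + t *\<^sub>R b) \<xi>) - (LINT \<xi>:A|lborel. \<phi> p \<xi>)
        - t *\<^sub>R (LINT \<xi>:A|lborel. \<psi> p \<xi>)
      = (LINT \<xi>:A|lborel. \<phi> (p + t *\<^sub>R b) \<xi> - \<phi> p \<xi> - t *\<^sub>R \<psi> p \<xi>)"
      using int[OF q] int[OF p] by (simp add: set_integral_diff)
    also have "norm \<dots> \<le> (\<bar>t\<bar> * (e / (m + 1))) * measure lborel A"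
      using assms(4) lin[OF t] int[OF q] int[OF p]
      by (intro norm_set_integral_le[OF assms(2,4,3)] set_integral_diff set_integrable_scaleR_right) auto
    also have "\<dots> = e * \<bar>t\<bar> * (m / (m + 1))" by (simp add: m_def)
    also have "\<dots> \<le> e * \<bar>t\<bar> * 1" using e m by (intro mult_left_mono) auto
    finally show "norm ((LINT \<xi>:A|lborel. \<phi> (p + t *\<^sub>R b) \<xi>) - (LINT \<xi>:A|lborel. \<phi> (p + 0 *\<^sub>R b) \<xi>)
        - (t - 0) *\<^sub>R (LINT \<xi>:A|lborel. \<psi> p \<xi>)) \<le> e * norm (t - 0)" by simp
  qed
qed

lemma
  fixes D :: "'p::euclidean_space list \<Rightarrow> 'p \<Rightarrow> 'b::euclidean_space \<Rightarrow> 'k::{real_normed_field,euclidean_space}"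
  assumes "open U" "compact K" "A \<in> sets borel" "A \<subseteq> K"
    and cont: "\<And>bs. set bs \<subseteq> Basis \<Longrightarrow> continuous_on (U \<times> K) (\<lambda>(p, \<xi>). D bs p \<xi>)"
    and der: "\<And>bs b p \<xi>. set bs \<subseteq> Basis \<Longrightarrow> b \<in> Basis \<Longrightarrow> p \<in> U \<Longrightarrow> \<xi> \<in> K \<Longrightarrow>
      ((\<lambda>t. D bs (p + t *\<^sub>R b) \<xi>) has_vector_derivative D (b # bs) p \<xi>) (at 0)"
  shows smooth_on_parametric_integral: "smooth_on U (\<lambda>p. LINT \<xi>:A|lborel. D [] p \<xi>)"
    and partials_parametric_integral: "\<And>bs p. set bs \<subseteq> Basis \<Longrightarrow> p \<in> U \<Longrightarrow>
      partials bs (\<lambda>p. LINT \<xi>:A|lborel. D [] p \<xi>) p = (LINT \<xi>:A|lborel. D bs p \<xi>)"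
proof -
  define E where "E = (\<lambda>bs p. LINT \<xi>:A|lborel. D bs p \<xi>)"
  have E: "((\<lambda>t. E bs (p + t *\<^sub>R b)) has_vector_derivative E (b # bs) p) (at 0)"
    if "set bs \<subseteq> Basis" "b \<in> Basis" "p \<in> U" for bs b p
    unfolding E_def
    by (rule has_vector_derivative_parametric_integral[OF assms(1-4) _ _ _ that(3)])
       (use that in \<open>auto intro!: cont der\<close>)
  show "smooth_on U (\<lambda>p. LINT \<xi>:A|lborel. D [] p \<xi>)"
    by (rule smooth_on_family[where D = E, OF assms(1) _ _ E])
       (auto simp: E_def intro: continuous_on_parametric_integral[OF assms(1-4)] cont)
  show "partials bs (\<lambda>p. LINT \<xi>:A|lborel. D [] p \<xi>) p = (LINT \<xi>:A|lborel. D bs p \<xi>)"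
    if "set bs \<subseteq> Basis" "p \<in> U" for bs p
    using partials_eq_family[OF assms(1) _ E that, of "E []"] by (simp add: E_def)
qed

text \<open>For each compact set and order a summable majorant, which may depend on both, makes
  every differentiated series converge uniformly by the Weierstrass test. The sums
  \<open>D bs\<close> are then the candidates for the derivatives of the limit.\<close>

lemma smooth_limit_series:
  fixes u :: "nat \<Rightarrow> 'a::euclidean_space \<Rightarrow> 'k::{real_normed_field,euclidean_space}"
  assumes \<Omega>: "open \<Omega>" and u: "\<And>n. smooth_on \<Omega> (u n)"
    and bound: "\<And>Q l. compact Q \<Longrightarrow> Q \<subseteq> \<Omega> \<Longrightarrow> \<exists>b. summable b \<and> (\<forall>n. seminorm Q l (u n) \<le> b n)"
  shows "smooth_limit \<Omega> (\<lambda>N x. \<Sum>n<N. u n x) (\<lambda>x. \<Sum>n. u n x)"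
proof -
  define D where "D = (\<lambda>bs x. \<Sum>n. partials bs (u n) x)"
  have unif: "\<exists>b. summable b \<and> (\<forall>n. \<forall>x\<in>Q. norm (partials bs (u n) x) \<le> b n)"
    if Q: "compact Q" "Q \<subseteq> \<Omega>" "set bs \<subseteq> Basis" for Q bs
  proof -
    obtain b where b: "summable b" "\<And>n. seminorm Q (length bs) (u n) \<le> b n"
      using bound[OF Q(1,2)] by blast
    have "norm (partials bs (u n) x) \<le> b n" if "x \<in> Q" for n x
      using norm_partials_le_seminorm[OF \<open>compact Q\<close> \<open>Q \<subseteq> \<Omega>\<close> u that \<open>set bs \<subseteq> Basis\<close>, of "length bs" n] b(2)[of n]
      by simp
    then show ?thesis using b(1) by blast
  qed
  have lim: "uniform_limit Q (\<lambda>N x. \<Sum>n<N. partials bs (u n) x) (D bs) sequentially"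
    if Q: "compact Q" "Q \<subseteq> \<Omega>" "set bs \<subseteq> Basis" for Q bs
    unfolding D_def using unif[OF Q] by (elim exE conjE, intro Weierstrass_m_test) auto
  have summ: "summable (\<lambda>n. partials bs (u n) x)" if "x \<in> \<Omega>" "set bs \<subseteq> Basis" for bs x
    using unif[of "{x}" bs] that by (auto intro: summable_comparison_test)
  have cont: "continuous_on \<Omega> (D bs)" if bs: "set bs \<subseteq> Basis" for bs
  proof (rule continuous_at_imp_continuous_on, intro ballI)
    fix x assume "x \<in> \<Omega>"
    then obtain r where r: "0 < r" "cball x r \<subseteq> \<Omega>" using \<Omega> open_contains_cball by blast
    have "continuous_on (cball x r) (D bs)"
      by (rule uniform_limit_theorem[OF _ lim[OF compact_cball r(2) bs]])
         (use r u bs in \<open>auto intro!: always_eventually continuous_on_sum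
            continuous_on_subset[OF smooth_on_continuous_partials]\<close>)
    then have "continuous_on (ball x r) (D bs)" by (rule continuous_on_subset) auto
    then show "isCont (D bs) x" using r by (simp add: continuous_on_eq_continuous_at)
  qed
  have der: "((\<lambda>t. D bs (x + t *\<^sub>R b)) has_vector_derivative D (b # bs) x) (at 0)"
    if bs: "set bs \<subseteq> Basis" and b: "b \<in> Basis" and x: "x \<in> \<Omega>" for bs b x
  proof -
    obtain r where r: "0 < r" "cball x r \<subseteq> \<Omega>" using \<Omega> x open_contains_cball by blast
    have in_ball: "x + t *\<^sub>R b \<in> cball x r" if "t \<in> {-r<..<r}" for t
      using that b by (auto simp: dist_norm)
    have *: "((\<lambda>t. partials bs (u n) (x + t *\<^sub>R b)) has_vector_derivative
        partials (b # bs) (u n) (x + t *\<^sub>R b)) (at t within {-r<..<r})" if "t \<in> {-r<..<r}" for n t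
      by (rule has_vector_derivative_at_within,
          rule has_vector_derivative_along_line[of "partials bs (u n)" x t b],
          rule smooth_on_has_derivative[OF u bs b]) (use in_ball[OF that] r in auto)
    \<comment> \<open>Termwise differentiation is a one-dimensional matter: only the segment through
      \<open>x\<close> in direction \<open>b\<close> is considered, and it lies in
      \<open>cball x r\<close>, where the differentiated series converges uniformly.\<close>
    have "\<exists>g. \<forall>t\<in>{-r<..<r}. (\<lambda>n. partials bs (u n) (x + t *\<^sub>R b)) sums g t \<and>
        (g has_derivative (\<lambda>h. h *\<^sub>R D (b # bs) (x + t *\<^sub>R b))) (at t within {-r<..<r})"
    proof (rule has_derivative_series[where f' = "\<lambda>n t h. h *\<^sub>R partials (b # bs) (u n) (x + t *\<^sub>R b)"])
      show "\<And>n t. t \<in> {-r<..<r} \<Longrightarrow> ((\<lambda>t. partials bs (u n) (x + t *\<^sub>R b)) has_derivative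
         (\<lambda>h. h *\<^sub>R partials (b # bs) (u n) (x + t *\<^sub>R b))) (at t within {-r<..<r})"
        using * by (simp add: has_vector_derivative_def)
      fix e :: real assume e: "0 < e"
      have "\<forall>\<^sub>F N in sequentially. \<forall>y\<in>cball x r.
          dist (\<Sum>n<N. partials (b # bs) (u n) y) (D (b # bs) y) < e"
        using lim[OF compact_cball r(2), of "b # bs"] bs b e by (auto simp: uniform_limit_iff)
      then show "\<forall>\<^sub>F N in sequentially. \<forall>t\<in>{-r<..<r}. \<forall>h.
          norm ((\<Sum>n<N. h *\<^sub>R partials (b # bs) (u n) (x + t *\<^sub>R b)) - h *\<^sub>R D (b # bs) (x + t *\<^sub>R b))
            \<le> e * norm h"
      proof (rule eventually_mono, intro ballI allI)
        fix N t and h :: real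
        assume N: "\<forall>y\<in>cball x r. dist (\<Sum>n<N. partials (b # bs) (u n) y) (D (b # bs) y) < e"
          and t: "t \<in> {-r<..<r}"
        have "norm ((\<Sum>n<N. h *\<^sub>R partials (b # bs) (u n) (x + t *\<^sub>R b)) - h *\<^sub>R D (b # bs) (x + t *\<^sub>R b))
          = \<bar>h\<bar> * dist (\<Sum>n<N. partials (b # bs) (u n) (x + t *\<^sub>R b)) (D (b # bs) (x + t *\<^sub>R b))"
          by (simp only: dist_norm norm_scaleR[symmetric] scaleR_diff_right scaleR_sum_right)
        also have "\<dots> \<le> \<bar>h\<bar> * e"
          using N in_ball[OF t] by (intro mult_left_mono) (auto intro: less_imp_le)
        finally show "norm ((\<Sum>n<N. h *\<^sub>R partials (b # bs) (u n) (x + t *\<^sub>R b))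
            - h *\<^sub>R D (b # bs) (x + t *\<^sub>R b)) \<le> e * norm h" by (simp add: mult.commute)
      qed
    next
      show "(\<lambda>n. partials bs (u n) (x + 0 *\<^sub>R b)) sums D bs (x + 0 *\<^sub>R b)"
        unfolding D_def using summ[OF x bs] by (simp add: summable_sums)
    qed (use r in auto)
    then obtain g where g: "\<And>t. t \<in> {-r<..<r} \<Longrightarrow> (\<lambda>n. partials bs (u n) (x + t *\<^sub>R b)) sums g t"
      "\<And>t. t \<in> {-r<..<r} \<Longrightarrow> (g has_derivative (\<lambda>h. h *\<^sub>R D (b # bs) (x + t *\<^sub>R b))) (at t within {-r<..<r})"
      by blast
    have gD: "(g has_vector_derivative D (b # bs) x) (at 0)"
      using g(2)[of 0] r(1) at_within_open[of 0 "{-r<..<r}"] by (simp add: has_vector_derivative_def)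
    have gE: "g t = D bs (x + t *\<^sub>R b)" if "t \<in> {-r<..<r}" for t
      using g(1)[OF that] by (simp add: D_def sums_iff)
    show ?thesis
      by (rule has_vector_derivative_transform_within_open[OF gD, of "{-r<..<r}"]) (use r gE in auto)
  qed
  have D_Nil: "D [] x = (\<Sum>n. u n x)" for x by (simp add: D_def)
  have smooth: "smooth_on \<Omega> (\<lambda>x. \<Sum>n. u n x)"
    by (rule smooth_on_family[OF \<Omega> _ cont der]) (simp_all add: D_Nil)
  have partials: "partials bs (\<lambda>x. \<Sum>n. u n x) x = D bs x" if "set bs \<subseteq> Basis" "x \<in> \<Omega>" for bs x
    by (rule partials_eq_family[OF \<Omega> _ der that]) (simp_all add: D_Nil)
  have smN: "smooth_on \<Omega> (\<lambda>x. \<Sum>n<N. u n x)" for N by (intro smooth_on_sum \<Omega> u)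
  have "(\<lambda>N. seminorm Q l (\<lambda>x. (\<Sum>n<N. u n x) - (\<Sum>n. u n x))) \<longlonglongrightarrow> 0"
    if Q: "compact Q" "Q \<subseteq> \<Omega>" for Q l
  proof (rule LIMSEQ_I)
    fix e :: real assume e: "0 < e"
    \<comment> \<open>Only finitely many lists \<open>bs\<close> have length at most
      \<open>l\<close>, so the uniform limits share one threshold. The supremum of quantities below
      \<open>e / 2\<close> is at most \<open>e / 2\<close>, hence strictly below
      \<open>e\<close>.\<close>
    have "\<forall>\<^sub>F N in sequentially. \<forall>bs\<in>{bs. set bs \<subseteq> Basis \<and> length bs \<le> l}. \<forall>x\<in>Q.
        dist (\<Sum>n<N. partials bs (u n) x) (D bs x) < e / 2"
    proof (rule eventually_ball_finite)
      show "finite {bs. set bs \<subseteq> (Basis :: 'a set) \<and> length bs \<le> l}"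
        by (intro finite_lists_length_le finite_Basis)
    qed (use lim[OF Q] e half_gt_zero[OF e] in \<open>unfold uniform_limit_iff, blast\<close>)
    then obtain N0 where N0: "\<And>N bs x. N \<ge> N0 \<Longrightarrow> set bs \<subseteq> Basis \<Longrightarrow> length bs \<le> l \<Longrightarrow> x \<in> Q \<Longrightarrow>
        dist (\<Sum>n<N. partials bs (u n) x) (D bs x) < e / 2"
      unfolding eventually_sequentially by blast
    have "seminorm Q l (\<lambda>x. (\<Sum>n<N. u n x) - (\<Sum>n. u n x)) \<le> e / 2" if "N \<ge> N0" for N
    proof (rule seminorm_leI)
      fix x bs assume x: "x \<in> Q" "set bs \<subseteq> (Basis :: 'a set)" "length bs \<le> l"
      have "partials bs (\<lambda>x. (\<Sum>n<N. u n x) - (\<Sum>n. u n x)) x = (\<Sum>n<N. partials bs (u n) x) - D bs x"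
        using x Q by (simp add: partials_diff[OF \<Omega> smN smooth] partials_sum[OF \<Omega> u] partials subset_iff)
      then show "norm (partials bs (\<lambda>x. (\<Sum>n<N. u n x) - (\<Sum>n. u n x)) x) \<le> e / 2"
        using N0[OF that x(2,3,1)] by (simp add: dist_norm)
    qed (use e in simp)
    moreover have "0 \<le> seminorm Q l (\<lambda>x. (\<Sum>n<N. u n x) - (\<Sum>n. u n x))" for N
      by (rule seminorm_nonneg[OF Q smooth_on_diff[OF \<Omega> smN smooth]])
    ultimately show "\<exists>N0. \<forall>N\<ge>N0. norm (seminorm Q l (\<lambda>x. (\<Sum>n<N. u n x) - (\<Sum>n. u n x)) - 0) < e"
      using e by (intro exI[of _ N0]) fastforce
  qed
  then show ?thesis unfolding smooth_limit_def using smN smooth by blast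
qed

section \<open>Growth as \<open>\<epsilon>\<close> tends to zero\<close>

text \<open>The growth conditions on nets are isolated as properties of a real function of
  \<open>\<epsilon>\<close>, so that nullity and moderateness follow from estimates combined by sums
  and products.\<close>

definition rapidly_decreasing :: "(real \<Rightarrow> real) \<Rightarrow> bool" where
  "rapidly_decreasing p \<longleftrightarrow> (\<forall>n::nat. p \<in> O[at_right 0](\<lambda>\<epsilon>. \<epsilon> ^ n))"

definition moderate_growth :: "(real \<Rightarrow> real) \<Rightarrow> bool" where
  "moderate_growth p \<longleftrightarrow> (\<exists>n::nat. p \<in> O[at_right 0](\<lambda>\<epsilon>. 1 / \<epsilon> ^ n))"

lemma eventually_unit_interval: "\<forall>\<^sub>F \<epsilon> in at_right 0. \<epsilon> \<in> {0<..1::real}"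
  by (auto simp: eventually_at_right_field intro: exI[of _ 1])

lemma bigo_of_le:
  fixes p q :: "real \<Rightarrow> real"
  assumes "\<And>\<epsilon>. \<epsilon> \<in> {0<..1} \<Longrightarrow> 0 \<le> p \<epsilon> \<and> p \<epsilon> \<le> q \<epsilon>"
  shows "p \<in> O[at_right 0](q)"
  by (rule bigoI[of _ 1], rule eventually_mono[OF eventually_unit_interval]) (use assms in fastforce)

lemma rapidly_decreasing_le:
  assumes "rapidly_decreasing q" "\<And>\<epsilon>. \<epsilon> \<in> {0<..1} \<Longrightarrow> 0 \<le> p \<epsilon> \<and> p \<epsilon> \<le> q \<epsilon>"
  shows "rapidly_decreasing p"
  using assms(1) bigo_of_le[of p q, OF assms(2)] unfolding rapidly_decreasing_def
  by (blast intro: landau_o.big_trans)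

lemma moderate_growth_le:
  assumes "moderate_growth q" "\<And>\<epsilon>. \<epsilon> \<in> {0<..1} \<Longrightarrow> 0 \<le> p \<epsilon> \<and> p \<epsilon> \<le> q \<epsilon>"
  shows "moderate_growth p"
  using assms(1) bigo_of_le[of p q, OF assms(2)] unfolding moderate_growth_def
  by (blast intro: landau_o.big_trans)

lemma rapidly_decreasing_zero: "rapidly_decreasing (\<lambda>_. 0)"
  by (simp add: rapidly_decreasing_def)

lemma rapidly_decreasing_add:
  "rapidly_decreasing p \<Longrightarrow> rapidly_decreasing q \<Longrightarrow> rapidly_decreasing (\<lambda>\<epsilon>. p \<epsilon> + q \<epsilon>)"
  by (auto simp: rapidly_decreasing_def intro: sum_in_bigo)

lemma rapidly_decreasing_sum:
  assumes "\<And>i. i \<in> I \<Longrightarrow> rapidly_decreasing (p i)"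
  shows "rapidly_decreasing (\<lambda>\<epsilon>. \<Sum>i\<in>I. p i \<epsilon>)"
  using assms by (auto simp: rapidly_decreasing_def intro: big_sum_in_bigo)

lemma bigo_inverse_power_mono:
  assumes "n \<le> m" shows "(\<lambda>\<epsilon>::real. 1 / \<epsilon> ^ n) \<in> O[at_right 0](\<lambda>\<epsilon>. 1 / \<epsilon> ^ m)"
  by (rule bigo_of_le) (use assms in \<open>auto intro!: divide_left_mono power_decreasing\<close>)

lemma moderate_growth_add:
  assumes "moderate_growth p" "moderate_growth q"
  shows "moderate_growth (\<lambda>\<epsilon>. p \<epsilon> + q \<epsilon>)"
proof -
  obtain n m :: nat where "p \<in> O[at_right 0](\<lambda>\<epsilon>. 1 / \<epsilon> ^ n)" "q \<in> O[at_right 0](\<lambda>\<epsilon>. 1 / \<epsilon> ^ m)"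
    using assms by (auto simp: moderate_growth_def)
  then have "p \<in> O[at_right 0](\<lambda>\<epsilon>. 1 / \<epsilon> ^ max n m)" "q \<in> O[at_right 0](\<lambda>\<epsilon>. 1 / \<epsilon> ^ max n m)"
    using bigo_inverse_power_mono[of n "max n m"] bigo_inverse_power_mono[of m "max n m"]
    by (auto intro: landau_o.big_trans)
  then show ?thesis unfolding moderate_growth_def by (intro exI[of _ "max n m"] sum_in_bigo)
qed

lemma moderate_growth_mult:
  assumes "moderate_growth p" "moderate_growth q"
  shows "moderate_growth (\<lambda>\<epsilon>. p \<epsilon> * q \<epsilon>)"
proof -
  obtain n m :: nat where "p \<in> O[at_right 0](\<lambda>\<epsilon>. 1 / \<epsilon> ^ n)" "q \<in> O[at_right 0](\<lambda>\<epsilon>. 1 / \<epsilon> ^ m)"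
    using assms by (auto simp: moderate_growth_def)
  from landau_o.big.mult[OF this] show ?thesis
    unfolding moderate_growth_def by (intro exI[of _ "n + m"]) (simp add: power_add)
qed

lemma moderate_growth_const: "moderate_growth (\<lambda>_. c)"
  unfolding moderate_growth_def by (intro exI[of _ 0]) simp

lemma rapidly_decreasing_imp_moderate: "rapidly_decreasing p \<Longrightarrow> moderate_growth p"
  unfolding moderate_growth_def rapidly_decreasing_def by (intro exI[of _ 0]) (auto dest: spec[of _ 0])

text \<open>Decay of order \<open>n + m\<close> in \<open>p\<close> pays for the growth
  \<open>1 / \<epsilon> ^ m\<close> of \<open>q\<close>: negligible functions form an ideal among
  the moderate ones.\<close>

lemma rapidly_decreasing_mult:
  assumes "rapidly_decreasing p" "moderate_growth q"
  shows "rapidly_decreasing (\<lambda>\<epsilon>. p \<epsilon> * q \<epsilon>)"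
  unfolding rapidly_decreasing_def
proof
  fix n :: nat
  obtain m :: nat where q: "q \<in> O[at_right 0](\<lambda>\<epsilon>. 1 / \<epsilon> ^ m)"
    using assms(2) by (auto simp: moderate_growth_def)
  have "p \<in> O[at_right 0](\<lambda>\<epsilon>. \<epsilon> ^ (n + m))" using assms(1) by (auto simp: rapidly_decreasing_def)
  from landau_o.big.mult[OF this q]
  have "(\<lambda>\<epsilon>. p \<epsilon> * q \<epsilon>) \<in> O[at_right 0](\<lambda>\<epsilon>. \<epsilon> ^ (n + m) * (1 / \<epsilon> ^ m))" .
  also have "(\<lambda>\<epsilon>. \<epsilon> ^ (n + m) * (1 / \<epsilon> ^ m)) \<in> O[at_right 0](\<lambda>\<epsilon>::real. \<epsilon> ^ n)"
    by (rule bigo_of_le) (simp add: power_add)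
  finally show "(\<lambda>\<epsilon>. p \<epsilon> * q \<epsilon>) \<in> O[at_right 0](\<lambda>\<epsilon>. \<epsilon> ^ n)" .
qed

text \<open>The exponential of a multiple of the logarithm is a power:
  \<open>exp (\<bar>c\<bar> * C * \<bar>ln \<epsilon>\<bar>)\<close> is at most
  \<open>1 / \<epsilon> ^ n\<close> as soon as \<open>n\<close> is at least
  \<open>\<bar>c\<bar> * C\<close>. This is where the logarithmic type turns into
  moderateness.\<close>

lemma moderate_growth_exp_of_ln:
  assumes "p \<in> O[at_right 0](\<lambda>\<epsilon>. \<bar>ln \<epsilon>\<bar>)"
  shows "moderate_growth (\<lambda>\<epsilon>. exp (c * p \<epsilon>))"
proof -
  obtain C where C: "C > 0" "\<forall>\<^sub>F \<epsilon> in at_right 0. norm (p \<epsilon>) \<le> C * norm \<bar>ln \<epsilon>\<bar>"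
    using landau_o.bigE[OF assms] by blast
  obtain n :: nat where n: "\<bar>c\<bar> * C \<le> real n" using real_arch_simple by blast
  have "\<forall>\<^sub>F \<epsilon> in at_right 0. norm (exp (c * p \<epsilon>)) \<le> 1 * norm (1 / \<epsilon> ^ n)"
    using C(2) eventually_unit_interval
  proof eventually_elim
    case (elim \<epsilon>)
    have "c * p \<epsilon> \<le> \<bar>c\<bar> * \<bar>p \<epsilon>\<bar>" by (metis abs_ge_self abs_mult)
    also have "\<dots> \<le> \<bar>c\<bar> * (C * \<bar>ln \<epsilon>\<bar>)" using elim by (intro mult_left_mono) auto
    also have "\<dots> \<le> real n * \<bar>ln \<epsilon>\<bar>" using n by (simp add: mult.assoc[symmetric] mult_right_mono)
    \<comment> \<open>Here \<open>\<epsilon> \<le> 1\<close> makes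
      \<open>\<bar>ln \<epsilon>\<bar> = - ln \<epsilon>\<close>.\<close>
    also have "\<dots> = ln (1 / \<epsilon> ^ n)" using elim by (simp add: ln_div ln_realpow)
    finally have "exp (c * p \<epsilon>) \<le> 1 / \<epsilon> ^ n" using elim by (subst ln_ge_iff[symmetric]) auto
    then show ?case using elim by simp
  qed
  then show ?thesis unfolding moderate_growth_def by (blast intro: bigoI)
qed

section \<open>Nets and their classes\<close>

lemma null_nets_iff:
  "u \<in> null_nets \<Omega> \<longleftrightarrow> u \<in> smooth_nets \<Omega> \<and>
     (\<forall>K l. compact K \<and> K \<subseteq> \<Omega> \<longrightarrow> rapidly_decreasing (\<lambda>\<epsilon>. seminorm K l (u \<epsilon>)))"
  by (auto simp: null_nets_def rapidly_decreasing_def)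

lemma moderate_nets_iff:
  "u \<in> moderate_nets \<Omega> \<longleftrightarrow> u \<in> smooth_nets \<Omega> \<and>
     (\<forall>K l. compact K \<and> K \<subseteq> \<Omega> \<longrightarrow> moderate_growth (\<lambda>\<epsilon>. seminorm K l (u \<epsilon>)))"
  by (auto simp: moderate_nets_def moderate_growth_def)

lemma null_nets_add:
  assumes "open \<Omega>" "u \<in> null_nets \<Omega>" "v \<in> null_nets \<Omega>"
  shows "(\<lambda>\<epsilon> x. u \<epsilon> x + v \<epsilon> x) \<in> null_nets \<Omega>"
proof -
  have sm: "smooth_on \<Omega> (u \<epsilon>)" "smooth_on \<Omega> (v \<epsilon>)" if "\<epsilon> \<in> {0<..1}" for \<epsilon>
    using assms that by (auto simp: null_nets_def smooth_nets_def)
  have "rapidly_decreasing (\<lambda>\<epsilon>. seminorm K l (\<lambda>x. u \<epsilon> x + v \<epsilon> x))" if K: "compact K" "K \<subseteq> \<Omega>" for K l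
  proof (rule rapidly_decreasing_le)
    show "rapidly_decreasing (\<lambda>\<epsilon>. seminorm K l (u \<epsilon>) + seminorm K l (v \<epsilon>))"
      using assms K by (intro rapidly_decreasing_add) (auto simp: null_nets_iff)
  qed (use assms(1) K sm in \<open>auto intro!: seminorm_add seminorm_nonneg[OF K] smooth_on_add\<close>)
  then show ?thesis
    using sm assms(1) by (auto simp: null_nets_iff smooth_nets_def intro!: smooth_on_add)
qed

lemma null_nets_cmult:
  assumes "open \<Omega>" "u \<in> null_nets \<Omega>"
  shows "(\<lambda>\<epsilon> x. c * u \<epsilon> x) \<in> null_nets \<Omega>"
proof -
  have sm: "smooth_on \<Omega> (u \<epsilon>)" if "\<epsilon> \<in> {0<..1}" for \<epsilon>
    using assms that by (auto simp: null_nets_def smooth_nets_def)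
  have "rapidly_decreasing (\<lambda>\<epsilon>. seminorm K l (\<lambda>x. c * u \<epsilon> x))" if K: "compact K" "K \<subseteq> \<Omega>" for K l
  proof (rule rapidly_decreasing_le)
    show "rapidly_decreasing (\<lambda>\<epsilon>. seminorm K l (u \<epsilon>) * norm c)"
      using assms K by (intro rapidly_decreasing_mult moderate_growth_const) (auto simp: null_nets_iff)
    show "0 \<le> seminorm K l (\<lambda>x. c * u \<epsilon> x) \<and> seminorm K l (\<lambda>x. c * u \<epsilon> x) \<le> seminorm K l (u \<epsilon>) * norm c"
      if "\<epsilon> \<in> {0<..1}" for \<epsilon>
      using seminorm_cmult[OF assms(1) K sm[OF that]] seminorm_nonneg[OF K smooth_on_cmult[OF assms(1) sm[OF that]]]
      by (simp add: mult.commute)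
  qed
  then show ?thesis
    using sm assms(1) by (auto simp: null_nets_iff smooth_nets_def intro!: smooth_on_cmult)
qed

lemma moderate_nets_add:
  assumes "open \<Omega>" "u \<in> moderate_nets \<Omega>" "v \<in> moderate_nets \<Omega>"
  shows "(\<lambda>\<epsilon> x. u \<epsilon> x + v \<epsilon> x) \<in> moderate_nets \<Omega>"
proof -
  have sm: "smooth_on \<Omega> (u \<epsilon>)" "smooth_on \<Omega> (v \<epsilon>)" if "\<epsilon> \<in> {0<..1}" for \<epsilon>
    using assms that by (auto simp: moderate_nets_def smooth_nets_def)
  have "moderate_growth (\<lambda>\<epsilon>. seminorm K l (\<lambda>x. u \<epsilon> x + v \<epsilon> x))" if K: "compact K" "K \<subseteq> \<Omega>" for K l
  proof (rule moderate_growth_le)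
    show "moderate_growth (\<lambda>\<epsilon>. seminorm K l (u \<epsilon>) + seminorm K l (v \<epsilon>))"
      using assms K by (intro moderate_growth_add) (auto simp: moderate_nets_iff)
  qed (use assms(1) K sm in \<open>auto intro!: seminorm_add seminorm_nonneg[OF K] smooth_on_add\<close>)
  then show ?thesis
    using sm assms(1) by (auto simp: moderate_nets_iff smooth_nets_def intro!: smooth_on_add)
qed

lemma zero_null_nets: "(\<lambda>\<epsilon> x. 0) \<in> null_nets \<Omega>"
  by (simp add: null_nets_iff smooth_nets_def smooth_on_zero seminorm_zero rapidly_decreasing_zero)

lemma null_nets_imp_moderate: "u \<in> null_nets \<Omega> \<Longrightarrow> u \<in> moderate_nets \<Omega>"
  by (auto simp: null_nets_iff moderate_nets_iff intro: rapidly_decreasing_imp_moderate)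

lemma null_nets_subset: "u \<in> null_nets \<Omega> \<Longrightarrow> V \<subseteq> \<Omega> \<Longrightarrow> u \<in> null_nets V"
  by (auto simp: null_nets_iff smooth_nets_def intro: smooth_on_subset)

lemma moderate_nets_subset: "u \<in> moderate_nets \<Omega> \<Longrightarrow> V \<subseteq> \<Omega> \<Longrightarrow> u \<in> moderate_nets V"
  by (auto simp: moderate_nets_iff smooth_nets_def intro: smooth_on_subset)

text \<open>Representatives need to agree only for \<open>\<epsilon>\<close> in the unit interval
  and on \<open>\<Omega>\<close>; elsewhere their difference is arbitrary and invisible to the
  conditions that define null nets.\<close>

lemma null_nets_of_eq:
  assumes "open \<Omega>" "\<And>\<epsilon> x. \<epsilon> \<in> {0<..1} \<Longrightarrow> x \<in> \<Omega> \<Longrightarrow> u \<epsilon> x = v \<epsilon> x"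
  shows "(\<lambda>\<epsilon> x. u \<epsilon> x - v \<epsilon> x) \<in> null_nets \<Omega>"
  unfolding null_nets_iff smooth_nets_def
proof (intro conjI allI impI CollectI ballI)
  show sm: "smooth_on \<Omega> (\<lambda>x. u \<epsilon> x - v \<epsilon> x)" if "\<epsilon> \<in> {0<..1}" for \<epsilon>
    using assms that by (intro smooth_on_cong[OF assms(1) _ smooth_on_zero]) auto
  fix K l assume K: "compact K \<and> K \<subseteq> \<Omega>"
  show "rapidly_decreasing (\<lambda>\<epsilon>. seminorm K l (\<lambda>x. u \<epsilon> x - v \<epsilon> x))"
  proof (rule rapidly_decreasing_le[OF rapidly_decreasing_zero])
    fix \<epsilon> :: real assume "\<epsilon> \<in> {0<..1}"
    then have "seminorm K l (\<lambda>x. u \<epsilon> x - v \<epsilon> x) = seminorm K l (\<lambda>x. 0 :: 'b)"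
      using assms K by (intro seminorm_cong) auto
    then show "0 \<le> seminorm K l (\<lambda>x. u \<epsilon> x - v \<epsilon> x) \<and> seminorm K l (\<lambda>x. u \<epsilon> x - v \<epsilon> x) \<le> 0"
      by (simp add: seminorm_zero)
  qed
qed

lemma equiv_net_rel:
  assumes "open \<Omega>"
  shows "equiv (moderate_nets \<Omega>) (net_rel \<Omega>)"
proof (rule equivI)
  show "net_rel \<Omega> \<subseteq> moderate_nets \<Omega> \<times> moderate_nets \<Omega>" by (auto simp: net_rel_def)
  show "refl_on (moderate_nets \<Omega>) (net_rel \<Omega>)"
    by (auto simp: refl_on_def net_rel_def zero_null_nets)
  show "sym (net_rel \<Omega>)"
    using null_nets_cmult[OF assms, where c = "-1"] by (fastforce simp: sym_on_def net_rel_def)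
  show "trans (net_rel \<Omega>)"
    unfolding trans_on_def net_rel_def using null_nets_add[OF assms] by fastforce
qed

lemma Cl_eqI:
  assumes "open \<Omega>" "u \<in> moderate_nets \<Omega>" "v \<in> moderate_nets \<Omega>" "(\<lambda>\<epsilon> x. u \<epsilon> x - v \<epsilon> x) \<in> null_nets \<Omega>"
  shows "Cl \<Omega> u = Cl \<Omega> v"
  unfolding Cl_def by (rule equiv_class_eq[OF equiv_net_rel[OF assms(1)]]) (use assms in \<open>simp add: net_rel_def\<close>)

lemma mem_Cl: "u \<in> moderate_nets \<Omega> \<Longrightarrow> u \<in> Cl \<Omega> u"
  by (auto simp: Cl_def net_rel_def zero_null_nets)

lemma mem_ClD: "v \<in> Cl \<Omega> u \<Longrightarrow> v \<in> moderate_nets \<Omega> \<and> (\<lambda>\<epsilon> x. u \<epsilon> x - v \<epsilon> x) \<in> null_nets \<Omega>"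
  by (auto simp: Cl_def net_rel_def)

lemma Cl_in_colombeau: "u \<in> moderate_nets \<Omega> \<Longrightarrow> Cl \<Omega> u \<in> colombeau \<Omega>"
  by (auto simp: Cl_def colombeau_def intro: quotientI)

lemma colombeau_mem:
  assumes "open \<Omega>" "U \<in> colombeau \<Omega>" "u \<in> U"
  shows "u \<in> moderate_nets \<Omega>" "U = Cl \<Omega> u"
proof -
  obtain v where v: "U = Cl \<Omega> v" "v \<in> moderate_nets \<Omega>"
    using assms(2) by (auto simp: colombeau_def quotient_def Cl_def)
  show "u \<in> moderate_nets \<Omega>" using mem_ClD v(1) assms(3) by blast
  then show "U = Cl \<Omega> u" using Cl_eqI[OF assms(1) v(2)] mem_ClD[of u \<Omega> v] v(1) assms(3) by blast
qed

lemma colombeau_nonempty: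
  assumes "open \<Omega>" "U \<in> colombeau \<Omega>"
  shows "U \<noteq> {}"
  using in_quotient_imp_non_empty[OF equiv_net_rel[OF assms(1)]] assms(2) by (auto simp: colombeau_def)

lemma colombeau_diff_null:
  assumes "open \<Omega>" "U \<in> colombeau \<Omega>" "u \<in> U" "v \<in> U"
  shows "(\<lambda>\<epsilon> x. u \<epsilon> x - v \<epsilon> x) \<in> null_nets \<Omega>"
  using colombeau_mem[OF assms(1-3)] mem_ClD assms(4) by blast

section \<open>Supports\<close>

text \<open>\<open>gen_restrict\<close> collects the classes of all representatives; these coincide
  on \<open>V\<close>, so vanishing there can be tested on any single representative.\<close>

lemma gen_restrict_zero_iff:
  assumes "open \<Omega>" "U \<in> colombeau \<Omega>" "u \<in> U" "open V" "V \<subseteq> \<Omega>"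
  shows "gen_restrict V U = Cl V (\<lambda>\<epsilon> x. 0) \<longleftrightarrow> u \<in> null_nets V"
proof -
  have mod: "v \<in> moderate_nets V" if "v \<in> U" for v
    using colombeau_mem(1)[OF assms(1,2) that] moderate_nets_subset assms(5) by blast
  have "Cl V v = Cl V u" if "v \<in> U" for v
    using mod that assms colombeau_diff_null[OF assms(1,2) that assms(3)]
    by (intro Cl_eqI) (auto intro: null_nets_subset)
  then have eq: "gen_restrict V U = Cl V u" using assms(3) unfolding gen_restrict_def by blast
  show ?thesis
  proof
    assume "gen_restrict V U = Cl V (\<lambda>\<epsilon> x. 0)"
    then have "(\<lambda>\<epsilon> x. 0) \<in> Cl V u"
      using eq mem_Cl[OF null_nets_imp_moderate[OF zero_null_nets]] by auto
    then show "u \<in> null_nets V" using mem_ClD by fastforce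
  next
    assume "u \<in> null_nets V"
    then have "Cl V u = Cl V (\<lambda>\<epsilon> x. 0)"
      using mod[OF assms(3)] by (intro Cl_eqI assms null_nets_imp_moderate zero_null_nets) auto
    then show "gen_restrict V U = Cl V (\<lambda>\<epsilon> x. 0)" using eq by simp
  qed
qed

lemma gen_supp_subset:
  assumes "open \<Omega>" "U \<in> colombeau \<Omega>" "u \<in> U" "open V" "V \<subseteq> \<Omega>" "u \<in> null_nets V"
  shows "gen_supp \<Omega> U \<subseteq> \<Omega> - V"
  using assms gen_restrict_zero_iff[OF assms(1-5)] by (auto simp: gen_supp_def)

text \<open>The support arises by removing open sets, so inside a compact \<open>C\<close> that
  contains it, it is \<open>C\<close> minus an open set.\<close>

lemma compact_gen_supp:
  assumes "compact C" "C \<subseteq> \<Omega>" "gen_supp \<Omega> U \<subseteq> C"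
  shows "compact (gen_supp \<Omega> U)"
proof -
  have "gen_supp \<Omega> U = C - \<Union>{V. open V \<and> V \<subseteq> \<Omega> \<and> gen_restrict V U = Cl V (\<lambda>\<epsilon> x. 0)}"
    using assms(2,3) unfolding gen_supp_def by blast
  also have "compact \<dots>" by (rule compact_diff[OF assms(1)]) auto
  finally show ?thesis .
qed

text \<open>Outside the support a representative is known to be null only near each point. Finitely
  many such neighbourhoods cover \<open>Q\<close>, and finite sums of rapidly decreasing functions
  are rapidly decreasing.\<close>

lemma rapidly_decreasing_off_supp:
  assumes "open \<Omega>" "U \<in> colombeau \<Omega>" "u \<in> U" "compact Q" "Q \<subseteq> \<Omega>" "Q \<inter> gen_supp \<Omega> U = {}"
  shows "rapidly_decreasing (\<lambda>\<epsilon>. seminorm Q l (u \<epsilon>))"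
proof -
  have u: "smooth_on \<Omega> (u \<epsilon>)" if "\<epsilon> \<in> {0<..1}" for \<epsilon>
    using colombeau_mem(1)[OF assms(1-3)] that by (auto simp: moderate_nets_def smooth_nets_def)
  \<comment> \<open>Nullity on the ball of radius \<open>2 * r\<close> makes the closed ball of
    radius \<open>r\<close> a compact subset of a set on which \<open>u\<close> is null; the open
    balls of radius \<open>r\<close> serve for the cover.\<close>
  have "\<exists>r>0. cball x r \<subseteq> \<Omega> \<and> u \<in> null_nets (ball x (2 * r))" if "x \<in> Q" for x
  proof -
    obtain V where V: "x \<in> V" "open V" "V \<subseteq> \<Omega>" "gen_restrict V U = Cl V (\<lambda>\<epsilon> x. 0)"
    proof -
      have "x \<in> \<Union>{V. open V \<and> V \<subseteq> \<Omega> \<and> gen_restrict V U = Cl V (\<lambda>\<epsilon> x. 0)}"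
        using \<open>x \<in> Q\<close> assms(5,6) by (auto simp: gen_supp_def)
      then show thesis using that by blast
    qed
    obtain r where "r > 0" "ball x r \<subseteq> V" using V(1,2) open_contains_ball by blast
    moreover have "u \<in> null_nets V" using gen_restrict_zero_iff[OF assms(1-3) V(2,3)] V(4) by simp
    moreover have "cball x (r / 2) \<subseteq> ball x r" using \<open>r > 0\<close> by (intro cball_subset_ball_iff[THEN iffD2]) auto
    ultimately show ?thesis
      using V(3) null_nets_subset[of u V "ball x (2 * (r / 2))"] by (intro exI[of _ "r / 2"]) auto
  qed
  then obtain r where r: "\<And>x. x \<in> Q \<Longrightarrow> r x > 0" "\<And>x. x \<in> Q \<Longrightarrow> cball x (r x) \<subseteq> \<Omega>"
    "\<And>x. x \<in> Q \<Longrightarrow> u \<in> null_nets (ball x (2 * r x))" by metis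
  have "Q \<subseteq> (\<Union>x\<in>Q. ball x (r x))" using r(1) by fastforce
  then obtain F where F: "F \<subseteq> Q" "finite F" "Q \<subseteq> (\<Union>x\<in>F. ball x (r x))"
    using compactE_image[OF assms(4), of Q "\<lambda>x. ball x (r x)"] by auto
  show ?thesis
  proof (rule rapidly_decreasing_le)
    show "rapidly_decreasing (\<lambda>\<epsilon>. \<Sum>x\<in>F. seminorm (cball x (r x)) l (u \<epsilon>))"
    proof (rule rapidly_decreasing_sum)
      fix x assume "x \<in> F"
      then have x: "x \<in> Q" using F by auto
      have "cball x (r x) \<subseteq> ball x (2 * r x)" using r(1)[OF x] by (intro cball_subset_ball_iff[THEN iffD2]) auto
      then show "rapidly_decreasing (\<lambda>\<epsilon>. seminorm (cball x (r x)) l (u \<epsilon>))"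
        using r(3)[OF x] by (auto simp: null_nets_iff)
    qed
    fix \<epsilon> :: real assume e: "\<epsilon> \<in> {0<..1}"
    have nonneg: "0 \<le> seminorm (cball x (r x)) l (u \<epsilon>)" if "x \<in> F" for x
      using that F r(2)[of x] by (intro seminorm_nonneg[OF _ _ u[OF e]]) auto
    have "seminorm Q l (u \<epsilon>) \<le> (\<Sum>x\<in>F. seminorm (cball x (r x)) l (u \<epsilon>))"
    proof (rule seminorm_leI)
      fix z bs assume z: "z \<in> Q" "set bs \<subseteq> (Basis :: 'a set)" "length bs \<le> l"
      then obtain x where x: "x \<in> F" "z \<in> ball x (r x)" using F(3) by auto
      have "norm (partials bs (u \<epsilon>) z) \<le> seminorm (cball x (r x)) l (u \<epsilon>)"
        using x z F r(2)[of x] by (intro norm_partials_le_seminorm[OF _ _ u[OF e]]) auto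
      also have "\<dots> \<le> (\<Sum>x\<in>F. seminorm (cball x (r x)) l (u \<epsilon>))"
        using x(1) F(2) nonneg by (intro member_le_sum) auto
      finally show "norm (partials bs (u \<epsilon>) z) \<le> (\<Sum>x\<in>F. seminorm (cball x (r x)) l (u \<epsilon>))" .
    qed (use nonneg in \<open>auto intro: sum_nonneg\<close>)
    then show "0 \<le> seminorm Q l (u \<epsilon>) \<and> seminorm Q l (u \<epsilon>) \<le> (\<Sum>x\<in>F. seminorm (cball x (r x)) l (u \<epsilon>))"
      using seminorm_nonneg[OF assms(4,5) u[OF e]] by auto
  qed
qed

section \<open>Composition of smooth kernels\<close>

text \<open>The set \<open>A\<close> is left arbitrary so that the possibly non-compact difference
  of two domains is covered as well.\<close>

definition kcomp :: "'a::euclidean_space set \<Rightarrow> ('a \<times> 'a \<Rightarrow> 'k::{real_normed_field,euclidean_space}) \<Rightarrow>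
    ('a \<times> 'a \<Rightarrow> 'k) \<Rightarrow> 'a \<times> 'a \<Rightarrow> 'k" where
  "kcomp A f g p = (LINT \<xi>:A|lborel. f (fst p, \<xi>) * g (\<xi>, snd p))"

definition kapply :: "'a::euclidean_space set \<Rightarrow> ('a \<times> 'a \<Rightarrow> 'k::{real_normed_field,euclidean_space}) \<Rightarrow>
    ('a \<Rightarrow> 'k) \<Rightarrow> 'a \<Rightarrow> 'k" where
  "kapply A h f x = (LINT y:A|lborel. h (x, y) * f y)"

lemma int_op_net_eq_kapply: "int_op_net K h f \<epsilon> = kapply K (h \<epsilon>) (f \<epsilon>)"
  by (auto simp: int_op_net_def kapply_def)

lemma continuous_on_kcomp_integrand:
  fixes f g :: "'a::euclidean_space \<times> 'a \<Rightarrow> 'k::{real_normed_field,euclidean_space}"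
  assumes "continuous_on (X \<times> X) f" "continuous_on (X \<times> X) g" "C \<subseteq> X"
  shows "continuous_on ((X \<times> X) \<times> C) (\<lambda>(p, \<xi>). f (fst p, \<xi>) * g (\<xi>, snd p))"
  unfolding split_beta
  by (intro continuous_on_mult continuous_on_compose2[OF assms(1), of _ "\<lambda>z. (fst (fst z), snd z)"]
      continuous_on_compose2[OF assms(2), of _ "\<lambda>z. (snd z, snd (fst z))"] continuous_intros)
     (use assms(3) in auto)

lemma set_integrable_kcomp:
  assumes "compact C" "C \<subseteq> X" "A \<in> sets borel" "A \<subseteq> C" "smooth_on (X \<times> X) f" "smooth_on (X \<times> X) g"
    "p \<in> X \<times> X"
  shows "set_integrable lborel A (\<lambda>\<xi>. f (fst p, \<xi>) * g (\<xi>, snd p))"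
proof (rule set_integrable_continuous_on[OF assms(1) _ assms(3,4)])
  show "continuous_on C (\<lambda>\<xi>. f (fst p, \<xi>) * g (\<xi>, snd p))"
    using continuous_on_slice[OF continuous_on_kcomp_integrand[OF assms(5,6)[THEN smooth_on_imp_continuous_on] assms(2)] assms(7)] .
qed

text \<open>A derivative in the first (second) variable of a composition falls on the first (second) kernel.\<close>

lemma
  fixes f g :: "'a::euclidean_space \<times> 'a \<Rightarrow> 'k::{real_normed_field,euclidean_space}"
  assumes X: "open X" and C: "compact C" "C \<subseteq> X" and A: "A \<in> sets borel" "A \<subseteq> C"
    and f: "smooth_on (X \<times> X) f" and g: "smooth_on (X \<times> X) g"
  shows smooth_on_kcomp: "smooth_on (X \<times> X) (kcomp A f g)"
    and partials_kcomp: "\<And>bs p. set bs \<subseteq> Basis \<Longrightarrow> p \<in> X \<times> X \<Longrightarrow> partials bs (kcomp A f g) p =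
      kcomp A (partials (filter (\<lambda>b. snd b = 0) bs) f) (partials (filter (\<lambda>b. snd b \<noteq> 0) bs) g) p"
proof -
  \<comment> \<open>Every basis vector of the product has exactly one nonzero component, so the two
    filters split \<open>bs\<close> into derivatives in the first and in the second variable. The
    order inside each part is kept, which avoids any symmetry of mixed partials.\<close>
  define D where "D = (\<lambda>bs p \<xi>. partials (filter (\<lambda>b. snd b = 0) bs) f (fst p, \<xi>) *
    partials (filter (\<lambda>b. snd b \<noteq> 0) bs) g (\<xi>, snd p))"
  have o: "open (X \<times> X)" using X by (simp add: open_Times)
  have cont: "continuous_on ((X \<times> X) \<times> C) (\<lambda>(p, \<xi>). D bs p \<xi>)" if "set bs \<subseteq> Basis" for bs
    unfolding D_def using that C
    by (intro continuous_on_kcomp_integrand smooth_on_continuous_partials f g) auto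
  have der: "((\<lambda>t. D bs (p + t *\<^sub>R b) \<xi>) has_vector_derivative D (b # bs) p \<xi>) (at 0)"
    if bs: "set bs \<subseteq> Basis" and b: "b \<in> Basis" and p: "p \<in> X \<times> X" and \<xi>: "\<xi> \<in> C" for bs b p \<xi>
  proof (cases "snd b = 0")
    case True
    have "((\<lambda>t. partials (filter (\<lambda>b. snd b = 0) bs) f ((fst p, \<xi>) + t *\<^sub>R b) *
        partials (filter (\<lambda>b. snd b \<noteq> 0) bs) g (\<xi>, snd p)) has_vector_derivative
        partials (b # filter (\<lambda>b. snd b = 0) bs) f (fst p, \<xi>) *
        partials (filter (\<lambda>b. snd b \<noteq> 0) bs) g (\<xi>, snd p)) (at 0)"
      by (intro has_vector_derivative_mult_left smooth_on_has_derivative[OF f]) (use bs b p \<xi> C in auto)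
    moreover have "(fst p, \<xi>) + t *\<^sub>R b = (fst (p + t *\<^sub>R b), \<xi>)" "snd (p + t *\<^sub>R b) = snd p" for t
      using True by (auto simp: prod_eq_iff)
    ultimately show ?thesis using True by (simp add: D_def)
  next
    case False
    then have b0: "fst b = 0" using b by (auto simp: Basis_prod_def)
    have "((\<lambda>t. partials (filter (\<lambda>b. snd b = 0) bs) f (fst p, \<xi>) *
        partials (filter (\<lambda>b. snd b \<noteq> 0) bs) g ((\<xi>, snd p) + t *\<^sub>R b)) has_vector_derivative
        partials (filter (\<lambda>b. snd b = 0) bs) f (fst p, \<xi>) *
        partials (b # filter (\<lambda>b. snd b \<noteq> 0) bs) g (\<xi>, snd p)) (at 0)"
      by (intro has_vector_derivative_mult_right smooth_on_has_derivative[OF g]) (use bs b p \<xi> C in auto)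
    moreover have "(\<xi>, snd p) + t *\<^sub>R b = (\<xi>, snd (p + t *\<^sub>R b))" "fst (p + t *\<^sub>R b) = fst p" for t
      using b0 by (auto simp: prod_eq_iff)
    ultimately show ?thesis using False b0 by (simp add: D_def)
  qed
  have k: "kcomp A f g = (\<lambda>p. LINT \<xi>:A|lborel. D [] p \<xi>)"
    by (auto simp: kcomp_def D_def)
  show "smooth_on (X \<times> X) (kcomp A f g)"
    unfolding k by (rule smooth_on_parametric_integral[OF o C(1) A cont der])
  show "partials bs (kcomp A f g) p =
      kcomp A (partials (filter (\<lambda>b. snd b = 0) bs) f) (partials (filter (\<lambda>b. snd b \<noteq> 0) bs) g) p"
    if "set bs \<subseteq> Basis" "p \<in> X \<times> X" for bs p
    unfolding k using partials_parametric_integral[OF o C(1) A cont der that]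
    by (simp add: D_def kcomp_def)
qed

text \<open>Two separate outer sets \<open>Q1\<close> and \<open>Q2\<close> are kept so that one of
  them can later be moved off a projection of the support. A bound \<open>v\<close> instead of the
  measure itself allows the same constant for \<open>K\<close>, \<open>K'\<close> and
  \<open>K' - K\<close>.\<close>

lemma seminorm_kcomp_le:
  fixes f g :: "'a::euclidean_space \<times> 'a \<Rightarrow> 'k::{real_normed_field,euclidean_space}"
  assumes X: "open X" and C: "compact C" "C \<subseteq> X" and A: "A \<in> sets borel" "A \<subseteq> C"
    and f: "smooth_on (X \<times> X) f" and g: "smooth_on (X \<times> X) g"
    and Q: "compact Q1" "Q1 \<subseteq> X" "compact Q2" "Q2 \<subseteq> X" and v: "measure lborel A \<le> v"
  shows "seminorm (Q1 \<times> Q2) l (kcomp A f g) \<le> v * (seminorm (Q1 \<times> C) l f * seminorm (C \<times> Q2) l g)"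
proof -
  have c: "compact (Q1 \<times> C)" "Q1 \<times> C \<subseteq> X \<times> X" "compact (C \<times> Q2)" "C \<times> Q2 \<subseteq> X \<times> X"
    using C Q by (auto intro: compact_Times)
  have nn: "0 \<le> seminorm (Q1 \<times> C) l f * seminorm (C \<times> Q2) l g"
    by (intro mult_nonneg_nonneg seminorm_nonneg[OF c(1,2) f] seminorm_nonneg[OF c(3,4) g])
  have v0: "0 \<le> v" using v measure_nonneg[of lborel A] by linarith
  show ?thesis
  proof (rule seminorm_leI)
    show "0 \<le> v * (seminorm (Q1 \<times> C) l f * seminorm (C \<times> Q2) l g)"
      using nn v0 by simp
    fix p bs assume p: "p \<in> Q1 \<times> Q2" and bs: "set bs \<subseteq> (Basis :: ('a \<times> 'a) set)" "length bs \<le> l"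
    let ?f = "partials (filter (\<lambda>b. snd b = 0) bs) f" and ?g = "partials (filter (\<lambda>b. snd b \<noteq> 0) bs) g"
    have pX: "p \<in> X \<times> X" using p Q by auto
    have len: "length (filter P bs) \<le> l" for P using bs(2) length_filter_le order_trans by blast
    have "norm (partials bs (kcomp A f g) p) = norm (LINT \<xi>:A|lborel. ?f (fst p, \<xi>) * ?g (\<xi>, snd p))"
      using partials_kcomp[OF X C A f g bs(1) pX] by (simp add: kcomp_def)
    also have "\<dots> \<le> (seminorm (Q1 \<times> C) l f * seminorm (C \<times> Q2) l g) * measure lborel A"
    proof (rule norm_set_integral_le[OF C(1) A(2,1)])
      show "set_integrable lborel A (\<lambda>\<xi>. ?f (fst p, \<xi>) * ?g (\<xi>, snd p))"
        using continuous_on_slice[OF continuous_on_kcomp_integrand[of X ?f ?g C] pX] C bs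
          smooth_on_continuous_partials[OF f, of "filter (\<lambda>b. snd b = 0) bs"]
          smooth_on_continuous_partials[OF g, of "filter (\<lambda>b. snd b \<noteq> 0) bs"]
        by (intro set_integrable_continuous_on[OF C(1) _ A]) auto
      fix \<xi> assume "\<xi> \<in> A"
      then have "(fst p, \<xi>) \<in> Q1 \<times> C" "(\<xi>, snd p) \<in> C \<times> Q2" using A p by auto
      then show "norm (?f (fst p, \<xi>) * ?g (\<xi>, snd p)) \<le> seminorm (Q1 \<times> C) l f * seminorm (C \<times> Q2) l g"
        unfolding norm_mult using len bs(1)
        by (intro mult_mono norm_partials_le_seminorm[OF c(1,2) f] norm_partials_le_seminorm[OF c(3,4) g]
            seminorm_nonneg[OF c(1,2) f] norm_ge_zero) auto
    qed
    also have "\<dots> \<le> (seminorm (Q1 \<times> C) l f * seminorm (C \<times> Q2) l g) * v"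
      using nn v by (intro mult_left_mono)
    finally show "norm (partials bs (kcomp A f g) p) \<le> v * (seminorm (Q1 \<times> C) l f * seminorm (C \<times> Q2) l g)"
      by (simp add: mult.commute)
  qed
qed

text \<open>Left factor, right factor and domain are exchanged one at a time, so that each term
  contains a single change.\<close>

lemma kcomp_diff:
  assumes "compact K'" "K' \<subseteq> X" "K \<subseteq> K'" "compact K"
    and s: "smooth_on (X \<times> X) f" "smooth_on (X \<times> X) f'" "smooth_on (X \<times> X) h" "smooth_on (X \<times> X) h'"
    and X: "open X" and p: "p \<in> X \<times> X"
  shows "kcomp K' f' h' p - kcomp K f h p =
    kcomp K (\<lambda>z. f' z - f z) h p + kcomp K f' (\<lambda>z. h' z - h z) p + kcomp (K' - K) f' h' p"
proof -
  have o: "open (X \<times> X)" using X by (simp add: open_Times)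
  have KX: "K \<subseteq> X" using assms by auto
  have b: "K \<in> sets borel" "K' - K \<in> sets borel"
    using borel_compact[OF assms(1)] borel_compact[OF assms(4)] by auto
  note I = set_integrable_kcomp[OF assms(4) KX b(1) subset_refl _ _ p]
  have "kcomp K' f' h' p = kcomp K f' h' p + kcomp (K' - K) f' h' p"
    unfolding kcomp_def using assms(1-3) p
      set_integral_Un[of K "K' - K" lborel "\<lambda>\<xi>. f' (fst p, \<xi>) * h' (\<xi>, snd p)"]
      I[OF s(2,4)] set_integrable_kcomp[OF assms(1,2) b(2) _ s(2,4) p]
    by (auto simp: Un_absorb1)
  moreover have "kcomp K (\<lambda>z. f' z - f z) h p = kcomp K f' h p - kcomp K f h p"
    unfolding kcomp_def left_diff_distrib by (rule set_integral_diff(2)[OF I[OF s(2,3)] I[OF s(1,3)]])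
  moreover have "kcomp K f' (\<lambda>z. h' z - h z) p = kcomp K f' h' p - kcomp K f' h p"
    unfolding kcomp_def right_diff_distrib by (rule set_integral_diff(2)[OF I[OF s(2,4)] I[OF s(2,3)]])
  ultimately show ?thesis by simp
qed

text \<open>The index is shifted by one: \<open>kpow K h n\<close> has \<open>n + 1\<close> factors
  and represents the iterated kernel of index \<open>Suc n\<close>. New factors are appended on the
  right.\<close>

primrec kpow :: "'a::euclidean_space set \<Rightarrow> ('a \<times> 'a \<Rightarrow> 'k::{real_normed_field,euclidean_space}) \<Rightarrow> nat \<Rightarrow>
    'a \<times> 'a \<Rightarrow> 'k" where
  "kpow K h 0 = h"
| "kpow K h (Suc n) = kcomp K (kpow K h n) h"

lemma smooth_on_kpow:
  assumes "open X" "compact K" "K \<subseteq> X" "smooth_on (X \<times> X) h"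
  shows "smooth_on (X \<times> X) (kpow K h n)"
  by (induction n) (use assms in \<open>auto intro!: smooth_on_kcomp borel_compact\<close>)

text \<open>The first variable of the power enters the first factor only, so its range
  \<open>Q1\<close> survives the induction while each of the \<open>n\<close> appended factors costs
  at most \<open>v * M\<close>.\<close>

lemma seminorm_kpow_le_left:
  assumes X: "open X" and Q: "compact Q" "Q \<subseteq> X" and K: "compact K" "K \<subseteq> Q"
    and h: "smooth_on (X \<times> X) h" and v: "measure lborel K \<le> v" and M: "seminorm (Q \<times> Q) l h \<le> M"
    and Q1: "compact Q1" "Q1 \<subseteq> Q"
  shows "seminorm (Q1 \<times> Q) l (kpow K h n) \<le> (v * M) ^ n * seminorm (Q1 \<times> Q) l h"
proof (induction n)
  case (Suc n)
  have QQ: "compact (Q \<times> Q)" "Q \<times> Q \<subseteq> X \<times> X" "compact (Q1 \<times> Q)" "Q1 \<times> Q \<subseteq> X \<times> X"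
    using Q Q1 by (auto intro: compact_Times)
  note kp = smooth_on_kpow[OF X K(1) order_trans[OF K(2) Q(2)] h]
  have nn: "0 \<le> seminorm (Q1 \<times> Q) l (kpow K h n)" by (rule seminorm_nonneg[OF QQ(3,4) kp])
  have v0: "0 \<le> v" using v measure_nonneg[of lborel K] by linarith
  have M0: "0 \<le> M" using M seminorm_nonneg[OF QQ(1,2) h, of l] by linarith
  have "seminorm (Q1 \<times> Q) l (kcomp K (kpow K h n) h) \<le> v * (seminorm (Q1 \<times> Q) l (kpow K h n) * seminorm (Q \<times> Q) l h)"
    using Q Q1 K v by (intro seminorm_kcomp_le[OF X Q _ K(2) kp h]) (auto intro: borel_compact)
  also have "\<dots> \<le> v * (((v * M) ^ n * seminorm (Q1 \<times> Q) l h) * M)"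
    using Suc M nn v0 M0 seminorm_nonneg[OF QQ(1,2) h, of l]
    by (intro mult_left_mono mult_mono mult_nonneg_nonneg zero_le_power seminorm_nonneg[OF QQ(3,4) h]) auto
  finally show ?case by (simp add: ac_simps)
qed simp

text \<open>The last variable enters only the last factor, which the recursion splits off directly;
  the preceding power is controlled by the left estimate over \<open>Q \<times> Q\<close>, so a case
  distinction takes the place of a second induction.\<close>

lemma seminorm_kpow_le_right:
  assumes X: "open X" and Q: "compact Q" "Q \<subseteq> X" and K: "compact K" "K \<subseteq> Q"
    and h: "smooth_on (X \<times> X) h" and v: "measure lborel K \<le> v" and M: "seminorm (Q \<times> Q) l h \<le> M"
    and Q2: "compact Q2" "Q2 \<subseteq> Q"
  shows "seminorm (Q \<times> Q2) l (kpow K h n) \<le> (v * M) ^ n * seminorm (Q \<times> Q2) l h"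
proof (cases n)
  case (Suc m)
  have QQ: "compact (Q \<times> Q)" "Q \<times> Q \<subseteq> X \<times> X" "compact (Q \<times> Q2)" "Q \<times> Q2 \<subseteq> X \<times> X"
    using Q Q2 by (auto intro: compact_Times)
  note kp = smooth_on_kpow[OF X K(1) order_trans[OF K(2) Q(2)] h]
  have v0: "0 \<le> v" using v measure_nonneg[of lborel K] by linarith
  have M0: "0 \<le> M" using M seminorm_nonneg[OF QQ(1,2) h, of l] by linarith
  have "seminorm (Q \<times> Q) l (kpow K h m) \<le> (v * M) ^ m * seminorm (Q \<times> Q) l h"
    by (rule seminorm_kpow_le_left[OF X Q K h v M Q(1) subset_refl])
  also have "\<dots> \<le> (v * M) ^ m * M" using M v0 M0 by (intro mult_left_mono) auto
  finally have *: "seminorm (Q \<times> Q) l (kpow K h m) \<le> (v * M) ^ m * M" .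
  have "seminorm (Q \<times> Q2) l (kcomp K (kpow K h m) h) \<le> v * (seminorm (Q \<times> Q) l (kpow K h m) * seminorm (Q \<times> Q2) l h)"
    using Q Q2 K v by (intro seminorm_kcomp_le[OF X Q _ K(2) kp h]) (auto intro: borel_compact)
  also have "\<dots> \<le> v * (((v * M) ^ m * M) * seminorm (Q \<times> Q2) l h)"
    using * v0 by (intro mult_left_mono mult_right_mono seminorm_nonneg[OF QQ(3,4) h]) auto
  finally show ?thesis by (simp add: Suc ac_simps)
qed simp

text \<open>Telescoping contributes one error for each of the \<open>n + 1\<close> factors, whence
  \<open>real (Suc n)\<close>. The quantity \<open>\<delta>\<close> measures both changes: that of
  the kernel, and that of the domain through the values of \<open>h'\<close> with first variable in
  \<open>K' - interior K\<close>.\<close>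

lemma seminorm_kpow_diff_le:
  assumes X: "open X" and Q: "compact Q" "Q \<subseteq> X" and K': "compact K'" "K' \<subseteq> Q"
    and K: "compact K" "K \<subseteq> K'"
    and h: "smooth_on (X \<times> X) h" and h': "smooth_on (X \<times> X) h'"
    and v: "measure lborel K' \<le> v" and M: "seminorm (Q \<times> Q) l h \<le> M" "seminorm (Q \<times> Q) l h' \<le> M"
    and \<delta>: "seminorm (Q \<times> Q) l (\<lambda>z. h' z - h z) + seminorm ((K' - interior K) \<times> Q) l h' \<le> \<delta>"
  shows "seminorm (Q \<times> Q) l (\<lambda>z. kpow K' h' n z - kpow K h n z) \<le> real (Suc n) * (v * M) ^ n * \<delta>"
proof (induction n)
  case 0
  have "0 \<le> seminorm ((K' - interior K) \<times> Q) l h'"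
    using Q K' by (intro seminorm_nonneg[OF _ _ h'] compact_Times compact_diff) auto
  then show ?case using \<delta> by simp
next
  case (Suc n)
  let ?p = "seminorm (Q \<times> Q) l" and ?P = "kpow K' h' n" and ?R = "kpow K h n"
  have o: "open (X \<times> X)" using X by (simp add: open_Times)
  have QQ: "compact (Q \<times> Q)" "Q \<times> Q \<subseteq> X \<times> X" using Q by (auto intro: compact_Times)
  have B: "compact (K' - interior K)" "K' - interior K \<subseteq> X" "K' - K \<in> sets borel"
    "K' - K \<subseteq> K' - interior K" "K \<subseteq> Q" "K \<in> sets borel"
    using K K' Q interior_subset[of K] borel_compact[OF K(1)] borel_compact[OF K'(1)]
    by (auto intro!: compact_diff)
  have vK: "measure lborel K \<le> v" "measure lborel (K' - K) \<le> v"
    using measure_subset_compact_le(1)[OF K'(1) K(2) B(6)]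
      measure_subset_compact_le(1)[OF K'(1) Diff_subset B(3)] v by auto
  have smP: "smooth_on (X \<times> X) ?P" using smooth_on_kpow[OF X K'(1) _ h'] K' Q by auto
  have smR: "smooth_on (X \<times> X) ?R" using smooth_on_kpow[OF X K(1) _ h] K K' Q by auto
  have smd: "smooth_on (X \<times> X) (\<lambda>z. ?P z - ?R z)" "smooth_on (X \<times> X) (\<lambda>z. h' z - h z)"
    by (intro smooth_on_diff o smP smR h h')+
  have v0: "0 \<le> v" using v measure_nonneg[of lborel K'] by linarith
  have M0: "0 \<le> M" using M seminorm_nonneg[OF QQ h, of l] by linarith
  have nn: "0 \<le> ?p (\<lambda>z. h' z - h z)" by (rule seminorm_nonneg[OF QQ smd(2)])
  have "?p ?P \<le> (v * M) ^ n * ?p h'"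
    by (rule seminorm_kpow_le_left[OF X Q K' h' v M(2) Q(1) subset_refl])
  also have "\<dots> \<le> (v * M) ^ n * M" using M v0 M0 by (intro mult_left_mono) auto
  finally have P: "?p ?P \<le> (v * M) ^ n * M" .
  have sm3: "smooth_on (X \<times> X) (kcomp K (\<lambda>z. ?P z - ?R z) h)"
    "smooth_on (X \<times> X) (kcomp K ?P (\<lambda>z. h' z - h z))"
    "smooth_on (X \<times> X) (kcomp (K' - K) ?P h')"
    using smooth_on_kcomp[OF X Q B(6,5) smd(1) h] smooth_on_kcomp[OF X Q B(6,5) smP smd(2)]
      smooth_on_kcomp[OF X B(1-4) smP h'] by auto
  have "?p (\<lambda>z. kpow K' h' (Suc n) z - kpow K h (Suc n) z) =
    ?p (\<lambda>z. (kcomp K (\<lambda>z. ?P z - ?R z) h z + kcomp K ?P (\<lambda>z. h' z - h z) z) + kcomp (K' - K) ?P h' z)"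
    using kcomp_diff[OF K'(1) _ K(2,1) smR smP h h' X] K' Q
    by (intro seminorm_cong[OF o QQ(2)]) auto
  also have "\<dots> \<le> ?p (\<lambda>z. kcomp K (\<lambda>z. ?P z - ?R z) h z + kcomp K ?P (\<lambda>z. h' z - h z) z)
      + ?p (kcomp (K' - K) ?P h')"
    by (intro seminorm_add[OF o QQ] smooth_on_add o sm3)
  also have "?p (\<lambda>z. kcomp K (\<lambda>z. ?P z - ?R z) h z + kcomp K ?P (\<lambda>z. h' z - h z) z)
      \<le> ?p (kcomp K (\<lambda>z. ?P z - ?R z) h) + ?p (kcomp K ?P (\<lambda>z. h' z - h z))"
    by (intro seminorm_add[OF o QQ] sm3)
  also have "?p (kcomp K (\<lambda>z. ?P z - ?R z) h) \<le> v * (?p (\<lambda>z. ?P z - ?R z) * ?p h)"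
    by (rule seminorm_kcomp_le[OF X Q B(6,5) smd(1) h Q Q vK(1)])
  also have "\<dots> \<le> v * ((real (Suc n) * (v * M) ^ n * \<delta>) * M)"
    using Suc M v0 M0 seminorm_nonneg[OF QQ h, of l] seminorm_nonneg[OF QQ smd(1), of l]
    by (intro mult_left_mono mult_mono) auto
  also have "?p (kcomp K ?P (\<lambda>z. h' z - h z)) \<le> v * (?p ?P * ?p (\<lambda>z. h' z - h z))"
    by (rule seminorm_kcomp_le[OF X Q B(6,5) smP smd(2) Q Q vK(1)])
  also have "\<dots> \<le> v * (((v * M) ^ n * M) * ?p (\<lambda>z. h' z - h z))"
    using P v0 nn by (intro mult_left_mono mult_right_mono) auto
  \<comment> \<open>\<open>K' - interior K\<close> is a compact superset of \<open>K' - K\<close>.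
    The intermediate variable lies in it, so the last factor supplies the small seminorm.\<close>
  also have "?p (kcomp (K' - K) ?P h') \<le>
      v * (seminorm (Q \<times> (K' - interior K)) l ?P * seminorm ((K' - interior K) \<times> Q) l h')"
    by (rule seminorm_kcomp_le[OF X B(1-4) smP h' Q Q vK(2)])
  also have "\<dots> \<le> v * (((v * M) ^ n * M) * seminorm ((K' - interior K) \<times> Q) l h')"
  proof (intro mult_left_mono mult_right_mono v0)
    have "seminorm (Q \<times> (K' - interior K)) l ?P \<le> ?p ?P"
      using K' by (intro seminorm_mono[OF QQ smP]) auto
    then show "seminorm (Q \<times> (K' - interior K)) l ?P \<le> (v * M) ^ n * M" using P by simp
    show "0 \<le> seminorm ((K' - interior K) \<times> Q) l h'"
      using Q B(1,2) by (intro seminorm_nonneg[OF _ _ h'] compact_Times) auto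
  qed
  finally have "?p (\<lambda>z. kpow K' h' (Suc n) z - kpow K h (Suc n) z) \<le>
    v * ((real (Suc n) * (v * M) ^ n * \<delta>) * M) +
    v * (((v * M) ^ n * M) * (?p (\<lambda>z. h' z - h z) + seminorm ((K' - interior K) \<times> Q) l h'))"
    by (simp add: algebra_simps)
  \<comment> \<open>The two new errors share the factor \<open>v * ((v * M) ^ n * M)\<close> and add
    up to at most one \<open>\<delta>\<close>, which raises the count from \<open>Suc n\<close> to
    \<open>Suc (Suc n)\<close>.\<close>
  also have "\<dots> \<le> v * ((real (Suc n) * (v * M) ^ n * \<delta>) * M) + v * (((v * M) ^ n * M) * \<delta>)"
    using \<delta> v0 M0 by (intro add_left_mono mult_left_mono) auto
  also have "\<dots> = real (Suc (Suc n)) * (v * M) ^ Suc n * \<delta>"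
    by (simp add: algebra_simps)
  finally show ?case .
qed

section \<open>Integral operators\<close>

text \<open>The variable \<open>x\<close> occurs in the kernel only, so derivatives of the image
  fall on \<open>h\<close> in the directions \<open>(b, 0)\<close>, and mere continuity of
  \<open>f\<close> is enough.\<close>

lemma
  fixes h :: "'a::euclidean_space \<times> 'a \<Rightarrow> 'k::{real_normed_field,euclidean_space}"
  assumes X: "open X" and C: "compact C" "C \<subseteq> X" and A: "A \<in> sets borel" "A \<subseteq> C"
    and h: "smooth_on (X \<times> X) h" and f: "continuous_on C f"
  shows smooth_on_kapply: "smooth_on X (kapply A h f)"
    and partials_kapply: "\<And>bs x. set bs \<subseteq> Basis \<Longrightarrow> x \<in> X \<Longrightarrow>
      partials bs (kapply A h f) x = kapply A (partials (map (\<lambda>b. (b, 0)) bs) h) f x"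
    and set_integrable_kapply: "\<And>bs x. set bs \<subseteq> Basis \<Longrightarrow> x \<in> X \<Longrightarrow>
      set_integrable lborel A (\<lambda>y. partials (map (\<lambda>b. (b, 0)) bs) h (x, y) * f y)"
proof -
  define D where "D = (\<lambda>bs x y. partials (map (\<lambda>b. (b, 0)) bs) h (x, y) * f y)"
  have B: "set (map (\<lambda>b. (b, 0)) bs) \<subseteq> (Basis :: ('a \<times> 'a) set)" if "set bs \<subseteq> Basis" for bs :: "'a list"
    using that by (auto simp: Basis_prod_def)
  have cont: "continuous_on (X \<times> C) (\<lambda>(x, y). D bs x y)" if "set bs \<subseteq> Basis" for bs
  proof -
    have "continuous_on (X \<times> C) (partials (map (\<lambda>b. (b, 0)) bs) h)"
      using smooth_on_continuous_partials[OF h B[OF that]] C by (auto intro: continuous_on_subset)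
    moreover have "continuous_on (X \<times> C) (\<lambda>z. f (snd z))"
      by (rule continuous_on_compose2[OF f]) (auto intro: continuous_intros)
    ultimately show ?thesis unfolding D_def split_beta by (auto intro!: continuous_on_mult)
  qed
  have der: "((\<lambda>t. D bs (x + t *\<^sub>R b) y) has_vector_derivative D (b # bs) x y) (at 0)"
    if "set bs \<subseteq> Basis" "b \<in> Basis" "x \<in> X" "y \<in> C" for bs b x y
  proof -
    have "((\<lambda>t. partials (map (\<lambda>b. (b, 0)) bs) h ((x, y) + t *\<^sub>R (b, 0)) * f y) has_vector_derivative
      partials ((b, 0) # map (\<lambda>b. (b, 0)) bs) h (x, y) * f y) (at 0)"
      by (intro has_vector_derivative_mult_left smooth_on_has_derivative[OF h] B)
         (use that C in \<open>auto simp: Basis_prod_def\<close>)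
    then show ?thesis by (simp add: D_def)
  qed
  have k: "kapply A h f = (\<lambda>x. LINT y:A|lborel. D [] x y)"
    by (auto simp: kapply_def D_def)
  show "smooth_on X (kapply A h f)"
    unfolding k by (rule smooth_on_parametric_integral[OF X C(1) A cont der])
  show "partials bs (kapply A h f) x = kapply A (partials (map (\<lambda>b. (b, 0)) bs) h) f x"
    if "set bs \<subseteq> Basis" "x \<in> X" for bs x
    unfolding k using partials_parametric_integral[OF X C(1) A cont der that]
    by (simp add: D_def kapply_def)
  show "set_integrable lborel A (\<lambda>y. partials (map (\<lambda>b. (b, 0)) bs) h (x, y) * f y)"
    if "set bs \<subseteq> Basis" "x \<in> X" for bs x
    using continuous_on_slice[OF cont[OF that(1)] that(2)]
    by (intro set_integrable_continuous_on[OF C(1) _ A]) (simp add: D_def)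
qed

text \<open>\<open>f\<close> is never differentiated, hence its seminorm of order 0 whatever
  \<open>l\<close> is.\<close>

lemma seminorm_kapply_le:
  fixes h :: "'a::euclidean_space \<times> 'a \<Rightarrow> 'k::{real_normed_field,euclidean_space}"
  assumes X: "open X" and C: "compact C" "C \<subseteq> X" and A: "A \<in> sets borel" "A \<subseteq> C"
    and h: "smooth_on (X \<times> X) h" and f: "smooth_on X f"
    and Q: "compact Q" "Q \<subseteq> X" and v: "measure lborel A \<le> v"
  shows "seminorm Q l (kapply A h f) \<le> v * (seminorm (Q \<times> C) l h * seminorm C 0 f)"
proof -
  have c: "compact (Q \<times> C)" "Q \<times> C \<subseteq> X \<times> X" using C Q by (auto intro: compact_Times)
  have nn: "0 \<le> seminorm (Q \<times> C) l h * seminorm C 0 f"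
    by (intro mult_nonneg_nonneg seminorm_nonneg[OF c h] seminorm_nonneg[OF C f])
  have v0: "0 \<le> v" using v measure_nonneg[of lborel A] by linarith
  have fc: "continuous_on C f" using smooth_on_imp_continuous_on[OF f] C continuous_on_subset by blast
  show ?thesis
  proof (rule seminorm_leI)
    show "0 \<le> v * (seminorm (Q \<times> C) l h * seminorm C 0 f)" using nn v0 by simp
    fix x bs assume x: "x \<in> Q" and bs: "set bs \<subseteq> (Basis :: 'a set)" "length bs \<le> l"
    let ?h = "partials (map (\<lambda>b. (b, 0)) bs) h"
    have xX: "x \<in> X" using x Q by auto
    have "norm (partials bs (kapply A h f) x) = norm (LINT y:A|lborel. ?h (x, y) * f y)"
      using partials_kapply[OF X C A h fc bs(1) xX] by (simp add: kapply_def)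
    also have "\<dots> \<le> (seminorm (Q \<times> C) l h * seminorm C 0 f) * measure lborel A"
    proof (rule norm_set_integral_le[OF C(1) A(2,1) set_integrable_kapply[OF X C A h fc bs(1) xX]])
      fix y assume y: "y \<in> A"
      show "norm (?h (x, y) * f y) \<le> seminorm (Q \<times> C) l h * seminorm C 0 f"
        unfolding norm_mult using y x bs A
        by (intro mult_mono norm_partials_le_seminorm[OF c h] norm_le_seminorm[OF C f]
            seminorm_nonneg[OF c h] norm_ge_zero) (auto simp: Basis_prod_def)
    qed
    also have "\<dots> \<le> (seminorm (Q \<times> C) l h * seminorm C 0 f) * v"
      using nn v by (intro mult_left_mono)
    finally show "norm (partials bs (kapply A h f) x) \<le> v * (seminorm (Q \<times> C) l h * seminorm C 0 f)"
      by (simp add: mult.commute)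
  qed
qed

lemma kapply_diff:
  assumes X: "open X" and K': "compact K'" "K' \<subseteq> X" and K: "K \<subseteq> K'" "compact K"
    and s: "smooth_on (X \<times> X) h" "smooth_on (X \<times> X) h'" "smooth_on X f" "smooth_on X f'"
    and x: "x \<in> X"
  shows "kapply K' h' f' x - kapply K h f x =
    kapply K (\<lambda>z. h' z - h z) f x + kapply K h' (\<lambda>z. f' z - f z) x + kapply (K' - K) h' f' x"
proof -
  have b: "K \<in> sets borel" "K' - K \<in> sets borel"
    using borel_compact[OF K'(1)] borel_compact[OF K(2)] by auto
  have c: "continuous_on K' g" if "smooth_on X g" for g :: "'a \<Rightarrow> 'b"
    using smooth_on_imp_continuous_on[OF that] K' continuous_on_subset by blast
  have I: "set_integrable lborel A (\<lambda>y. h (x, y) * f y)"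
    if "A \<in> sets borel" "A \<subseteq> K'" "smooth_on (X \<times> X) h" "smooth_on X f" for A and h :: "'a \<times> 'a \<Rightarrow> 'b" and f
    using set_integrable_kapply[OF X K' that(1-3) c[OF that(4)], of "[]" x] x by simp
  have "kapply K' h' f' x = kapply K h' f' x + kapply (K' - K) h' f' x"
    unfolding kapply_def
    using set_integral_Un[of K "K' - K" lborel "\<lambda>y. h' (x, y) * f' y"] I[OF _ _ s(2,4)] b K
    by (auto simp: Un_absorb1)
  moreover have "kapply K (\<lambda>z. h' z - h z) f x = kapply K h' f x - kapply K h f x"
    unfolding kapply_def left_diff_distrib by (rule set_integral_diff(2)[OF I I]) (use b K s in auto)
  moreover have "kapply K h' (\<lambda>z. f' z - f z) x = kapply K h' f' x - kapply K h' f x"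
    unfolding kapply_def right_diff_distrib by (rule set_integral_diff(2)[OF I I]) (use b K s in auto)
  ultimately show ?thesis by simp
qed

text \<open>Fubini for an integrand that is continuous on the compact \<open>K \<times> K\<close>
  and extended by zero: composing operators composes their kernels.\<close>

lemma kapply_kapply:
  fixes h g :: "'a::euclidean_space \<times> 'a \<Rightarrow> 'k::{real_normed_field,euclidean_space}"
  assumes K: "compact K" "K \<subseteq> X"
    and s: "continuous_on (X \<times> X) h" "continuous_on (X \<times> X) g" "continuous_on X f" and x: "x \<in> X"
  shows "kapply K h (kapply K g f) x = kapply K (kcomp K h g) f x"
proof -
  define \<phi> where "\<phi> = (\<lambda>(\<xi>, y). h (x, \<xi>) * g (\<xi>, y) * f y)"
  have "continuous_on (K \<times> K) \<phi>"
    unfolding \<phi>_def split_beta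
    by (intro continuous_on_mult continuous_on_compose2[OF s(1), of _ "\<lambda>z. (x, fst z)"]
        continuous_on_compose2[OF s(2), of _ "\<lambda>z. (fst z, snd z)"] continuous_on_compose2[OF s(3), of _ snd]
        continuous_intros) (use K x in auto)
  then have int: "integrable (lborel \<Otimes>\<^sub>M lborel) (\<lambda>z. indicator (K \<times> K) z *\<^sub>R \<phi> z)"
    unfolding lborel_prod using borel_integrable_compact[OF compact_Times[OF K(1,1)]] by blast
  have "(\<integral>y. (\<integral>\<xi>. indicator (K \<times> K) (\<xi>, y) *\<^sub>R \<phi> (\<xi>, y) \<partial>lborel) \<partial>lborel) =
      (\<integral>\<xi>. (\<integral>y. indicator (K \<times> K) (\<xi>, y) *\<^sub>R \<phi> (\<xi>, y) \<partial>lborel) \<partial>lborel)"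
    using lborel_pair.Fubini_integral[of "\<lambda>\<xi> y. indicator (K \<times> K) (\<xi>, y) *\<^sub>R \<phi> (\<xi>, y)"] int
    by (simp add: split_beta')
  also have "(\<integral>\<xi>. (\<integral>y. indicator (K \<times> K) (\<xi>, y) *\<^sub>R \<phi> (\<xi>, y) \<partial>lborel) \<partial>lborel) =
      kapply K h (kapply K g f) x"
  proof -
    have "(\<integral>y. indicator (K \<times> K) (\<xi>, y) *\<^sub>R \<phi> (\<xi>, y) \<partial>lborel) =
        indicat_real K \<xi> *\<^sub>R (h (x, \<xi>) * kapply K g f \<xi>)" for \<xi>
    proof -
      have "indicator (K \<times> K) (\<xi>, y) *\<^sub>R \<phi> (\<xi>, y) =
        indicat_real K \<xi> *\<^sub>R (h (x, \<xi>) * (indicat_real K y *\<^sub>R (g (\<xi>, y) * f y)))" for y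
        by (auto simp: indicator_def \<phi>_def)
      then show ?thesis
        by (simp only: kapply_def set_lebesgue_integral_def integral_scaleR_right integral_mult_right_zero)
    qed
    then show ?thesis by (simp add: kapply_def[of K h] set_lebesgue_integral_def)
  qed
  also have "(\<integral>y. (\<integral>\<xi>. indicator (K \<times> K) (\<xi>, y) *\<^sub>R \<phi> (\<xi>, y) \<partial>lborel) \<partial>lborel) =
      kapply K (kcomp K h g) f x"
  proof -
    have "(\<integral>\<xi>. indicator (K \<times> K) (\<xi>, y) *\<^sub>R \<phi> (\<xi>, y) \<partial>lborel) =
        indicat_real K y *\<^sub>R (kcomp K h g (x, y) * f y)" for y
    proof -
      have "indicator (K \<times> K) (\<xi>, y) *\<^sub>R \<phi> (\<xi>, y) =
        indicat_real K y *\<^sub>R ((indicat_real K \<xi> *\<^sub>R (h (x, \<xi>) * g (\<xi>, y))) * f y)" for \<xi>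
        by (auto simp: indicator_def \<phi>_def)
      then show ?thesis
        by (simp only: kcomp_def set_lebesgue_integral_def integral_scaleR_right integral_mult_left_zero
            fst_conv snd_conv)
    qed
    then show ?thesis by (simp add: kapply_def set_lebesgue_integral_def)
  qed
  finally show ?thesis by simp
qed

section \<open>The iterated kernels\<close>

text \<open>Coordinate \<open>i\<close> becomes the outer integral, so that in the application the
  inner integral over the remaining coordinates is the previous iterated kernel.\<close>

lemma (in product_sigma_finite) product_integral_insert_rev:
  fixes f :: "_ \<Rightarrow> _::{banach, second_countable_topology}"
  assumes I: "finite I" "i \<notin> I" and f: "integrable (Pi\<^sub>M (insert i I) M) f"
  shows "integral\<^sup>L (Pi\<^sub>M (insert i I) M) f = (\<integral>t. (\<integral>\<xi>. f (\<xi>(i := t)) \<partial>Pi\<^sub>M I M) \<partial>M i)"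
proof -
  interpret I: finite_product_sigma_finite M I by standard fact
  have "integral\<^sup>L (Pi\<^sub>M (insert i I) M) f = integral\<^sup>L (Pi\<^sub>M ({i} \<union> I) M) f" by simp
  also have "\<dots> = (\<integral>x. (\<integral>y. f (merge {i} I (x, y)) \<partial>Pi\<^sub>M I M) \<partial>Pi\<^sub>M {i} M)"
    using f I by (intro product_integral_fold) auto
  \<comment> \<open>Points of the product space over \<open>I\<close> are \<open>undefined\<close>
    outside \<open>I\<close>, and so is \<open>merge\<close> outside \<open>{i} \<union> I\<close>;
    hence \<open>merge\<close> is a plain update.\<close>
  also have "\<dots> = (\<integral>x. (\<integral>y. f (y(i := x i)) \<partial>Pi\<^sub>M I M) \<partial>Pi\<^sub>M {i} M)"
  proof (intro Bochner_Integration.integral_cong refl arg_cong[where f = f])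
    fix x y assume "y \<in> space (Pi\<^sub>M I M)"
    then have "y \<in> extensional I" by (auto simp: space_PiM PiE_def)
    then show "merge {i} I (x, y) = y(i := x i)"
      using I(2) by (auto simp: merge_def fun_eq_iff extensional_def)
  qed
  also have "\<dots> = (\<integral>t. (\<integral>y. f (y(i := t)) \<partial>Pi\<^sub>M I M) \<partial>M i)"
  proof (rule product_integral_singleton)
    have swap: "(\<lambda>(t, y). (y, t)) \<in> measurable (M i \<Otimes>\<^sub>M Pi\<^sub>M I M) (Pi\<^sub>M I M \<Otimes>\<^sub>M M i)"
      by measurable
    have "(\<lambda>(t, y). f (y(i := t))) \<in> borel_measurable (M i \<Otimes>\<^sub>M Pi\<^sub>M I M)"
      using measurable_compose[OF measurable_compose[OF swap measurable_add_dim] borel_measurable_integrable[OF f]]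
      by (simp add: split_beta')
    then show "(\<lambda>t. \<integral>y. f (y(i := t)) \<partial>Pi\<^sub>M I M) \<in> borel_measurable (M i)"
      by (intro I.borel_measurable_lebesgue_integral) (simp add: split_beta')
  qed
  finally show ?thesis .
qed

lemma iter_kernel_net_1: "iter_kernel_net K h 1 \<epsilon> p = h \<epsilon> p"
proof -
  have "product_sigma_finite (\<lambda>i::nat. lborel :: 'a measure)"
    by (simp add: product_sigma_finite_def sigma_finite_lborel)
  then show ?thesis
    by (cases p) (simp add: iter_kernel_net_def set_lebesgue_integral_def PiM_empty
        lebesgue_integral_count_space_finite)
qed

text \<open>The last intermediate variable \<open>t = \<xi> n\<close> is integrated last. Of the two
  factors that contain it, \<open>h \<epsilon> (t, y)\<close> is constant in the other variables and
  comes out of the inner integral.\<close>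

lemma iter_kernel_net_Suc:
  fixes h :: "('a::euclidean_space \<times> 'a, 'k::{real_normed_field,euclidean_space}) net"
  assumes K: "compact K" "K \<subseteq> X" and h: "continuous_on (X \<times> X) (h \<epsilon>)" and X: "open X"
    and p: "p \<in> X \<times> X" and n: "n \<ge> 1"
  shows "iter_kernel_net K h (Suc n) \<epsilon> p = kcomp K (iter_kernel_net K h n \<epsilon>) (h \<epsilon>) p"
proof -
  interpret product_sigma_finite "\<lambda>i::nat. lborel :: 'a measure"
    by (simp add: product_sigma_finite_def sigma_finite_lborel)
  obtain x y where xy: "p = (x, y)" "x \<in> X" "y \<in> X" using p by auto
  \<comment> \<open>The chain of points runs from \<open>x\<close> through \<open>K\<close> to
    \<open>y\<close>, so all arguments of the kernel lie in this compact set.\<close>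
  define Q where "Q = insert x (insert y K)"
  have Q: "compact Q" "Q \<subseteq> X" using K xy by (auto simp: Q_def)
  \<comment> \<open>\<open>h \<epsilon>\<close> is controlled only on \<open>X \<times> X\<close>.
    Cutting it off outside \<open>Q \<times> Q\<close> yields a bounded Borel function on the whole
    space, which makes the product integrable, without changing the integrand over
    \<open>K\<close>.\<close>
  define g where "g z = indicat_real (Q \<times> Q) z *\<^sub>R h \<epsilon> z" for z
  have QQ: "compact (Q \<times> Q)" "Q \<times> Q \<subseteq> X \<times> X" using Q by (auto intro: compact_Times)
  have hc: "continuous_on (Q \<times> Q) (h \<epsilon>)" using h QQ continuous_on_subset by blast
  have g_meas: "g \<in> borel_measurable borel"
    unfolding g_def by (intro borel_measurable_continuous_on_indicator hc borel_compact QQ(1))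
  obtain M where M: "0 \<le> M" "\<And>z. norm (g z) \<le> M"
  proof -
    obtain M where "\<And>z. z \<in> Q \<times> Q \<Longrightarrow> norm (h \<epsilon> z) \<le> M"
      using compact_imp_bounded[OF compact_continuous_image[OF hc QQ(1)]] by (auto simp: bounded_iff)
    then have "norm (g z) \<le> max 0 M" for z by (auto simp: g_def indicator_def max.coboundedI2)
    then show thesis using that[of "max 0 M"] by auto
  qed
  define I where "I = {1..<n}"
  have I: "finite I" "n \<notin> I" "{1..<Suc n} = insert n I" using n by (auto simp: I_def)
  define F where "F \<xi> = (let \<zeta> = \<xi>(0 := x, Suc n := y) in \<Prod>i<Suc n. g (\<zeta> i, \<zeta> (Suc i)))" for \<xi> :: "nat \<Rightarrow> 'a"
  have gh: "g (a, b) = h \<epsilon> (a, b)" if "a \<in> Q" "b \<in> Q" for a b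
    using that by (simp add: g_def)
  have Kb: "K \<in> sets borel" using K by (simp add: borel_compact)
  have fac: "F (\<xi>(n := t)) = (let \<zeta> = \<xi>(0 := x, n := t) in \<Prod>i<n. g (\<zeta> i, \<zeta> (Suc i))) * g (t, y)" for \<xi> t
  proof -
    have "(\<xi>(n := t))(0 := x, Suc n := y) = (\<xi>(0 := x, n := t))(Suc n := y)"
      using n by (auto simp: fun_eq_iff)
    then show ?thesis using n unfolding F_def Let_def by (auto intro!: prod.cong)
  qed
  have Fm: "F \<in> borel_measurable (Pi\<^sub>M (insert n I) (\<lambda>_. lborel))"
  proof -
    have comp: "(\<lambda>\<xi>. (\<xi>(0 := x, Suc n := y)) i) \<in> borel_measurable (Pi\<^sub>M (insert n I) (\<lambda>_. lborel))"
      if "i \<le> Suc n" for i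
    proof (cases "i = 0 \<or> i = Suc n")
      case False
      then have "i \<in> insert n I" using that by (auto simp: I_def)
      then have "(\<lambda>\<xi>. \<xi> i) \<in> measurable (Pi\<^sub>M (insert n I) (\<lambda>_. lborel)) (lborel :: 'a measure)"
        by (rule measurable_component_singleton)
      then show ?thesis using False by simp
    qed auto
    have "(\<lambda>\<xi>. g ((\<xi>(0 := x, Suc n := y)) i, (\<xi>(0 := x, Suc n := y)) (Suc i)))
        \<in> borel_measurable (Pi\<^sub>M (insert n I) (\<lambda>_. lborel))" if "i < Suc n" for i
      by (rule measurable_compose[OF borel_measurable_Pair g_meas]) (rule comp, use that in simp)+
    then show ?thesis unfolding F_def Let_def by (intro borel_measurable_prod) auto
  qed
  have PiK: "({1..<Suc n} \<rightarrow>\<^sub>E K) \<in> sets (Pi\<^sub>M (insert n I) (\<lambda>_. lborel))"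
    unfolding I(3) using I(1) Kb by (intro sets_PiM_I_finite) auto
  have PiKfin: "emeasure (Pi\<^sub>M (insert n I) (\<lambda>_. lborel)) ({1..<Suc n} \<rightarrow>\<^sub>E K) < \<infinity>"
  proof -
    have "emeasure (Pi\<^sub>M (insert n I) (\<lambda>_. lborel)) ({1..<Suc n} \<rightarrow>\<^sub>E K) = (\<Prod>i\<in>insert n I. emeasure lborel K)"
      unfolding I(3) using I(1) Kb by (intro emeasure_PiM) auto
    also have "\<dots> < \<infinity>" using emeasure_compact_finite[OF K(1)] by (simp add: less_top[symmetric] power_eq_top_ennreal)
    finally show ?thesis .
  qed
  have Fint: "integrable (Pi\<^sub>M (insert n I) (\<lambda>_. lborel))
      (\<lambda>\<xi>. indicat_real ({1..<Suc n} \<rightarrow>\<^sub>E K) \<xi> *\<^sub>R F \<xi>)"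
  proof (rule integrableI_bounded_set_indicator[OF PiK Fm PiKfin, of "M ^ Suc n"])
    have "norm (F \<xi>) \<le> M ^ Suc n" for \<xi>
    proof -
      have "norm (F \<xi>) = (\<Prod>i<Suc n. norm (g ((\<xi>(0 := x, Suc n := y)) i, (\<xi>(0 := x, Suc n := y)) (Suc i))))"
        by (simp add: F_def Let_def prod_norm[symmetric] norm_mult)
      also have "\<dots> \<le> (\<Prod>i<Suc n. M)" by (intro prod_mono) (use M in auto)
      finally show ?thesis by simp
    qed
    then show "AE \<xi> in Pi\<^sub>M (insert n I) (\<lambda>_. lborel). \<xi> \<in> {1..<Suc n} \<rightarrow>\<^sub>E K \<longrightarrow> norm (F \<xi>) \<le> M ^ Suc n"
      by auto
  qed
  have "iter_kernel_net K h (Suc n) \<epsilon> p =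
    (LINT \<xi>|(Pi\<^sub>M (insert n I) (\<lambda>_. lborel)). indicat_real ({1..<Suc n} \<rightarrow>\<^sub>E K) \<xi> *\<^sub>R F \<xi>)"
    unfolding iter_kernel_net_def xy set_lebesgue_integral_def I(3)[symmetric] prod.case
  proof (intro Bochner_Integration.integral_cong refl)
    fix \<xi> :: "nat \<Rightarrow> 'a"
    have "(let \<zeta> = \<xi>(0 := x, Suc n := y) in \<Prod>i<Suc n. h \<epsilon> (\<zeta> i, \<zeta> (Suc i))) = F \<xi>"
      if "\<xi> \<in> {1..<Suc n} \<rightarrow>\<^sub>E K"
    proof -
      have inQ: "(\<xi>(0 := x, Suc n := y)) i \<in> Q" if "i \<le> Suc n" for i
        using \<open>\<xi> \<in> {1..<Suc n} \<rightarrow>\<^sub>E K\<close> that by (auto simp: Q_def PiE_iff)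
      show ?thesis unfolding F_def Let_def by (intro prod.cong refl gh[symmetric] inQ) auto
    qed
    then show "indicat_real ({1..<Suc n} \<rightarrow>\<^sub>E K) \<xi> *\<^sub>R (let \<zeta> = \<xi>(0 := x, Suc n := y) in \<Prod>i<Suc n. h \<epsilon> (\<zeta> i, \<zeta> (Suc i)))
        = indicat_real ({1..<Suc n} \<rightarrow>\<^sub>E K) \<xi> *\<^sub>R F \<xi>"
      by (auto simp: indicator_def)
  qed
  also have "\<dots> = (\<integral>t. (\<integral>\<xi>. indicat_real ({1..<Suc n} \<rightarrow>\<^sub>E K) (\<xi>(n := t)) *\<^sub>R F (\<xi>(n := t))
      \<partial>Pi\<^sub>M I (\<lambda>_. lborel)) \<partial>lborel)"
    by (rule product_integral_insert_rev[OF I(1,2) Fint])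
  also have "\<dots> = (\<integral>t. indicat_real K t *\<^sub>R (iter_kernel_net K h n \<epsilon> (x, t) * h \<epsilon> (t, y)) \<partial>lborel)"
  proof (intro Bochner_Integration.integral_cong refl)
    fix t :: 'a
    have "(\<integral>\<xi>. indicat_real ({1..<Suc n} \<rightarrow>\<^sub>E K) (\<xi>(n := t)) *\<^sub>R F (\<xi>(n := t)) \<partial>Pi\<^sub>M I (\<lambda>_. lborel)) =
      (\<integral>\<xi>. indicat_real K t *\<^sub>R ((indicat_real (I \<rightarrow>\<^sub>E K) \<xi> *\<^sub>R
        (let \<zeta> = \<xi>(0 := x, n := t) in \<Prod>i<n. h \<epsilon> (\<zeta> i, \<zeta> (Suc i)))) * h \<epsilon> (t, y)) \<partial>Pi\<^sub>M I (\<lambda>_. lborel))"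
    proof (intro Bochner_Integration.integral_cong refl)
      fix \<xi> assume "\<xi> \<in> space (Pi\<^sub>M I (\<lambda>_. lborel :: 'a measure))"
      then have ext: "\<xi> \<in> extensional I" by (auto simp: space_PiM PiE_def)
      have ind: "indicat_real ({1..<Suc n} \<rightarrow>\<^sub>E K) (\<xi>(n := t)) = indicat_real K t * indicat_real (I \<rightarrow>\<^sub>E K) \<xi>"
        unfolding I(3) using ext I(2)
        by (auto simp: indicator_def PiE_iff extensional_def split: if_splits)
      have "F (\<xi>(n := t)) = (let \<zeta> = \<xi>(0 := x, n := t) in \<Prod>i<n. h \<epsilon> (\<zeta> i, \<zeta> (Suc i))) * h \<epsilon> (t, y)"
        if "t \<in> K" "\<xi> \<in> I \<rightarrow>\<^sub>E K"
      proof -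
        have inQ: "(\<xi>(0 := x, n := t)) i \<in> Q" if "i \<le> n" for i
          using \<open>\<xi> \<in> I \<rightarrow>\<^sub>E K\<close> \<open>t \<in> K\<close> that by (auto simp: Q_def PiE_iff I_def)
        have "(\<Prod>i<n. g ((\<xi>(0 := x, n := t)) i, (\<xi>(0 := x, n := t)) (Suc i))) =
           (\<Prod>i<n. h \<epsilon> ((\<xi>(0 := x, n := t)) i, (\<xi>(0 := x, n := t)) (Suc i)))"
          by (intro prod.cong refl gh inQ) auto
        then show ?thesis unfolding fac Let_def using gh[of t y] that by (simp add: Q_def)
      qed
      then show "indicat_real ({1..<Suc n} \<rightarrow>\<^sub>E K) (\<xi>(n := t)) *\<^sub>R F (\<xi>(n := t)) =
        indicat_real K t *\<^sub>R ((indicat_real (I \<rightarrow>\<^sub>E K) \<xi> *\<^sub>R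
        (let \<zeta> = \<xi>(0 := x, n := t) in \<Prod>i<n. h \<epsilon> (\<zeta> i, \<zeta> (Suc i)))) * h \<epsilon> (t, y))"
        unfolding ind by (auto simp: indicator_def)
    qed
    then show "(\<integral>\<xi>. indicat_real ({1..<Suc n} \<rightarrow>\<^sub>E K) (\<xi>(n := t)) *\<^sub>R F (\<xi>(n := t)) \<partial>Pi\<^sub>M I (\<lambda>_. lborel)) =
      indicat_real K t *\<^sub>R (iter_kernel_net K h n \<epsilon> (x, t) * h \<epsilon> (t, y))"
      by (simp only: iter_kernel_net_def set_lebesgue_integral_def I_def[symmetric] prod.case
          integral_scaleR_right integral_mult_left_zero)
  qed
  finally show ?thesis by (simp add: kcomp_def set_lebesgue_integral_def xy)
qed

lemma iter_kernel_net_eq_kpow: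
  fixes h :: "('a::euclidean_space \<times> 'a, 'k::{real_normed_field,euclidean_space}) net"
  assumes K: "compact K" "K \<subseteq> X" and h: "continuous_on (X \<times> X) (h \<epsilon>)" and X: "open X"
    and p: "p \<in> X \<times> X"
  shows "iter_kernel_net K h (Suc n) \<epsilon> p = kpow K (h \<epsilon>) n p"
  using p
proof (induction n arbitrary: p)
  case 0
  then show ?case using iter_kernel_net_1[of K h \<epsilon> p] by simp
next
  case (Suc n)
  have "kcomp K (iter_kernel_net K h (Suc n) \<epsilon>) (h \<epsilon>) p = kcomp K (kpow K (h \<epsilon>) n) (h \<epsilon>) p"
    unfolding kcomp_def
    by (rule set_lebesgue_integral_cong) (use Suc K in \<open>auto intro: borel_compact\<close>)
  then show ?case using iter_kernel_net_Suc[where n = "Suc n" and h = h and \<epsilon> = \<epsilon>, OF K h X Suc.prems] by simp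
qed

section \<open>Generalized integral operators\<close>

lemma colombeau_smooth_on:
  assumes "open \<Omega>" "U \<in> colombeau \<Omega>" "u \<in> U" "\<epsilon> \<in> {0<..1}"
  shows "smooth_on \<Omega> (u \<epsilon>)"
  using colombeau_mem(1)[OF assms(1-3)] assms(4) by (auto simp: moderate_nets_def smooth_nets_def)

lemma colombeau_moderate_growth:
  assumes "open \<Omega>" "U \<in> colombeau \<Omega>" "u \<in> U" "compact K" "K \<subseteq> \<Omega>"
  shows "moderate_growth (\<lambda>\<epsilon>. seminorm K l (u \<epsilon>))"
  using colombeau_mem(1)[OF assms(1-3)] assms(4,5) by (auto simp: moderate_nets_iff)

lemma colombeau_diff_rapidly_decreasing:
  assumes "open \<Omega>" "U \<in> colombeau \<Omega>" "u \<in> U" "v \<in> U" "compact K" "K \<subseteq> \<Omega>"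
  shows "rapidly_decreasing (\<lambda>\<epsilon>. seminorm K l (\<lambda>x. u \<epsilon> x - v \<epsilon> x))"
  using colombeau_diff_null[OF assms(1-4)] assms(5,6) by (auto simp: null_nets_iff)

lemma gen_supp_in: "gen_supp \<Omega> U \<subseteq> \<Omega>"
  by (auto simp: gen_supp_def)

lemma integration_domainD:
  assumes "integration_domain X H K"
  shows "compact K" "K \<subseteq> X" "gen_supp (X \<times> X) H \<subseteq> interior K \<times> interior K"
  using assms by (auto simp: integration_domain_def)

text \<open>Any two domains thus have a common larger one, which is why the comparison lemmas may
  assume \<open>K \<subseteq> K'\<close>.\<close>

lemma integration_domain_Un:
  assumes "integration_domain X H K" "integration_domain X H K'"
  shows "integration_domain X H (K \<union> K')"
  using assms interior_mono[of K "K \<union> K'"] unfolding integration_domain_def by blast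

text \<open>The witness is a closed \<open>e\<close>-neighbourhood, inside \<open>X\<close>, of the
  union of both projections of the support.\<close>

lemma integration_domain_exists:
  assumes X: "open X" and "compact (gen_supp (X \<times> X) H)"
  shows "\<exists>K. integration_domain X H K"
proof -
  let ?T = "gen_supp (X \<times> X) H"
  define S where "S = fst ` ?T \<union> snd ` ?T"
  have S: "compact S" "S \<subseteq> X"
    using assms gen_supp_in[of "X \<times> X" H]
    by (auto simp: S_def intro!: compact_Un compact_continuous_image continuous_intros)
  obtain e where e: "0 < e" "(\<Union>x\<in>S. cball x e) \<subseteq> X"
    using compact_subset_open_imp_cball_epsilon_subset[OF S(1) X S(2)] by blast
  define K where "K = (\<Union>x\<in>S. cball x e)"
  \<comment> \<open>As a sum of the compact sets \<open>S\<close> and \<open>cball 0 e\<close>, the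
    neighbourhood is compact.\<close>
  have K_eq: "K = (\<Union>x\<in>S. \<Union>y\<in>cball 0 e. {x + y})"
  proof -
    have "cball x e = (\<Union>y\<in>cball 0 e. {x + y})" for x :: 'a
      using cball_translation[of x 0 e] by (simp only: UNION_singleton_eq_range add_0_right)
    then show ?thesis unfolding K_def by (rule SUP_cong[OF refl])
  qed
  have "compact K" unfolding K_eq by (rule compact_sums'[OF S(1) compact_cball])
  moreover have "S \<subseteq> interior K"
  proof -
    have "(\<Union>x\<in>S. ball x e) \<subseteq> interior K"
      unfolding K_def by (intro interior_maximal UN_mono subset_refl ball_subset_cball open_UN ballI open_ball)
    moreover have "S \<subseteq> (\<Union>x\<in>S. ball x e)" using e(1) by (auto intro: centre_in_ball[THEN iffD2])
    ultimately show ?thesis by (rule order_trans[rotated])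
  qed
  moreover have "?T \<subseteq> S \<times> S"
  proof
    fix z assume "z \<in> ?T"
    then have "fst z \<in> S" "snd z \<in> S" by (simp_all add: S_def)
    then show "z \<in> S \<times> S" by (simp add: mem_Times_iff)
  qed
  ultimately have "integration_domain X H K"
    using e(2) by (auto simp: integration_domain_def K_def[symmetric])
  then show ?thesis ..
qed

lemma int_op_net_moderate:
  assumes X: "open X" and H: "H \<in> colombeau (X \<times> X)" "h \<in> H" and F: "F \<in> colombeau X" "f \<in> F"
    and K: "compact K" "K \<subseteq> X"
  shows "int_op_net K h f \<in> moderate_nets X"
  unfolding moderate_nets_iff smooth_nets_def
proof (intro conjI allI impI CollectI ballI)
  have o: "open (X \<times> X)" using X by (simp add: open_Times)
  note hs = colombeau_smooth_on[OF o H] and fs = colombeau_smooth_on[OF X F]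
  have Kb: "K \<in> sets borel" using K by (simp add: borel_compact)
  show sm: "smooth_on X (int_op_net K h f \<epsilon>)" if "\<epsilon> \<in> {0<..1}" for \<epsilon>
    unfolding int_op_net_eq_kapply
    using smooth_on_kapply[OF X K Kb subset_refl hs[OF that]]
      continuous_on_subset[OF smooth_on_imp_continuous_on[OF fs[OF that]] K(2)] by blast
  fix Q l assume Q: "compact Q \<and> Q \<subseteq> X"
  show "moderate_growth (\<lambda>\<epsilon>. seminorm Q l (int_op_net K h f \<epsilon>))"
  proof (rule moderate_growth_le)
    show "moderate_growth (\<lambda>\<epsilon>. measure lborel K * (seminorm (Q \<times> K) l (h \<epsilon>) * seminorm K 0 (f \<epsilon>)))"
      using Q K by (intro moderate_growth_mult moderate_growth_const colombeau_moderate_growth[OF o H]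
          colombeau_moderate_growth[OF X F] compact_Times) auto
    show "0 \<le> seminorm Q l (int_op_net K h f \<epsilon>) \<and> seminorm Q l (int_op_net K h f \<epsilon>)
        \<le> measure lborel K * (seminorm (Q \<times> K) l (h \<epsilon>) * seminorm K 0 (f \<epsilon>))" if "\<epsilon> \<in> {0<..1}" for \<epsilon>
      using seminorm_nonneg[OF _ _ sm[OF that]] Q
        seminorm_kapply_le[OF X K Kb subset_refl hs[OF that] fs[OF that], of Q]
      by (auto simp: int_op_net_eq_kapply)
  qed
qed

text \<open>Each of the three errors is a product with one negligible factor: a difference of
  representatives of \<open>H\<close>, one of \<open>F\<close>, or \<open>h'\<close> over
  \<open>Q \<times> (K' - interior K)\<close>, which misses the support.\<close>

lemma int_op_net_diff_null:
  assumes X: "open X" and H: "H \<in> colombeau (X \<times> X)" "h \<in> H" "h' \<in> H"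
    and F: "F \<in> colombeau X" "f \<in> F" "f' \<in> F"
    and K: "integration_domain X H K" and K': "integration_domain X H K'" and sub: "K \<subseteq> K'"
  shows "(\<lambda>\<epsilon> x. int_op_net K' h' f' \<epsilon> x - int_op_net K h f \<epsilon> x) \<in> null_nets X"
  unfolding null_nets_iff smooth_nets_def
proof (intro conjI allI impI CollectI ballI)
  have o: "open (X \<times> X)" using X by (simp add: open_Times)
  note hs = colombeau_smooth_on[OF o H(1,2)] and hs' = colombeau_smooth_on[OF o H(1,3)]
    and fs = colombeau_smooth_on[OF X F(1,2)] and fs' = colombeau_smooth_on[OF X F(1,3)]
  note Kc = integration_domainD[OF K] and Kc' = integration_domainD[OF K']
  show sm: "smooth_on X (\<lambda>x. int_op_net K' h' f' \<epsilon> x - int_op_net K h f \<epsilon> x)" if "\<epsilon> \<in> {0<..1}" for \<epsilon>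
    using int_op_net_moderate[OF X H(1,2) F(1,2) Kc(1,2)] int_op_net_moderate[OF X H(1,3) F(1,3) Kc'(1,2)] that
    by (intro smooth_on_diff X) (auto simp: moderate_nets_def smooth_nets_def)
  fix Q l assume "compact Q \<and> Q \<subseteq> X"
  then have Q: "compact Q" "Q \<subseteq> X" by auto
  let ?B = "K' - interior K" and ?v = "measure lborel K'"
  have B: "compact ?B" "?B \<subseteq> X" "K' - K \<in> sets borel" "K' - K \<subseteq> ?B" "K \<in> sets borel"
    using Kc Kc' interior_subset[of K] borel_compact[OF Kc(1)] borel_compact[OF Kc'(1)]
    by (auto intro!: compact_diff)
  have vK: "measure lborel K \<le> ?v" "measure lborel (K' - K) \<le> ?v"
    using measure_subset_compact_le(1)[OF Kc'(1)] B(3,5) sub by auto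
  let ?\<delta> = "\<lambda>\<epsilon>. seminorm (Q \<times> K) l (\<lambda>z. h' \<epsilon> z - h \<epsilon> z) * (?v * seminorm K 0 (f \<epsilon>))
    + seminorm K 0 (\<lambda>x. f' \<epsilon> x - f \<epsilon> x) * (?v * seminorm (Q \<times> K) l (h' \<epsilon>))
    + seminorm (Q \<times> ?B) l (h' \<epsilon>) * (?v * seminorm ?B 0 (f' \<epsilon>))"
  have QK: "compact (Q \<times> K)" "Q \<times> K \<subseteq> X \<times> X" "compact (Q \<times> ?B)" "Q \<times> ?B \<subseteq> X \<times> X"
    using Q Kc(1,2) B(1,2) by (auto intro: compact_Times)
  have off: "(Q \<times> ?B) \<inter> gen_supp (X \<times> X) H = {}" using Kc(3) by auto
  show "rapidly_decreasing (\<lambda>\<epsilon>. seminorm Q l (\<lambda>x. int_op_net K' h' f' \<epsilon> x - int_op_net K h f \<epsilon> x))"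
  proof (rule rapidly_decreasing_le)
    show "rapidly_decreasing ?\<delta>"
      by (intro rapidly_decreasing_add rapidly_decreasing_mult moderate_growth_mult moderate_growth_const
          colombeau_diff_rapidly_decreasing[OF o H(1,3,2) QK(1,2)]
          colombeau_diff_rapidly_decreasing[OF X F(1,3,2) Kc(1,2)]
          rapidly_decreasing_off_supp[OF o H(1,3) QK(3,4) off]
          colombeau_moderate_growth[OF o H(1,3) QK(1,2)] colombeau_moderate_growth[OF X F(1,2) Kc(1,2)]
          colombeau_moderate_growth[OF X F(1,3) B(1,2)])
    fix \<epsilon> :: real assume e: "\<epsilon> \<in> {0<..1}"
    note s = hs[OF e] hs'[OF e] fs[OF e] fs'[OF e]
    have sd: "smooth_on (X \<times> X) (\<lambda>z. h' \<epsilon> z - h \<epsilon> z)" "smooth_on X (\<lambda>x. f' \<epsilon> x - f \<epsilon> x)"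
      by (intro smooth_on_diff o X s)+
    have c: "continuous_on C g" if "C \<subseteq> X" "smooth_on X g" for C and g :: "'a \<Rightarrow> 'b"
      using smooth_on_imp_continuous_on[OF that(2)] that(1) continuous_on_subset by blast
    have sm3: "smooth_on X (kapply K (\<lambda>z. h' \<epsilon> z - h \<epsilon> z) (f \<epsilon>))"
      "smooth_on X (kapply K (h' \<epsilon>) (\<lambda>x. f' \<epsilon> x - f \<epsilon> x))" "smooth_on X (kapply (K' - K) (h' \<epsilon>) (f' \<epsilon>))"
      using smooth_on_kapply[OF X Kc(1,2) B(5) subset_refl sd(1) c[OF Kc(2) s(3)]]
        smooth_on_kapply[OF X Kc(1,2) B(5) subset_refl s(2) c[OF Kc(2) sd(2)]]
        smooth_on_kapply[OF X B(1-4) s(2) c[OF B(2) s(4)]] by auto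
    have "seminorm Q l (\<lambda>x. int_op_net K' h' f' \<epsilon> x - int_op_net K h f \<epsilon> x) =
      seminorm Q l (\<lambda>x. (kapply K (\<lambda>z. h' \<epsilon> z - h \<epsilon> z) (f \<epsilon>) x + kapply K (h' \<epsilon>) (\<lambda>x. f' \<epsilon> x - f \<epsilon> x) x)
        + kapply (K' - K) (h' \<epsilon>) (f' \<epsilon>) x)"
      unfolding int_op_net_eq_kapply
      by (intro seminorm_cong[OF X Q(2)] kapply_diff[OF X Kc'(1,2) sub Kc(1) s])
    also have "\<dots> \<le> seminorm Q l (\<lambda>x. kapply K (\<lambda>z. h' \<epsilon> z - h \<epsilon> z) (f \<epsilon>) x
        + kapply K (h' \<epsilon>) (\<lambda>x. f' \<epsilon> x - f \<epsilon> x) x) + seminorm Q l (kapply (K' - K) (h' \<epsilon>) (f' \<epsilon>))"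
      by (intro seminorm_add[OF X Q] smooth_on_add X sm3)
    also have "seminorm Q l (\<lambda>x. kapply K (\<lambda>z. h' \<epsilon> z - h \<epsilon> z) (f \<epsilon>) x
        + kapply K (h' \<epsilon>) (\<lambda>x. f' \<epsilon> x - f \<epsilon> x) x) \<le> seminorm Q l (kapply K (\<lambda>z. h' \<epsilon> z - h \<epsilon> z) (f \<epsilon>))
        + seminorm Q l (kapply K (h' \<epsilon>) (\<lambda>x. f' \<epsilon> x - f \<epsilon> x))"
      by (intro seminorm_add[OF X Q] sm3)
    also have "seminorm Q l (kapply K (\<lambda>z. h' \<epsilon> z - h \<epsilon> z) (f \<epsilon>)) \<le>
        ?v * (seminorm (Q \<times> K) l (\<lambda>z. h' \<epsilon> z - h \<epsilon> z) * seminorm K 0 (f \<epsilon>))"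
      by (rule seminorm_kapply_le[OF X Kc(1,2) B(5) subset_refl sd(1) s(3) Q vK(1)])
    also have "seminorm Q l (kapply K (h' \<epsilon>) (\<lambda>x. f' \<epsilon> x - f \<epsilon> x)) \<le>
        ?v * (seminorm (Q \<times> K) l (h' \<epsilon>) * seminorm K 0 (\<lambda>x. f' \<epsilon> x - f \<epsilon> x))"
      by (rule seminorm_kapply_le[OF X Kc(1,2) B(5) subset_refl s(2) sd(2) Q vK(1)])
    also have "seminorm Q l (kapply (K' - K) (h' \<epsilon>) (f' \<epsilon>)) \<le>
        ?v * (seminorm (Q \<times> ?B) l (h' \<epsilon>) * seminorm ?B 0 (f' \<epsilon>))"
      by (rule seminorm_kapply_le[OF X B(1-4) s(2) s(4) Q vK(2)])
    finally show "0 \<le> seminorm Q l (\<lambda>x. int_op_net K' h' f' \<epsilon> x - int_op_net K h f \<epsilon> x) \<and>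
        seminorm Q l (\<lambda>x. int_op_net K' h' f' \<epsilon> x - int_op_net K h f \<epsilon> x) \<le> ?\<delta> \<epsilon>"
      using seminorm_nonneg[OF Q sm[OF e]] by (simp add: ac_simps)
  qed
qed

lemma int_op_eq:
  assumes X: "open X" and H: "H \<in> colombeau (X \<times> X)" "h \<in> H" and F: "F \<in> colombeau X" "f \<in> F"
    and K: "integration_domain X H K"
  shows "int_op X H F = Cl X (int_op_net K h f)"
proof -
  \<comment> \<open>Neither domain need contain the other, so each is compared with their union;
    using this twice links two arbitrary choices.\<close>
  have *: "Cl X (int_op_net K1 h1 f1) = Cl X (int_op_net (K1 \<union> K2) h2 f2)"
    if "integration_domain X H K1" "integration_domain X H K2" "h1 \<in> H" "h2 \<in> H" "f1 \<in> F" "f2 \<in> F"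
    for K1 K2 h1 h2 f1 f2
    using that integration_domain_Un[OF that(1,2)] H F
    by (intro Cl_eqI[symmetric] X int_op_net_moderate[OF X] int_op_net_diff_null[OF X]) (auto simp: integration_domain_def)
  have "Cl X (int_op_net K h f) = Cl X (int_op_net K' h' f')"
    if "integration_domain X H K'" "h' \<in> H" "f' \<in> F" for K' h' f'
    using *[OF K that(1) H(2) that(2) F(2) that(3)] *[OF that(1) K that(2) that(2) that(3) that(3)]
    by (simp add: Un_commute)
  then show ?thesis
    unfolding int_op_def by (intro the_equality) (use assms in blast)+
qed

lemma int_op_net_mem:
  assumes X: "open X" and H: "H \<in> colombeau (X \<times> X)" "h \<in> H" and F: "F \<in> colombeau X" "f \<in> F"
    and K: "integration_domain X H K"
  shows "int_op_net K h f \<in> int_op X H F"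
  unfolding int_op_eq[OF assms]
  using K by (intro mem_Cl int_op_net_moderate[OF X H F]) (auto simp: integration_domain_def)

text \<open>If \<open>Q\<close> misses the first projection of the support of \<open>H\<close>, then
  \<open>Q \<times> K\<close> misses the support itself and the kernel is negligible there. So the
  image is supported in that projection, which is compact.\<close>

lemma int_op_in_colombeau_C:
  assumes X: "open X" and H: "H \<in> colombeau_C (X \<times> X)" and F: "F \<in> colombeau X"
  shows "int_op X H F \<in> colombeau_C X"
proof -
  have o: "open (X \<times> X)" using X by (simp add: open_Times)
  have Hc: "H \<in> colombeau (X \<times> X)" and T: "compact (gen_supp (X \<times> X) H)"
    using H by (auto simp: colombeau_C_def)
  obtain h f where hf: "h \<in> H" "f \<in> F"
    using colombeau_nonempty[OF o Hc] colombeau_nonempty[OF X F] by blast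
  obtain K where K: "integration_domain X H K" using integration_domain_exists[OF X T] by blast
  note Kc = integration_domainD[OF K]
  let ?u = "int_op_net K h f" and ?T1 = "fst ` gen_supp (X \<times> X) H"
  have eq: "int_op X H F = Cl X ?u" by (rule int_op_eq[OF X Hc hf(1) F hf(2) K])
  have mod: "?u \<in> moderate_nets X" by (rule int_op_net_moderate[OF X Hc hf(1) F hf(2) Kc(1,2)])
  have T1: "compact ?T1" "?T1 \<subseteq> X"
    using T gen_supp_in[of "X \<times> X" H] by (auto intro!: compact_continuous_image continuous_intros)
  have "?u \<in> null_nets (X - ?T1)"
    unfolding null_nets_iff
  proof (intro conjI allI impI)
    show "?u \<in> smooth_nets (X - ?T1)"
      using mod by (auto simp: moderate_nets_iff smooth_nets_def intro: smooth_on_subset)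
    fix Q l assume "compact Q \<and> Q \<subseteq> X - ?T1"
    then have Q: "compact Q" "Q \<subseteq> X" "Q \<inter> ?T1 = {}" by auto
    have QK: "compact (Q \<times> K)" "Q \<times> K \<subseteq> X \<times> X" "(Q \<times> K) \<inter> gen_supp (X \<times> X) H = {}"
      using Q Kc by (auto intro: compact_Times) force
    show "rapidly_decreasing (\<lambda>\<epsilon>. seminorm Q l (?u \<epsilon>))"
    proof (rule rapidly_decreasing_le)
      show "rapidly_decreasing (\<lambda>\<epsilon>. seminorm (Q \<times> K) l (h \<epsilon>) * (measure lborel K * seminorm K 0 (f \<epsilon>)))"
        by (intro rapidly_decreasing_mult moderate_growth_mult moderate_growth_const
            rapidly_decreasing_off_supp[OF o Hc hf(1) QK] colombeau_moderate_growth[OF X F hf(2) Kc(1,2)])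
      fix \<epsilon> :: real assume e: "\<epsilon> \<in> {0<..1}"
      have "0 \<le> seminorm Q l (?u \<epsilon>)"
        using mod e by (intro seminorm_nonneg[OF Q(1,2)]) (auto simp: moderate_nets_def smooth_nets_def)
      moreover have "seminorm Q l (?u \<epsilon>) \<le> measure lborel K * (seminorm (Q \<times> K) l (h \<epsilon>) * seminorm K 0 (f \<epsilon>))"
        unfolding int_op_net_eq_kapply
        by (rule seminorm_kapply_le[OF X Kc(1,2) borel_compact[OF Kc(1)] subset_refl
              colombeau_smooth_on[OF o Hc hf(1) e] colombeau_smooth_on[OF X F hf(2) e] Q(1,2) order_refl])
      ultimately show "0 \<le> seminorm Q l (?u \<epsilon>) \<and> seminorm Q l (?u \<epsilon>)
          \<le> seminorm (Q \<times> K) l (h \<epsilon>) * (measure lborel K * seminorm K 0 (f \<epsilon>))"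
        by (simp add: ac_simps)
    qed
  qed
  then have "gen_supp X (Cl X ?u) \<subseteq> X - (X - ?T1)"
    using X T1 by (intro gen_supp_subset[OF X Cl_in_colombeau[OF mod] mem_Cl[OF mod]])
      (auto intro: open_Diff compact_imp_closed)
  then have "compact (gen_supp X (Cl X ?u))" using T1 by (intro compact_gen_supp[OF T1]) auto
  then show ?thesis unfolding eq colombeau_C_def using Cl_in_colombeau[OF mod] by simp
qed

section \<open>Nets of kernels dominated by a kernel\<close>

text \<open>The estimates are made over rectangles with sides in some \<open>Q\<close> containing
  \<open>K\<close>, whereas seminorms range over arbitrary compact subsets of
  \<open>X \<times> X\<close>; these are enclosed by means of their projections.\<close>

lemma square_hull:
  assumes "compact C" "C \<subseteq> X \<times> X" "compact K" "K \<subseteq> X"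
  obtains Q where "compact Q" "Q \<subseteq> X" "K \<subseteq> Q" "fst ` C \<subseteq> Q" "snd ` C \<subseteq> Q"
proof (rule that[of "fst ` C \<union> snd ` C \<union> K"])
  show "compact (fst ` C \<union> snd ` C \<union> K)"
    using assms by (auto intro!: compact_Un compact_continuous_image continuous_intros)
qed (use assms in auto)

lemma Times_disjoint:
  shows "A \<inter> fst ` T = {} \<Longrightarrow> A \<times> B \<inter> T = {}"
    and "B \<inter> snd ` T = {} \<Longrightarrow> A \<times> B \<inter> T = {}"
proof -
  have "fst z \<in> A \<inter> fst ` T" "snd z \<in> B \<inter> snd ` T" if "z \<in> A \<times> B \<inter> T" for z
    using that by (auto simp: mem_Times_iff)
  then show "A \<inter> fst ` T = {} \<Longrightarrow> A \<times> B \<inter> T = {}" "B \<inter> snd ` T = {} \<Longrightarrow> A \<times> B \<inter> T = {}"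
    by blast+
qed

lemma subset_Times_images: "fst ` C \<subseteq> A \<Longrightarrow> snd ` C \<subseteq> B \<Longrightarrow> C \<subseteq> A \<times> B"
  by (rule subsetI) (simp add: mem_Times_iff image_subset_iff)

text \<open>Shared by iterated kernels and exponential sums, whose estimates both have the form of
  \<open>dom\<close>. Leaving one side of the rectangle free matters: for \<open>R\<close> off a
  projection of the support, \<open>h\<close> is rapidly decreasing over the rectangle, and
  domination passes this on to \<open>w\<close>.\<close>

lemma
  assumes X: "open X" and H: "H \<in> colombeau_C (X \<times> X)" "h \<in> H" and K: "integration_domain X H K"
    and w: "w \<in> smooth_nets (X \<times> X)"
    and dom: "\<And>Q l. compact Q \<Longrightarrow> Q \<subseteq> X \<Longrightarrow> K \<subseteq> Q \<Longrightarrow> \<exists>G. moderate_growth G \<and>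
      (\<forall>R \<epsilon>. compact R \<longrightarrow> R \<subseteq> Q \<longrightarrow> \<epsilon> \<in> {0<..1} \<longrightarrow>
        seminorm (R \<times> Q) l (w \<epsilon>) \<le> seminorm (R \<times> Q) l (h \<epsilon>) * G \<epsilon> \<and>
        seminorm (Q \<times> R) l (w \<epsilon>) \<le> seminorm (Q \<times> R) l (h \<epsilon>) * G \<epsilon>)"
  shows dominated_kernel_moderate: "w \<in> moderate_nets (X \<times> X)"
    and dominated_kernel_colombeau_C: "Cl (X \<times> X) w \<in> colombeau_C (X \<times> X)"
    and dominated_kernel_integration_domain: "integration_domain X (Cl (X \<times> X) w) K"
proof -
  have o: "open (X \<times> X)" using X by (simp add: open_Times)
  have Hc: "H \<in> colombeau (X \<times> X)" and T: "compact (gen_supp (X \<times> X) H)"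
    using H by (auto simp: colombeau_C_def)
  note Kc = integration_domainD[OF K]
  have ws: "smooth_on (X \<times> X) (w \<epsilon>)" if "\<epsilon> \<in> {0<..1}" for \<epsilon>
    using w that by (auto simp: smooth_nets_def)
  show mod: "w \<in> moderate_nets (X \<times> X)"
    unfolding moderate_nets_iff
  proof (intro conjI w allI impI)
    fix C l assume "compact C \<and> C \<subseteq> X \<times> X"
    then have C: "compact C" "C \<subseteq> X \<times> X" by auto
    obtain Q where Q: "compact Q" "Q \<subseteq> X" "K \<subseteq> Q" "fst ` C \<subseteq> Q" "snd ` C \<subseteq> Q"
      by (rule square_hull[OF C Kc(1,2)])
    have QQ: "compact (Q \<times> Q)" "Q \<times> Q \<subseteq> X \<times> X" "C \<subseteq> Q \<times> Q"
      using Q by (auto intro: compact_Times)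
    obtain G where G: "moderate_growth G" "\<And>\<epsilon>. \<epsilon> \<in> {0<..1} \<Longrightarrow>
        seminorm (Q \<times> Q) l (w \<epsilon>) \<le> seminorm (Q \<times> Q) l (h \<epsilon>) * G \<epsilon>"
      using dom[OF Q(1-3), of l] Q(1) by blast
    show "moderate_growth (\<lambda>\<epsilon>. seminorm C l (w \<epsilon>))"
    proof (rule moderate_growth_le)
      show "moderate_growth (\<lambda>\<epsilon>. seminorm (Q \<times> Q) l (h \<epsilon>) * G \<epsilon>)"
        by (intro moderate_growth_mult G colombeau_moderate_growth[OF o Hc H(2) QQ(1,2)])
      show "0 \<le> seminorm C l (w \<epsilon>) \<and> seminorm C l (w \<epsilon>) \<le> seminorm (Q \<times> Q) l (h \<epsilon>) * G \<epsilon>"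
        if e: "\<epsilon> \<in> {0<..1}" for \<epsilon>
        using seminorm_nonneg[OF C ws[OF e], of l] seminorm_mono[OF QQ(1,2) ws[OF e] QQ(3), of l] G(2)[OF e]
        by linarith
    qed
  qed
  let ?T = "gen_supp (X \<times> X) H"
  have Tp: "compact (fst ` ?T)" "compact (snd ` ?T)"
    using T by (auto intro!: compact_continuous_image continuous_intros)
  have "w \<in> null_nets ((X - fst ` ?T) \<times> X)"
    unfolding null_nets_iff
  proof (intro conjI allI impI)
    show "w \<in> smooth_nets ((X - fst ` ?T) \<times> X)"
      using ws by (auto simp: smooth_nets_def intro!: smooth_on_subset[OF ws])
    fix C l assume *: "compact C \<and> C \<subseteq> (X - fst ` ?T) \<times> X"
    then have "fst z \<in> X - fst ` ?T \<and> snd z \<in> X" if "z \<in> C" for z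
      using that by (metis mem_Times_iff subsetD)
    then have C: "compact C" "C \<subseteq> X \<times> X" "fst ` C \<inter> fst ` ?T = {}"
      using * by (blast, metis DiffD1 mem_Times_iff subsetI, blast)
    obtain Q where Q: "compact Q" "Q \<subseteq> X" "K \<subseteq> Q" "fst ` C \<subseteq> Q" "snd ` C \<subseteq> Q"
      by (rule square_hull[OF C(1,2) Kc(1,2)])
    let ?R = "fst ` C"
    have R: "compact ?R" using C(1) by (auto intro!: compact_continuous_image continuous_intros)
    have RQ: "compact (?R \<times> Q)" "?R \<times> Q \<subseteq> X \<times> X" "?R \<times> Q \<inter> ?T = {}" "C \<subseteq> ?R \<times> Q"
      by (rule compact_Times[OF R Q(1)], rule Sigma_mono[OF order_trans[OF Q(4,2)] Q(2)],
          rule Times_disjoint(1)[OF C(3)], rule subset_Times_images[OF subset_refl Q(5)])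
    obtain G where G: "moderate_growth G" "\<And>\<epsilon>. \<epsilon> \<in> {0<..1} \<Longrightarrow>
        seminorm (?R \<times> Q) l (w \<epsilon>) \<le> seminorm (?R \<times> Q) l (h \<epsilon>) * G \<epsilon>"
      using dom[OF Q(1-3), of l] R Q(4) by blast
    show "rapidly_decreasing (\<lambda>\<epsilon>. seminorm C l (w \<epsilon>))"
    proof (rule rapidly_decreasing_le)
      show "rapidly_decreasing (\<lambda>\<epsilon>. seminorm (?R \<times> Q) l (h \<epsilon>) * G \<epsilon>)"
        by (intro rapidly_decreasing_mult G rapidly_decreasing_off_supp[OF o Hc H(2) RQ(1-3)])
      show "0 \<le> seminorm C l (w \<epsilon>) \<and> seminorm C l (w \<epsilon>) \<le> seminorm (?R \<times> Q) l (h \<epsilon>) * G \<epsilon>"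
        if e: "\<epsilon> \<in> {0<..1}" for \<epsilon>
        using seminorm_nonneg[OF C(1,2) ws[OF e], of l] seminorm_mono[OF RQ(1,2) ws[OF e] RQ(4), of l] G(2)[OF e]
        by linarith
    qed
  qed
  then have S1: "gen_supp (X \<times> X) (Cl (X \<times> X) w) \<subseteq> X \<times> X - (X - fst ` ?T) \<times> X"
    using X Tp by (intro gen_supp_subset[OF o Cl_in_colombeau[OF mod] mem_Cl[OF mod]])
      (auto intro!: open_Times open_Diff compact_imp_closed)
  have "w \<in> null_nets (X \<times> (X - snd ` ?T))"
    unfolding null_nets_iff
  proof (intro conjI allI impI)
    show "w \<in> smooth_nets (X \<times> (X - snd ` ?T))"
      using ws by (auto simp: smooth_nets_def intro!: smooth_on_subset[OF ws])
    fix C l assume *: "compact C \<and> C \<subseteq> X \<times> (X - snd ` ?T)"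
    then have "fst z \<in> X \<and> snd z \<in> X - snd ` ?T" if "z \<in> C" for z
      using that by (metis mem_Times_iff subsetD)
    then have C: "compact C" "C \<subseteq> X \<times> X" "snd ` C \<inter> snd ` ?T = {}"
      using * by (blast, metis DiffD1 mem_Times_iff subsetI, blast)
    obtain Q where Q: "compact Q" "Q \<subseteq> X" "K \<subseteq> Q" "fst ` C \<subseteq> Q" "snd ` C \<subseteq> Q"
      by (rule square_hull[OF C(1,2) Kc(1,2)])
    let ?R = "snd ` C"
    have R: "compact ?R" using C(1) by (auto intro!: compact_continuous_image continuous_intros)
    have RQ: "compact (Q \<times> ?R)" "Q \<times> ?R \<subseteq> X \<times> X" "Q \<times> ?R \<inter> ?T = {}" "C \<subseteq> Q \<times> ?R"
      by (rule compact_Times[OF Q(1) R], rule Sigma_mono[OF Q(2) order_trans[OF Q(5,2)]],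
          rule Times_disjoint(2)[OF C(3)], rule subset_Times_images[OF Q(4) subset_refl])
    obtain G where G: "moderate_growth G" "\<And>\<epsilon>. \<epsilon> \<in> {0<..1} \<Longrightarrow>
        seminorm (Q \<times> ?R) l (w \<epsilon>) \<le> seminorm (Q \<times> ?R) l (h \<epsilon>) * G \<epsilon>"
      using dom[OF Q(1-3), of l] R Q(5) by blast
    show "rapidly_decreasing (\<lambda>\<epsilon>. seminorm C l (w \<epsilon>))"
    proof (rule rapidly_decreasing_le)
      show "rapidly_decreasing (\<lambda>\<epsilon>. seminorm (Q \<times> ?R) l (h \<epsilon>) * G \<epsilon>)"
        by (intro rapidly_decreasing_mult G rapidly_decreasing_off_supp[OF o Hc H(2) RQ(1-3)])
      show "0 \<le> seminorm C l (w \<epsilon>) \<and> seminorm C l (w \<epsilon>) \<le> seminorm (Q \<times> ?R) l (h \<epsilon>) * G \<epsilon>"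
        if e: "\<epsilon> \<in> {0<..1}" for \<epsilon>
        using seminorm_nonneg[OF C(1,2) ws[OF e], of l] seminorm_mono[OF RQ(1,2) ws[OF e] RQ(4), of l] G(2)[OF e]
        by linarith
    qed
  qed
  then have S2: "gen_supp (X \<times> X) (Cl (X \<times> X) w) \<subseteq> X \<times> X - X \<times> (X - snd ` ?T)"
    using X Tp by (intro gen_supp_subset[OF o Cl_in_colombeau[OF mod] mem_Cl[OF mod]])
      (auto intro!: open_Times open_Diff compact_imp_closed)
  \<comment> \<open>Vanishing off either projection confines the support to their product, which can
    exceed the support of \<open>H\<close> but still lies in
    \<open>interior K \<times> interior K\<close>.\<close>
  have sub: "gen_supp (X \<times> X) (Cl (X \<times> X) w) \<subseteq> fst ` ?T \<times> snd ` ?T"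
    using S1 S2 by (auto simp: subset_iff)
  have "fst ` ?T \<times> snd ` ?T \<subseteq> X \<times> X" using gen_supp_in[of "X \<times> X" H] by auto
  then have "compact (gen_supp (X \<times> X) (Cl (X \<times> X) w))"
    by (rule compact_gen_supp[OF compact_Times[OF Tp] _ sub])
  then show "Cl (X \<times> X) w \<in> colombeau_C (X \<times> X)"
    using Cl_in_colombeau[OF mod] by (simp add: colombeau_C_def)
  have "fst ` ?T \<times> snd ` ?T \<subseteq> interior K \<times> interior K" using Kc(3) by auto
  then show "integration_domain X (Cl (X \<times> X) w) K"
    using sub Kc by (auto simp: integration_domain_def)
qed

text \<open>Both summands in the bracket are rapidly decreasing: the first compares two
  representatives of \<open>H\<close>, the second is taken off its support. One argument thus
  settles independence for iterated kernels and for the exponential alike.\<close>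

lemma dominated_kernel_diff:
  assumes X: "open X" and H: "H \<in> colombeau (X \<times> X)" "h \<in> H" "h' \<in> H"
    and K: "integration_domain X H K" and K': "integration_domain X H K'" and sub: "K \<subseteq> K'"
    and w: "w \<in> moderate_nets (X \<times> X)" "w' \<in> moderate_nets (X \<times> X)"
    and dom: "\<And>Q l. compact Q \<Longrightarrow> Q \<subseteq> X \<Longrightarrow> K' \<subseteq> Q \<Longrightarrow> \<exists>G. moderate_growth G \<and>
      (\<forall>\<epsilon>\<in>{0<..1}. seminorm (Q \<times> Q) l (\<lambda>z. w' \<epsilon> z - w \<epsilon> z) \<le>
        (seminorm (Q \<times> Q) l (\<lambda>z. h' \<epsilon> z - h \<epsilon> z) + seminorm ((K' - interior K) \<times> Q) l (h' \<epsilon>)) * G \<epsilon>)"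
  shows "Cl (X \<times> X) w' = Cl (X \<times> X) w"
proof -
  have o: "open (X \<times> X)" using X by (simp add: open_Times)
  note Kc = integration_domainD[OF K] and Kc' = integration_domainD[OF K']
  have sm: "smooth_on (X \<times> X) (\<lambda>z. w' \<epsilon> z - w \<epsilon> z)" if "\<epsilon> \<in> {0<..1}" for \<epsilon>
    using w that by (intro smooth_on_diff o) (auto simp: moderate_nets_def smooth_nets_def)
  have "(\<lambda>\<epsilon> z. w' \<epsilon> z - w \<epsilon> z) \<in> null_nets (X \<times> X)"
    unfolding null_nets_iff
  proof (intro conjI allI impI)
    show "(\<lambda>\<epsilon> z. w' \<epsilon> z - w \<epsilon> z) \<in> smooth_nets (X \<times> X)" using sm by (auto simp: smooth_nets_def)
    fix C l assume "compact C \<and> C \<subseteq> X \<times> X"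
    then have C: "compact C" "C \<subseteq> X \<times> X" by auto
    obtain Q where Q: "compact Q" "Q \<subseteq> X" "K' \<subseteq> Q" "fst ` C \<subseteq> Q" "snd ` C \<subseteq> Q"
      by (rule square_hull[OF C Kc'(1,2)])
    let ?B = "(K' - interior K) \<times> Q"
    have QQ: "compact (Q \<times> Q)" "Q \<times> Q \<subseteq> X \<times> X" "C \<subseteq> Q \<times> Q"
      using Q by (auto intro: compact_Times)
    have B: "compact ?B" "?B \<subseteq> X \<times> X" "?B \<inter> gen_supp (X \<times> X) H = {}"
      using Q Kc Kc' by (auto intro!: compact_Times compact_diff)
    obtain G where G: "moderate_growth G" "\<And>\<epsilon>. \<epsilon> \<in> {0<..1} \<Longrightarrow> seminorm (Q \<times> Q) l (\<lambda>z. w' \<epsilon> z - w \<epsilon> z) \<le>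
        (seminorm (Q \<times> Q) l (\<lambda>z. h' \<epsilon> z - h \<epsilon> z) + seminorm ?B l (h' \<epsilon>)) * G \<epsilon>"
      using dom[OF Q(1-3), of l] by blast
    show "rapidly_decreasing (\<lambda>\<epsilon>. seminorm C l (\<lambda>z. w' \<epsilon> z - w \<epsilon> z))"
    proof (rule rapidly_decreasing_le)
      show "rapidly_decreasing (\<lambda>\<epsilon>. (seminorm (Q \<times> Q) l (\<lambda>z. h' \<epsilon> z - h \<epsilon> z) + seminorm ?B l (h' \<epsilon>)) * G \<epsilon>)"
        by (intro rapidly_decreasing_mult rapidly_decreasing_add G
            colombeau_diff_rapidly_decreasing[OF o H(1,3,2) QQ(1,2)]
            rapidly_decreasing_off_supp[OF o H(1,3) B])
      show "0 \<le> seminorm C l (\<lambda>z. w' \<epsilon> z - w \<epsilon> z) \<and> seminorm C l (\<lambda>z. w' \<epsilon> z - w \<epsilon> z) \<le>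
          (seminorm (Q \<times> Q) l (\<lambda>z. h' \<epsilon> z - h \<epsilon> z) + seminorm ?B l (h' \<epsilon>)) * G \<epsilon>" if e: "\<epsilon> \<in> {0<..1}" for \<epsilon>
        using seminorm_nonneg[OF C sm[OF e], of l] seminorm_mono[OF QQ(1,2) sm[OF e] QQ(3), of l] G(2)[OF e]
        by linarith
    qed
  qed
  then show ?thesis using w by (intro Cl_eqI o)
qed

section \<open>Iterated kernels as generalized functions\<close>

lemma moderate_growth_power: "moderate_growth p \<Longrightarrow> moderate_growth (\<lambda>\<epsilon>. p \<epsilon> ^ n)"
  by (induction n) (auto intro: moderate_growth_const moderate_growth_mult)

lemma iter_kernel_net_smooth_on:
  assumes "open X" "compact K" "K \<subseteq> X" "smooth_on (X \<times> X) (h \<epsilon>)"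
  shows "smooth_on (X \<times> X) (iter_kernel_net K h (Suc n) \<epsilon>)"
  by (rule smooth_on_cong[OF open_Times[OF assms(1,1)] _ smooth_on_kpow[OF assms]],
      rule iter_kernel_net_eq_kpow[where h = h and \<epsilon> = \<epsilon>, OF assms(2,3) smooth_on_imp_continuous_on[OF assms(4)] assms(1)])

lemma
  assumes X: "open X" and H: "H \<in> colombeau_C (X \<times> X)" "h \<in> H" and K: "integration_domain X H K"
  shows iter_kernel_net_moderate: "iter_kernel_net K h (Suc n) \<in> moderate_nets (X \<times> X)"
    and iter_kernel_net_colombeau_C: "Cl (X \<times> X) (iter_kernel_net K h (Suc n)) \<in> colombeau_C (X \<times> X)"
    and iter_kernel_net_integration_domain:
      "integration_domain X (Cl (X \<times> X) (iter_kernel_net K h (Suc n))) K"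
proof -
  have o: "open (X \<times> X)" using X by (simp add: open_Times)
  have Hc: "H \<in> colombeau (X \<times> X)" using H by (auto simp: colombeau_C_def)
  note Kc = integration_domainD[OF K]
  note hs = colombeau_smooth_on[OF o Hc H(2)]
  let ?w = "iter_kernel_net K h (Suc n)" and ?v = "measure lborel K"
  have w: "?w \<in> smooth_nets (X \<times> X)"
    unfolding smooth_nets_def
    by (intro CollectI ballI iter_kernel_net_smooth_on[where h = h] X Kc(1,2) hs)
  have dom: "\<exists>G. moderate_growth G \<and>
      (\<forall>R \<epsilon>. compact R \<longrightarrow> R \<subseteq> Q \<longrightarrow> \<epsilon> \<in> {0<..1} \<longrightarrow>
        seminorm (R \<times> Q) l (?w \<epsilon>) \<le> seminorm (R \<times> Q) l (h \<epsilon>) * G \<epsilon> \<and>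
        seminorm (Q \<times> R) l (?w \<epsilon>) \<le> seminorm (Q \<times> R) l (h \<epsilon>) * G \<epsilon>)"
    if Q: "compact Q" "Q \<subseteq> X" "K \<subseteq> Q" for Q l
  \<comment> \<open>The witness comes from the estimates for \<open>kpow\<close>, with the measure
    of \<open>K\<close> as \<open>v\<close> and the seminorm over \<open>Q \<times> Q\<close> as
    \<open>M\<close>.\<close>
  proof (intro exI[of _ "\<lambda>\<epsilon>. (?v * seminorm (Q \<times> Q) l (h \<epsilon>)) ^ n"] conjI allI impI)
    show "moderate_growth (\<lambda>\<epsilon>. (?v * seminorm (Q \<times> Q) l (h \<epsilon>)) ^ n)"
      using Q by (intro moderate_growth_power moderate_growth_mult moderate_growth_const
          colombeau_moderate_growth[OF o Hc H(2)] compact_Times) auto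
    fix R and \<epsilon> :: real assume R: "compact R" "R \<subseteq> Q" and e: "\<epsilon> \<in> {0<..1}"
    have eq: "seminorm C l (?w \<epsilon>) = seminorm C l (kpow K (h \<epsilon>) n)" if "C \<subseteq> X \<times> X" for C
      by (intro seminorm_cong[OF o that] iter_kernel_net_eq_kpow[where h = h and \<epsilon> = \<epsilon>, OF Kc(1,2) smooth_on_imp_continuous_on[OF hs[OF e]] X])
    show "seminorm (R \<times> Q) l (?w \<epsilon>) \<le> seminorm (R \<times> Q) l (h \<epsilon>) * (?v * seminorm (Q \<times> Q) l (h \<epsilon>)) ^ n"
      using seminorm_kpow_le_left[OF X Q(1,2) Kc(1) Q(3) hs[OF e] order_refl order_refl R, of l n] R Q(2)
      by (subst eq) (auto simp: mult.commute)
    show "seminorm (Q \<times> R) l (?w \<epsilon>) \<le> seminorm (Q \<times> R) l (h \<epsilon>) * (?v * seminorm (Q \<times> Q) l (h \<epsilon>)) ^ n"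
      using seminorm_kpow_le_right[OF X Q(1,2) Kc(1) Q(3) hs[OF e] order_refl order_refl R, of l n] R Q(2)
      by (subst eq) (auto simp: mult.commute)
  qed
  show "?w \<in> moderate_nets (X \<times> X)" by (rule dominated_kernel_moderate[OF X H K w dom])
  show "Cl (X \<times> X) ?w \<in> colombeau_C (X \<times> X)" by (rule dominated_kernel_colombeau_C[OF X H K w dom])
  show "integration_domain X (Cl (X \<times> X) ?w) K" by (rule dominated_kernel_integration_domain[OF X H K w dom])
qed

lemma Cl_iter_kernel_net_eq_of_subset:
  assumes X: "open X" and H: "H \<in> colombeau_C (X \<times> X)" "h \<in> H" "h' \<in> H"
    and K: "integration_domain X H K" and K': "integration_domain X H K'" and sub: "K \<subseteq> K'"
  shows "Cl (X \<times> X) (iter_kernel_net K' h' (Suc n)) = Cl (X \<times> X) (iter_kernel_net K h (Suc n))"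
proof -
  have o: "open (X \<times> X)" using X by (simp add: open_Times)
  have Hc: "H \<in> colombeau (X \<times> X)" using H by (auto simp: colombeau_C_def)
  note Kc = integration_domainD[OF K] and Kc' = integration_domainD[OF K']
  note hs = colombeau_smooth_on[OF o Hc H(2)] and hs' = colombeau_smooth_on[OF o Hc H(3)]
  let ?v = "measure lborel K'"
  show ?thesis
  proof (rule dominated_kernel_diff[OF X Hc H(2,3) K K' sub iter_kernel_net_moderate[OF X H(1,2) K]
        iter_kernel_net_moderate[OF X H(1,3) K']])
    fix Q l assume Q: "compact Q" "Q \<subseteq> X" "K' \<subseteq> Q"
    \<comment> \<open>The sum bounds the seminorms of \<open>h\<close> and of \<open>h'\<close> at
      once.\<close>
    let ?M = "\<lambda>\<epsilon>. seminorm (Q \<times> Q) l (h \<epsilon>) + seminorm (Q \<times> Q) l (h' \<epsilon>)"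
    let ?\<delta> = "\<lambda>\<epsilon>. seminorm (Q \<times> Q) l (\<lambda>z. h' \<epsilon> z - h \<epsilon> z) + seminorm ((K' - interior K) \<times> Q) l (h' \<epsilon>)"
    have QQ: "compact (Q \<times> Q)" "Q \<times> Q \<subseteq> X \<times> X" using Q by (auto intro: compact_Times)
    show "\<exists>G. moderate_growth G \<and> (\<forall>\<epsilon>\<in>{0<..1}. seminorm (Q \<times> Q) l (\<lambda>z. iter_kernel_net K' h' (Suc n) \<epsilon> z
        - iter_kernel_net K h (Suc n) \<epsilon> z) \<le> ?\<delta> \<epsilon> * G \<epsilon>)"
    proof (intro exI[of _ "\<lambda>\<epsilon>. real (Suc n) * (?v * ?M \<epsilon>) ^ n"] conjI ballI)
      show "moderate_growth (\<lambda>\<epsilon>. real (Suc n) * (?v * ?M \<epsilon>) ^ n)"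
        by (intro moderate_growth_mult moderate_growth_power moderate_growth_const moderate_growth_add
            colombeau_moderate_growth[OF o Hc H(2) QQ] colombeau_moderate_growth[OF o Hc H(3) QQ])
      fix \<epsilon> :: real assume e: "\<epsilon> \<in> {0<..1}"
      have nn: "0 \<le> seminorm (Q \<times> Q) l (h \<epsilon>)" "0 \<le> seminorm (Q \<times> Q) l (h' \<epsilon>)"
        by (rule seminorm_nonneg[OF QQ hs[OF e]], rule seminorm_nonneg[OF QQ hs'[OF e]])
      have "seminorm (Q \<times> Q) l (\<lambda>z. iter_kernel_net K' h' (Suc n) \<epsilon> z - iter_kernel_net K h (Suc n) \<epsilon> z)
        = seminorm (Q \<times> Q) l (\<lambda>z. kpow K' (h' \<epsilon>) n z - kpow K (h \<epsilon>) n z)"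
        by (intro seminorm_cong[OF o QQ(2)] arg_cong2[where f = "(-)"]
            iter_kernel_net_eq_kpow[where h = h and \<epsilon> = \<epsilon>, OF Kc(1,2) smooth_on_imp_continuous_on[OF hs[OF e]] X]
            iter_kernel_net_eq_kpow[where h = h' and \<epsilon> = \<epsilon>, OF Kc'(1,2) smooth_on_imp_continuous_on[OF hs'[OF e]] X])
      also have "\<dots> \<le> real (Suc n) * (?v * ?M \<epsilon>) ^ n * ?\<delta> \<epsilon>"
        using nn by (intro seminorm_kpow_diff_le[OF X Q(1,2) Kc'(1) Q(3) Kc(1) sub hs[OF e] hs'[OF e] order_refl]) auto
      finally show "seminorm (Q \<times> Q) l (\<lambda>z. iter_kernel_net K' h' (Suc n) \<epsilon> z - iter_kernel_net K h (Suc n) \<epsilon> z)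
        \<le> ?\<delta> \<epsilon> * (real (Suc n) * (?v * ?M \<epsilon>) ^ n)" by (simp add: mult.commute)
    qed
  qed
qed

text \<open>The union of two domains links them through nested pairs, so all choices give one class
  and the \<open>THE\<close> is well defined.\<close>

lemma iter_kernel_eq:
  assumes X: "open X" and H: "H \<in> colombeau_C (X \<times> X)" "h \<in> H" and K: "integration_domain X H K"
  shows "iter_kernel X H (Suc n) = Cl (X \<times> X) (iter_kernel_net K h (Suc n))"
proof -
  have "Cl (X \<times> X) (iter_kernel_net K h (Suc n)) = Cl (X \<times> X) (iter_kernel_net K' h' (Suc n))"
    if "integration_domain X H K'" "h' \<in> H" for K' h'
    using Cl_iter_kernel_net_eq_of_subset[OF X H that(2) K integration_domain_Un[OF K that(1)]]
      Cl_iter_kernel_net_eq_of_subset[OF X H(1) that(2) that(2) that(1) integration_domain_Un[OF K that(1)]]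
    by simp
  then show ?thesis
    unfolding iter_kernel_def by (intro the_equality) (use assms in blast)+
qed

lemma iter_kernel_1:
  assumes X: "open X" and H: "H \<in> colombeau_C (X \<times> X)"
  shows "iter_kernel X H 1 = H"
proof -
  have o: "open (X \<times> X)" using X by (simp add: open_Times)
  have Hc: "H \<in> colombeau (X \<times> X)" and T: "compact (gen_supp (X \<times> X) H)"
    using H by (auto simp: colombeau_C_def)
  obtain h where h: "h \<in> H" using colombeau_nonempty[OF o Hc] by blast
  obtain K where K: "integration_domain X H K" using integration_domain_exists[OF X T] by blast
  have "iter_kernel_net K h 1 = h" using iter_kernel_net_1 by blast
  then show ?thesis
    using iter_kernel_eq[OF X H h K, of 0] colombeau_mem(2)[OF o Hc h] by simp
qed

text \<open>The recursion appends the new factor on the right, so the operator applied first is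
  peeled off and the induction runs over all \<open>F\<close>. With one common \<open>K\<close>,
  composing the operators composes the kernels exactly for every \<open>\<epsilon>\<close>, hence
  the classes agree.\<close>

lemma is_kernel_iter_kernel:
  assumes X: "open X" and H: "H \<in> colombeau_C (X \<times> X)"
  shows "is_kernel X (int_op X H ^^ Suc n) (iter_kernel X H (Suc n))"
proof -
  have o: "open (X \<times> X)" using X by (simp add: open_Times)
  have Hc: "H \<in> colombeau (X \<times> X)" and T: "compact (gen_supp (X \<times> X) H)"
    using H by (auto simp: colombeau_C_def)
  obtain h where h: "h \<in> H" using colombeau_nonempty[OF o Hc] by blast
  obtain K where K: "integration_domain X H K" using integration_domain_exists[OF X T] by blast
  note Kc = integration_domainD[OF K]
  note hs = colombeau_smooth_on[OF o Hc h]
  let ?L = "\<lambda>n. iter_kernel_net K h (Suc n)"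
  have L: "iter_kernel X H (Suc n) = Cl (X \<times> X) (?L n)" for n by (rule iter_kernel_eq[OF X H h K])
  have Lc: "Cl (X \<times> X) (?L n) \<in> colombeau (X \<times> X)" "?L n \<in> Cl (X \<times> X) (?L n)" for n
    using iter_kernel_net_colombeau_C[OF X H h K, of n] mem_Cl[OF iter_kernel_net_moderate[OF X H h K, of n]]
    by (auto simp: colombeau_C_def)
  have LK: "integration_domain X (Cl (X \<times> X) (?L n)) K" for n
    by (rule iter_kernel_net_integration_domain[OF X H h K])
  have "(int_op X H ^^ Suc n) F = int_op X (Cl (X \<times> X) (?L n)) F" if "F \<in> colombeau X" for F
    using that
  proof (induction n arbitrary: F)
    case 0
    then show ?case using iter_kernel_1[OF X H] L[of 0] by simp
  next
    case (Suc n)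
    let ?G = "int_op X H F"
    obtain f where f: "f \<in> F" using colombeau_nonempty[OF X Suc.prems] by blast
    have G: "?G \<in> colombeau X" using int_op_in_colombeau_C[OF X H Suc.prems] by (simp add: colombeau_C_def)
    have g: "int_op_net K h f \<in> ?G" by (rule int_op_net_mem[OF X Hc h Suc.prems f K])
    have "(int_op X H ^^ Suc (Suc n)) F = (int_op X H ^^ Suc n) ?G"
      by (simp only: funpow_Suc_right o_apply)
    also have "\<dots> = int_op X (Cl (X \<times> X) (?L n)) ?G" by (rule Suc.IH[OF G])
    \<comment> \<open>By \<open>LK\<close> the integration domain of \<open>H\<close> also serves
      for the iterated kernel.\<close>
    also have "\<dots> = Cl X (int_op_net K (?L n) (int_op_net K h f))"
      by (rule int_op_eq[OF X Lc G g LK])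
    also have "\<dots> = Cl X (int_op_net K (?L (Suc n)) f)"
    proof (rule Cl_eqI[OF X])
      show "int_op_net K (?L n) (int_op_net K h f) \<in> moderate_nets X"
        by (rule int_op_net_moderate[OF X Lc G g Kc(1,2)])
      show "int_op_net K (?L (Suc n)) f \<in> moderate_nets X"
        by (rule int_op_net_moderate[OF X Lc Suc.prems f Kc(1,2)])
      show "(\<lambda>\<epsilon> x. int_op_net K (?L n) (int_op_net K h f) \<epsilon> x - int_op_net K (?L (Suc n)) f \<epsilon> x) \<in> null_nets X"
      proof (rule null_nets_of_eq[OF X])
        fix \<epsilon> :: real and x assume e: "\<epsilon> \<in> {0<..1}" and x: "x \<in> X"
        have hc: "continuous_on (X \<times> X) (h \<epsilon>)" by (rule smooth_on_imp_continuous_on[OF hs[OF e]])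
        have "int_op_net K (?L n) (int_op_net K h f) \<epsilon> x = kapply K (kcomp K (?L n \<epsilon>) (h \<epsilon>)) (f \<epsilon>) x"
          unfolding int_op_net_eq_kapply
          by (rule kapply_kapply[OF Kc(1,2) _ hc _ x])
             (auto intro!: smooth_on_imp_continuous_on iter_kernel_net_smooth_on[where h = h and \<epsilon> = \<epsilon>, OF X Kc(1,2) hs[OF e]]
               colombeau_smooth_on[OF X Suc.prems f e])
        also have "\<dots> = kapply K (?L (Suc n) \<epsilon>) (f \<epsilon>) x"
          unfolding kapply_def
          by (rule set_lebesgue_integral_cong)
             (use Kc(1,2) x iter_kernel_net_Suc[where h = h and \<epsilon> = \<epsilon>, OF Kc(1,2) hc X] in \<open>auto intro!: borel_compact\<close>)
        finally show "int_op_net K (?L n) (int_op_net K h f) \<epsilon> x = int_op_net K (?L (Suc n)) f \<epsilon> x"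
          by (simp only: int_op_net_eq_kapply)
      qed
    qed
    also have "\<dots> = int_op X (Cl (X \<times> X) (?L (Suc n))) F"
      by (rule int_op_eq[OF X Lc Suc.prems f LK, symmetric])
    finally show ?case .
  qed
  then show ?thesis
    unfolding is_kernel_def L using iter_kernel_net_colombeau_C[OF X H h K] by blast
qed

section \<open>The exponential series\<close>

lemma smooth_limit_cong:
  assumes "open \<Omega>" "\<And>N x. x \<in> \<Omega> \<Longrightarrow> s N x = s' N x" "smooth_limit \<Omega> s' g"
  shows "smooth_limit \<Omega> s g"
proof -
  have "smooth_on \<Omega> (s N)" for N
    using assms by (intro smooth_on_cong[of \<Omega> "s N" "s' N"]) (auto simp: smooth_limit_def)
  moreover have "seminorm K l (\<lambda>x. s N x - g x) = seminorm K l (\<lambda>x. s' N x - g x)" if "K \<subseteq> \<Omega>" for K l N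
    using assms(2) by (intro seminorm_cong[OF assms(1) that]) simp
  ultimately show ?thesis using assms(3) by (auto simp: smooth_limit_def)
qed

text \<open>The summation index now starts at 0 to match the shifted index of \<open>kpow\<close>,
  so the factorial becomes \<open>fact (Suc n)\<close>.\<close>

lemma exp_partial_sum_eq:
  assumes "open X" "compact K" "K \<subseteq> X" "smooth_on (X \<times> X) (h \<epsilon>)" "p \<in> X \<times> X"
  shows "exp_partial_sum K h \<epsilon> N p = (\<Sum>n<N. (1 / fact (Suc n)) * kpow K (h \<epsilon>) n p)"
proof -
  have "exp_partial_sum K h \<epsilon> N p = (\<Sum>n<N. iter_kernel_net K h (Suc n) \<epsilon> p / fact (Suc n))"
    unfolding exp_partial_sum_def One_nat_def by (rule sum.atLeast1_atMost_eq)
  also have "\<dots> = (\<Sum>n<N. (1 / fact (Suc n)) * kpow K (h \<epsilon>) n p)"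
    by (intro sum.cong refl, subst iter_kernel_net_eq_kpow[where h = h and \<epsilon> = \<epsilon>,
          OF assms(2,3) smooth_on_imp_continuous_on[OF assms(4)] assms(1,5)]) simp
  finally show ?thesis .
qed

lemma sum_power_over_fact_le_exp:
  fixes a :: real
  assumes "0 \<le> a"
  shows "(\<Sum>n<N. a ^ n / fact n) \<le> exp a"
proof -
  have "(\<Sum>n<N. a ^ n /\<^sub>R fact n) \<le> (\<Sum>n. a ^ n /\<^sub>R fact n)"
    using assms summable_exp_generic[of a] by (intro sum_le_suminf) auto
  then show ?thesis by (simp add: exp_def divide_inverse mult.commute)
qed

text \<open>The factor \<open>Suc n\<close>, which the difference of two \<open>n\<close>-th iterated kernels brings in, is absorbed by
  the factorial.\<close>

lemma seminorm_exp_sum_le: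
  fixes u :: "nat \<Rightarrow> 'a::euclidean_space \<Rightarrow> 'k::{real_normed_field,euclidean_space}"
  assumes \<Omega>: "open \<Omega>" "compact C" "C \<subseteq> \<Omega>" "\<And>n. smooth_on \<Omega> (u n)" and nn: "0 \<le> a" "0 \<le> \<delta>"
    and le: "\<And>n. seminorm C l (u n) \<le> real (Suc n) * a ^ n * \<delta>"
  shows "seminorm C l (\<lambda>z. \<Sum>n<N. (1 / fact (Suc n)) * u n z) \<le> \<delta> * exp a"
proof -
  have "seminorm C l (\<lambda>z. \<Sum>n<N. (1 / fact (Suc n)) * u n z) \<le>
      (\<Sum>n<N. seminorm C l (\<lambda>z. (1 / fact (Suc n)) * u n z))"
    by (intro seminorm_sum[OF \<Omega>(1-3)] smooth_on_cmult \<Omega>)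
  also have "\<dots> \<le> (\<Sum>n<N. \<delta> * (a ^ n / fact n))"
  proof (rule sum_mono)
    fix n
    have "seminorm C l (\<lambda>z. (1 / fact (Suc n)) * u n z) \<le> norm (1 / fact (Suc n) :: 'k) * seminorm C l (u n)"
      by (rule seminorm_cmult[OF \<Omega>])
    also have "\<dots> = seminorm C l (u n) / fact (Suc n)"
      by (simp add: norm_divide norm_fact del: fact_Suc)
    also have "\<dots> \<le> (real (Suc n) * a ^ n * \<delta>) / fact (Suc n)"
      by (rule divide_right_mono[OF le]) simp
    also have "\<dots> = \<delta> * (a ^ n / fact n)"
      unfolding fact_Suc mult.assoc by (subst mult_divide_mult_cancel_left) (auto simp: mult.commute)
    finally show "seminorm C l (\<lambda>z. (1 / fact (Suc n)) * u n z) \<le> \<delta> * (a ^ n / fact n)" .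
  qed
  also have "\<dots> \<le> \<delta> * exp a"
    unfolding sum_distrib_left[symmetric]
    by (rule mult_left_mono[OF sum_power_over_fact_le_exp[OF nn(1)] nn(2)])
  finally show ?thesis .
qed

text \<open>Lets \<open>seminorm_of_limit_le\<close> bound a single limit, by comparison with
  zero.\<close>

lemma smooth_limit_zero: "smooth_limit \<Omega> (\<lambda>N x. 0) (\<lambda>x. 0)"
  by (simp add: smooth_limit_def smooth_on_zero seminorm_zero)

text \<open>Up to the factor \<open>M\<close> the majorant is the series of \<open>exp a\<close>,
  where \<open>a\<close> is the measure of \<open>K\<close> times the seminorm \<open>M\<close> of
  \<open>h \<epsilon>\<close>. With \<open>\<epsilon>\<close> fixed no growth condition
  enters.\<close>

lemma exp_series_converges:
  assumes X: "open X" and K: "compact K" "K \<subseteq> X" and h: "smooth_on (X \<times> X) (h \<epsilon>)"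
  shows "\<exists>g. smooth_limit (X \<times> X) (exp_partial_sum K h \<epsilon>) g"
proof -
  have o: "open (X \<times> X)" using X by (simp add: open_Times)
  let ?u = "\<lambda>n p. (1 / fact (Suc n)) * kpow K (h \<epsilon>) n p"
  note kp = smooth_on_kpow[OF X K h]
  have "smooth_limit (X \<times> X) (\<lambda>N p. \<Sum>n<N. ?u n p) (\<lambda>p. \<Sum>n. ?u n p)"
  proof (rule smooth_limit_series[OF o smooth_on_cmult[OF o kp]])
    fix C l assume C: "compact C" "C \<subseteq> X \<times> X"
    obtain Q where Q: "compact Q" "Q \<subseteq> X" "K \<subseteq> Q" "fst ` C \<subseteq> Q" "snd ` C \<subseteq> Q"
      by (rule square_hull[OF C K])
    have QQ: "compact (Q \<times> Q)" "Q \<times> Q \<subseteq> X \<times> X" "C \<subseteq> Q \<times> Q"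
      using Q subset_Times_images[OF Q(4,5)] by (auto intro: compact_Times)
    define M a where "M = seminorm (Q \<times> Q) l (h \<epsilon>)" and "a = measure lborel K * M"
    have M0: "0 \<le> M" unfolding M_def by (rule seminorm_nonneg[OF QQ(1,2) h])
    have a0: "0 \<le> a" using M0 by (simp add: a_def)
    have "seminorm C l (?u n) \<le> (a ^ n /\<^sub>R fact n) * M" for n
    proof -
      have "seminorm C l (?u n) \<le> norm (1 / fact (Suc n) :: 'b) * seminorm C l (kpow K (h \<epsilon>) n)"
        by (rule seminorm_cmult[OF o C kp])
      also have "\<dots> = seminorm C l (kpow K (h \<epsilon>) n) / fact (Suc n)"
        by (simp add: norm_divide norm_fact del: fact_Suc)
      also have "\<dots> \<le> (a ^ n * M) / fact n"
      proof (rule frac_le)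
        have "seminorm C l (kpow K (h \<epsilon>) n) \<le> seminorm (Q \<times> Q) l (kpow K (h \<epsilon>) n)"
          by (rule seminorm_mono[OF QQ(1,2) kp QQ(3)])
        also have "\<dots> \<le> a ^ n * M"
          using seminorm_kpow_le_left[OF X Q(1,2) K(1) Q(3) h order_refl order_refl Q(1) subset_refl, of l n]
          by (simp add: M_def a_def)
        finally show "seminorm C l (kpow K (h \<epsilon>) n) \<le> a ^ n * M" .
        show "fact n \<le> (fact (Suc n) :: real)" by (rule fact_mono) simp
      qed (use a0 M0 in auto)
      finally show ?thesis by (simp add: field_simps)
    qed
    then show "\<exists>b. summable b \<and> (\<forall>n. seminorm C l (?u n) \<le> b n)"
      using summable_mult2[OF summable_exp_generic[of a], of M] by blast
  qed
  then have "smooth_limit (X \<times> X) (exp_partial_sum K h \<epsilon>) (\<lambda>p. \<Sum>n. ?u n p)"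
    by (rule smooth_limit_cong[OF o exp_partial_sum_eq[where h = h and \<epsilon> = \<epsilon>, OF X K h], rotated])
  then show ?thesis by blast
qed

text \<open>Membership in \<open>colombeau_ln\<close> provides one representative of logarithmic
  type. Any other differs from it by a null net, whose seminorms are bounded near 0 and hence
  dominated by \<open>\<bar>ln \<epsilon>\<bar>\<close>.\<close>

lemma ln_growth:
  assumes X: "open \<Omega>" and H: "H \<in> colombeau_ln \<Omega>" "H \<in> colombeau \<Omega>" "h \<in> H" and C: "compact C" "C \<subseteq> \<Omega>"
  shows "(\<lambda>\<epsilon>. seminorm C l (h \<epsilon>)) \<in> O[at_right 0](\<lambda>\<epsilon>. \<bar>ln \<epsilon>\<bar>)"
proof -
  obtain u where u: "u \<in> ln_nets \<Omega>" "H = Cl \<Omega> u"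
    using H(1) by (auto simp: colombeau_ln_def quotient_def Cl_def)
  have null: "(\<lambda>\<epsilon> x. u \<epsilon> x - h \<epsilon> x) \<in> null_nets \<Omega>" using mem_ClD H(3) u(2) by blast
  have us: "smooth_on \<Omega> (u \<epsilon>)" "smooth_on \<Omega> (\<lambda>x. u \<epsilon> x - h \<epsilon> x)" if "\<epsilon> \<in> {0<..1}" for \<epsilon>
    using u(1) null that by (auto simp: ln_nets_def null_nets_def smooth_nets_def)
  note hs = colombeau_smooth_on[OF X H(2,3)]
  have "(\<lambda>\<epsilon>. seminorm C l (h \<epsilon>)) \<in> O[at_right 0](\<lambda>\<epsilon>. seminorm C l (u \<epsilon>) + seminorm C l (\<lambda>x. u \<epsilon> x - h \<epsilon> x))"
  proof (rule bigo_of_le)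
    fix \<epsilon> :: real assume e: "\<epsilon> \<in> {0<..1}"
    have "seminorm C l (\<lambda>x. u \<epsilon> x - (u \<epsilon> x - h \<epsilon> x)) \<le> seminorm C l (u \<epsilon>) + seminorm C l (\<lambda>x. u \<epsilon> x - h \<epsilon> x)"
      by (rule seminorm_diff[OF X C us[OF e]])
    then show "0 \<le> seminorm C l (h \<epsilon>) \<and> seminorm C l (h \<epsilon>) \<le> seminorm C l (u \<epsilon>) + seminorm C l (\<lambda>x. u \<epsilon> x - h \<epsilon> x)"
      using seminorm_nonneg[OF C hs[OF e]] by simp
  qed
  also have "(\<lambda>\<epsilon>. seminorm C l (u \<epsilon>) + seminorm C l (\<lambda>x. u \<epsilon> x - h \<epsilon> x)) \<in> O[at_right 0](\<lambda>\<epsilon>. \<bar>ln \<epsilon>\<bar>)"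
  proof (rule sum_in_bigo)
    show "(\<lambda>\<epsilon>. seminorm C l (u \<epsilon>)) \<in> O[at_right 0](\<lambda>\<epsilon>. \<bar>ln \<epsilon>\<bar>)"
      using u(1) C by (auto simp: ln_nets_def)
    have "(\<lambda>\<epsilon>. seminorm C l (\<lambda>x. u \<epsilon> x - h \<epsilon> x)) \<in> O[at_right 0](\<lambda>\<epsilon>. \<epsilon> ^ 0)"
      using null C unfolding null_nets_def by blast
    also have "(\<lambda>\<epsilon>::real. \<epsilon> ^ 0) \<in> O[at_right 0](\<lambda>\<epsilon>. \<bar>ln \<epsilon>\<bar>)"
    \<comment> \<open>Below \<open>exp (-1)\<close> the logarithm exceeds 1 in absolute value, hence
      the constant 1.\<close>
    proof (rule bigoI[of _ 1])
      have "\<forall>\<^sub>F \<epsilon> in at_right (0::real). \<epsilon> \<in> {0<..<exp (-1)}"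
        by (rule eventually_at_right_real) simp
      then show "\<forall>\<^sub>F \<epsilon> in at_right (0::real). norm (\<epsilon> ^ 0) \<le> 1 * norm \<bar>ln \<epsilon>\<bar>"
      proof (rule eventually_mono)
        fix \<epsilon> :: real assume e: "\<epsilon> \<in> {0<..<exp (-1)}"
        then have "ln \<epsilon> < ln (exp (-1))" by (subst ln_less_cancel_iff) auto
        then show "norm (\<epsilon> ^ 0) \<le> 1 * norm \<bar>ln \<epsilon>\<bar>" by simp
      qed
    qed
    finally show "(\<lambda>\<epsilon>. seminorm C l (\<lambda>x. u \<epsilon> x - h \<epsilon> x)) \<in> O[at_right 0](\<lambda>\<epsilon>. \<bar>ln \<epsilon>\<bar>)" .
  qed
  finally show ?thesis .
qed

text \<open>Summing the bounds for \<open>kpow\<close> leaves the seminorm of \<open>h\<close> over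
  the chosen rectangle as a factor, times \<open>exp (v * p)\<close> with \<open>p\<close> taken
  over \<open>Q \<times> Q\<close>. Logarithmic growth makes this exponential the moderate factor
  that \<open>dom\<close> demands.\<close>

lemma
  assumes X: "open X" and H: "H \<in> colombeau_C_ln (X \<times> X)" "h \<in> H" and K: "integration_domain X H K"
    and s: "is_exp_sum X K h s"
  shows is_exp_sum_moderate: "s \<in> moderate_nets (X \<times> X)"
    and is_exp_sum_colombeau_C: "Cl (X \<times> X) s \<in> colombeau_C (X \<times> X)"
proof -
  have o: "open (X \<times> X)" using X by (simp add: open_Times)
  have HC: "H \<in> colombeau_C (X \<times> X)" and Hc: "H \<in> colombeau (X \<times> X)" and Hl: "H \<in> colombeau_ln (X \<times> X)"
    using H by (auto simp: colombeau_C_def colombeau_C_ln_def)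
  note Kc = integration_domainD[OF K]
  note hs = colombeau_smooth_on[OF o Hc H(2)]
  let ?v = "measure lborel K"
  have lim: "smooth_limit (X \<times> X) (exp_partial_sum K h \<epsilon>) (s \<epsilon>)" if "\<epsilon> \<in> {0<..1}" for \<epsilon>
    using s that by (auto simp: is_exp_sum_def)
  then have ss: "s \<in> smooth_nets (X \<times> X)" by (auto simp: smooth_nets_def smooth_limit_def)
  have dom: "\<exists>G. moderate_growth G \<and>
      (\<forall>R \<epsilon>. compact R \<longrightarrow> R \<subseteq> Q \<longrightarrow> \<epsilon> \<in> {0<..1} \<longrightarrow>
        seminorm (R \<times> Q) l (s \<epsilon>) \<le> seminorm (R \<times> Q) l (h \<epsilon>) * G \<epsilon> \<and>
        seminorm (Q \<times> R) l (s \<epsilon>) \<le> seminorm (Q \<times> R) l (h \<epsilon>) * G \<epsilon>)"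
    if Q: "compact Q" "Q \<subseteq> X" "K \<subseteq> Q" for Q l
  proof (intro exI[of _ "\<lambda>\<epsilon>. exp (?v * seminorm (Q \<times> Q) l (h \<epsilon>))"] conjI allI impI)
    have QQ: "compact (Q \<times> Q)" "Q \<times> Q \<subseteq> X \<times> X" using Q by (auto intro: compact_Times)
    show "moderate_growth (\<lambda>\<epsilon>. exp (?v * seminorm (Q \<times> Q) l (h \<epsilon>)))"
      by (rule moderate_growth_exp_of_ln[OF ln_growth[OF o Hl Hc H(2) QQ]])
    fix R and \<epsilon> :: real assume R: "compact R" "R \<subseteq> Q" and e: "\<epsilon> \<in> {0<..1}"
    let ?a = "?v * seminorm (Q \<times> Q) l (h \<epsilon>)"
    have a0: "0 \<le> ?a" using seminorm_nonneg[OF QQ hs[OF e], of l] by simp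
    note kp = smooth_on_kpow[OF X Kc(1,2) hs[OF e]]
    have *: "seminorm C l (s \<epsilon>) \<le> seminorm C l (h \<epsilon>) * exp ?a"
      if C: "compact C" "C \<subseteq> X \<times> X"
        and le: "\<And>n. seminorm C l (kpow K (h \<epsilon>) n) \<le> ?a ^ n * seminorm C l (h \<epsilon>)" for C
    proof -
      have d0: "0 \<le> seminorm C l (h \<epsilon>)" by (rule seminorm_nonneg[OF C hs[OF e]])
      \<comment> \<open>The factor \<open>Suc n\<close> is inserted so that the estimate shaped for
        differences of powers applies.\<close>
      have "seminorm C l (kpow K (h \<epsilon>) n) \<le> real (Suc n) * ?a ^ n * seminorm C l (h \<epsilon>)" for n
      proof -
        have "1 * (?a ^ n * seminorm C l (h \<epsilon>)) \<le> real (Suc n) * (?a ^ n * seminorm C l (h \<epsilon>))"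
          using a0 d0 by (intro mult_right_mono) auto
        then show ?thesis using le[of n] by (simp only: mult.assoc mult_1_left)
      qed
      note b = seminorm_exp_sum_le[OF o C kp a0 d0 this]
      have "seminorm C l (\<lambda>x. s \<epsilon> x - 0) \<le> seminorm C l (h \<epsilon>) * exp ?a"
      proof (rule seminorm_of_limit_le[OF o C lim[OF e] smooth_limit_zero])
        fix N
        have "seminorm C l (\<lambda>x. exp_partial_sum K h \<epsilon> N x - 0) =
          seminorm C l (\<lambda>z. \<Sum>n<N. (1 / fact (Suc n)) * kpow K (h \<epsilon>) n z)"
          using exp_partial_sum_eq[where h = h and \<epsilon> = \<epsilon>, OF X Kc(1,2) hs[OF e]]
          by (intro seminorm_cong[OF o C(2)]) simp
        then show "seminorm C l (\<lambda>x. exp_partial_sum K h \<epsilon> N x - 0) \<le> seminorm C l (h \<epsilon>) * exp ?a"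
          using b[of N] by simp
      qed
      then show ?thesis by simp
    qed
    show "seminorm (R \<times> Q) l (s \<epsilon>) \<le> seminorm (R \<times> Q) l (h \<epsilon>) * exp ?a"
      by (rule *[OF compact_Times[OF R(1) Q(1)] Sigma_mono[OF order_trans[OF R(2) Q(2)] Q(2)]
            seminorm_kpow_le_left[OF X Q(1,2) Kc(1) Q(3) hs[OF e] order_refl order_refl R]])
    show "seminorm (Q \<times> R) l (s \<epsilon>) \<le> seminorm (Q \<times> R) l (h \<epsilon>) * exp ?a"
      by (rule *[OF compact_Times[OF Q(1) R(1)] Sigma_mono[OF Q(2) order_trans[OF R(2) Q(2)]]
            seminorm_kpow_le_right[OF X Q(1,2) Kc(1) Q(3) hs[OF e] order_refl order_refl R]])
  qed
  show "s \<in> moderate_nets (X \<times> X)" by (rule dominated_kernel_moderate[OF X HC H(2) K ss dom])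
  show "Cl (X \<times> X) s \<in> colombeau_C (X \<times> X)" by (rule dominated_kernel_colombeau_C[OF X HC H(2) K ss dom])
qed

lemma Cl_exp_sum_eq_of_subset:
  assumes X: "open X" and H: "H \<in> colombeau_C_ln (X \<times> X)" "h \<in> H" "h' \<in> H"
    and K: "integration_domain X H K" and K': "integration_domain X H K'" and sub: "K \<subseteq> K'"
    and s: "is_exp_sum X K h s" and s': "is_exp_sum X K' h' s'"
  shows "Cl (X \<times> X) s' = Cl (X \<times> X) s"
proof -
  have o: "open (X \<times> X)" using X by (simp add: open_Times)
  have Hc: "H \<in> colombeau (X \<times> X)" and Hl: "H \<in> colombeau_ln (X \<times> X)"
    using H by (auto simp: colombeau_C_def colombeau_C_ln_def)
  note Kc = integration_domainD[OF K] and Kc' = integration_domainD[OF K']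
  note hs = colombeau_smooth_on[OF o Hc H(2)] and hs' = colombeau_smooth_on[OF o Hc H(3)]
  let ?v = "measure lborel K'"
  show ?thesis
  proof (rule dominated_kernel_diff[OF X Hc H(2,3) K K' sub is_exp_sum_moderate[OF X H(1,2) K s]
        is_exp_sum_moderate[OF X H(1,3) K' s']])
    fix Q l assume Q: "compact Q" "Q \<subseteq> X" "K' \<subseteq> Q"
    \<comment> \<open>A sum bounds both seminorms and inherits logarithmic growth, so its
      exponential stays moderate.\<close>
    let ?M = "\<lambda>\<epsilon>. seminorm (Q \<times> Q) l (h \<epsilon>) + seminorm (Q \<times> Q) l (h' \<epsilon>)"
    let ?\<delta> = "\<lambda>\<epsilon>. seminorm (Q \<times> Q) l (\<lambda>z. h' \<epsilon> z - h \<epsilon> z) + seminorm ((K' - interior K) \<times> Q) l (h' \<epsilon>)"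
    have QQ: "compact (Q \<times> Q)" "Q \<times> Q \<subseteq> X \<times> X" using Q by (auto intro: compact_Times)
    have B: "compact ((K' - interior K) \<times> Q)" "(K' - interior K) \<times> Q \<subseteq> X \<times> X"
      using Q Kc' by (auto intro!: compact_Times compact_diff)
    show "\<exists>G. moderate_growth G \<and> (\<forall>\<epsilon>\<in>{0<..1}. seminorm (Q \<times> Q) l (\<lambda>z. s' \<epsilon> z - s \<epsilon> z) \<le> ?\<delta> \<epsilon> * G \<epsilon>)"
    proof (intro exI[of _ "\<lambda>\<epsilon>. exp (?v * ?M \<epsilon>)"] conjI ballI)
      show "moderate_growth (\<lambda>\<epsilon>. exp (?v * ?M \<epsilon>))"
        by (intro moderate_growth_exp_of_ln sum_in_bigo ln_growth[OF o Hl Hc H(2) QQ] ln_growth[OF o Hl Hc H(3) QQ])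
      fix \<epsilon> :: real assume e: "\<epsilon> \<in> {0<..1}"
      have nn: "0 \<le> seminorm (Q \<times> Q) l (h \<epsilon>)" "0 \<le> seminorm (Q \<times> Q) l (h' \<epsilon>)"
        by (rule seminorm_nonneg[OF QQ hs[OF e]], rule seminorm_nonneg[OF QQ hs'[OF e]])
      have a0: "0 \<le> ?v * ?M \<epsilon>" using nn by simp
      have d0: "0 \<le> ?\<delta> \<epsilon>"
        by (intro add_nonneg_nonneg seminorm_nonneg[OF QQ smooth_on_diff[OF o hs'[OF e] hs[OF e]]]
            seminorm_nonneg[OF B hs'[OF e]])
      note kp = smooth_on_kpow[OF X Kc(1,2) hs[OF e]] and kp' = smooth_on_kpow[OF X Kc'(1,2) hs'[OF e]]
      have le: "seminorm (Q \<times> Q) l (\<lambda>z. kpow K' (h' \<epsilon>) n z - kpow K (h \<epsilon>) n z)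
          \<le> real (Suc n) * (?v * ?M \<epsilon>) ^ n * ?\<delta> \<epsilon>" for n
        using nn by (intro seminorm_kpow_diff_le[OF X Q(1,2) Kc'(1) Q(3) Kc(1) sub hs[OF e] hs'[OF e] order_refl]) auto
      have lim: "smooth_limit (X \<times> X) (exp_partial_sum K h \<epsilon>) (s \<epsilon>)"
        "smooth_limit (X \<times> X) (exp_partial_sum K' h' \<epsilon>) (s' \<epsilon>)"
        using s s' e by (auto simp: is_exp_sum_def)
      show "seminorm (Q \<times> Q) l (\<lambda>z. s' \<epsilon> z - s \<epsilon> z) \<le> ?\<delta> \<epsilon> * exp (?v * ?M \<epsilon>)"
      proof (rule seminorm_of_limit_le[OF o QQ lim(2,1)])
        fix N
        have "seminorm (Q \<times> Q) l (\<lambda>x. exp_partial_sum K' h' \<epsilon> N x - exp_partial_sum K h \<epsilon> N x) =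
          seminorm (Q \<times> Q) l (\<lambda>z. \<Sum>n<N. (1 / fact (Suc n)) * (kpow K' (h' \<epsilon>) n z - kpow K (h \<epsilon>) n z))"
          using exp_partial_sum_eq[where h = h and \<epsilon> = \<epsilon>, OF X Kc(1,2) hs[OF e]]
            exp_partial_sum_eq[where h = h' and \<epsilon> = \<epsilon>, OF X Kc'(1,2) hs'[OF e]]
          by (intro seminorm_cong[OF o QQ(2)]) (simp add: sum_subtractf right_diff_distrib diff_divide_distrib)
        also have "\<dots> \<le> ?\<delta> \<epsilon> * exp (?v * ?M \<epsilon>)"
          by (rule seminorm_exp_sum_le[OF o QQ smooth_on_diff[OF o kp' kp] a0 d0 le])
        finally show "seminorm (Q \<times> Q) l (\<lambda>x. exp_partial_sum K' h' \<epsilon> N x - exp_partial_sum K h \<epsilon> N x)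
            \<le> ?\<delta> \<epsilon> * exp (?v * ?M \<epsilon>)" .
      qed
    qed
  qed
qed

lemma is_exp_sum_exists:
  assumes X: "open X" and H: "H \<in> colombeau (X \<times> X)" "h \<in> H" and K: "integration_domain X H K"
  shows "\<exists>s. is_exp_sum X K h s"
proof -
  note Kc = integration_domainD[OF K]
  have "\<forall>\<epsilon>\<in>{0<..1}. \<exists>g. smooth_limit (X \<times> X) (exp_partial_sum K h \<epsilon>) g"
    by (intro ballI exp_series_converges[where h = h] X Kc(1,2) colombeau_smooth_on[OF open_Times[OF X X] H])
  then show ?thesis unfolding is_exp_sum_def by (rule bchoice)
qed

text \<open>Two sums over different domains are linked through a third one, \<open>r\<close>, over
  the union; it exists because the series converges over every integration domain.\<close>

lemma exp_kernel_eq: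
  assumes X: "open X" and H: "H \<in> colombeau_C_ln (X \<times> X)" "h \<in> H" and K: "integration_domain X H K"
    and s: "is_exp_sum X K h s"
  shows "exp_kernel X H = Cl (X \<times> X) s"
proof -
  have Hc: "H \<in> colombeau (X \<times> X)" using H by (auto simp: colombeau_C_def colombeau_C_ln_def)
  have "Cl (X \<times> X) s = Cl (X \<times> X) s'"
    if K': "integration_domain X H K'" and h': "h' \<in> H" and s': "is_exp_sum X K' h' s'" for K' h' s'
  proof -
    note U = integration_domain_Un[OF K K']
    obtain r where r: "is_exp_sum X (K \<union> K') h' r" using is_exp_sum_exists[OF X Hc h' U] by blast
    show ?thesis
      using Cl_exp_sum_eq_of_subset[OF X H h' K U Un_upper1 s r]
        Cl_exp_sum_eq_of_subset[OF X H(1) h' h' K' U Un_upper2 s' r] by simp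
  qed
  then show ?thesis
    unfolding exp_kernel_def by (intro the_equality) (use assms in blast)+
qed

section \<open>The exponential operator\<close>

lemma gen_add_eq:
  assumes \<Omega>: "open \<Omega>" and U: "U \<in> colombeau \<Omega>" "u \<in> U" and V: "V \<in> colombeau \<Omega>" "v \<in> V"
  shows "gen_add \<Omega> U V = Cl \<Omega> (\<lambda>\<epsilon> x. u \<epsilon> x + v \<epsilon> x)"
proof -
  have "Cl \<Omega> (\<lambda>\<epsilon> x. u' \<epsilon> x + v' \<epsilon> x) = Cl \<Omega> (\<lambda>\<epsilon> x. u \<epsilon> x + v \<epsilon> x)" if u': "u' \<in> U" and v': "v' \<in> V" for u' v'
  proof (rule Cl_eqI[OF \<Omega>])
    have "(\<lambda>\<epsilon> x. (u' \<epsilon> x - u \<epsilon> x) + (v' \<epsilon> x - v \<epsilon> x)) \<in> null_nets \<Omega>"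
      by (intro null_nets_add[OF \<Omega>] colombeau_diff_null[OF \<Omega> U(1) u' U(2)] colombeau_diff_null[OF \<Omega> V(1) v' V(2)])
    then show "(\<lambda>\<epsilon> x. u' \<epsilon> x + v' \<epsilon> x - (u \<epsilon> x + v \<epsilon> x)) \<in> null_nets \<Omega>"
      by (simp add: algebra_simps)
  qed (intro moderate_nets_add[OF \<Omega>] colombeau_mem(1)[OF \<Omega> U(1)] colombeau_mem(1)[OF \<Omega> V(1)] u' v' U(2) V(2))+
  then show ?thesis unfolding gen_add_def using U(2) V(2) by blast
qed

theorem mainTheorem6:
  fixes X :: "(real ^ 'd) set"
    and H :: "((real ^ 'd) \<times> (real ^ 'd), 'k::{real_normed_field,euclidean_space}) net set"
  assumes "open X"
    and "H \<in> colombeau_C_ln (X \<times> X)"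
  shows
    "iter_kernel X H 1 = H \<and>
     (\<forall>n\<ge>1. is_kernel X (int_op X H ^^ n) (iter_kernel X H n)) \<and>
     (\<exists>K. integration_domain X H K) \<and>
     (\<forall>K h. integration_domain X H K \<and> h \<in> H \<longrightarrow>
        (\<forall>n\<ge>1. iter_kernel_net K h n \<in> iter_kernel X H n) \<and>
        (\<forall>\<epsilon>\<in>{0<..1}. \<exists>g. smooth_limit (X \<times> X) (exp_partial_sum K h \<epsilon>) g) \<and>
        (\<forall>s. is_exp_sum X K h s \<longrightarrow>
           s \<in> moderate_nets (X \<times> X) \<and> Cl (X \<times> X) s = exp_kernel X H)) \<and>
     exp_kernel X H \<in> colombeau_C (X \<times> X) \<and>
     (\<forall>F\<in>colombeau X.
        int_op X (exp_kernel X H) F \<in> colombeau_C X \<and>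
        exp_op X H F \<in> colombeau X \<and>
        (\<forall>K s f. integration_domain X (exp_kernel X H) K \<and> s \<in> exp_kernel X H \<and> f \<in> F \<longrightarrow>
           exp_op X H F = Cl X (\<lambda>\<epsilon> x. int_op_net K s f \<epsilon> x + f \<epsilon> x)))"
proof -
  note X = assms(1)
  have o: "open (X \<times> X)" using X by (simp add: open_Times)
  have HC: "H \<in> colombeau_C (X \<times> X)" and Hc: "H \<in> colombeau (X \<times> X)" and T: "compact (gen_supp (X \<times> X) H)"
    using assms(2) by (auto simp: colombeau_C_def colombeau_C_ln_def)
  \<comment> \<open>A domain, a representative and a sum over it realize
    \<open>exp_kernel X H\<close> as the class of an actual sum; they also show that the claims
    about all \<open>K\<close>, \<open>h\<close> and \<open>s\<close> are not vacuous.\<close>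
  obtain K0 where K0: "integration_domain X H K0" using integration_domain_exists[OF X T] by blast
  obtain h0 where h0: "h0 \<in> H" using colombeau_nonempty[OF o Hc] by blast
  obtain s0 where s0: "is_exp_sum X K0 h0 s0" using is_exp_sum_exists[OF X Hc h0 K0] by blast
  let ?S = "exp_kernel X H"
  have S: "?S \<in> colombeau_C (X \<times> X)"
    using is_exp_sum_colombeau_C[OF X assms(2) h0 K0 s0] exp_kernel_eq[OF X assms(2) h0 K0 s0] by simp
  then have Sc: "?S \<in> colombeau (X \<times> X)" and ST: "compact (gen_supp (X \<times> X) ?S)"
    by (auto simp: colombeau_C_def)
  have kernel: "is_kernel X (int_op X H ^^ n) (iter_kernel X H n)" if "n \<ge> 1" for n
    using is_kernel_iter_kernel[OF X HC, of "n - 1"] that by simp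
  have mem: "iter_kernel_net K h n \<in> iter_kernel X H n" if "integration_domain X H K" "h \<in> H" "n \<ge> 1" for K h n
    using iter_kernel_eq[OF X HC that(2,1), of "n - 1"]
      mem_Cl[OF iter_kernel_net_moderate[OF X HC that(2,1), of "n - 1"]] that(3) by simp
  have conv: "\<exists>g. smooth_limit (X \<times> X) (exp_partial_sum K h \<epsilon>) g"
    if "integration_domain X H K" "h \<in> H" "\<epsilon> \<in> {0<..1}" for K h \<epsilon>
    by (rule exp_series_converges[where h = h and \<epsilon> = \<epsilon>, OF X integration_domainD(1,2)[OF that(1)]
          colombeau_smooth_on[OF o Hc that(2,3)]])
  have sums: "s \<in> moderate_nets (X \<times> X) \<and> Cl (X \<times> X) s = ?S"
    if "integration_domain X H K" "h \<in> H" "is_exp_sum X K h s" for K h s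
    using is_exp_sum_moderate[OF X assms(2) that(2,1,3)] exp_kernel_eq[OF X assms(2) that(2,1,3)] by simp
  have op: "int_op X ?S F \<in> colombeau_C X" if F: "F \<in> colombeau X" for F
    by (rule int_op_in_colombeau_C[OF X S F])
  \<comment> \<open>The domain \<open>K\<close> here belongs to the exponential kernel itself, and
    \<open>s\<close> is any representative of it, not necessarily the sum of a series.\<close>
  have exp_op: "exp_op X H F = Cl X (\<lambda>\<epsilon> x. int_op_net K s f \<epsilon> x + f \<epsilon> x)"
    if F: "F \<in> colombeau X" "f \<in> F" and K: "integration_domain X ?S K" and s: "s \<in> ?S" for F K s f
    unfolding exp_op_def
    using op[OF F(1)] by (intro gen_add_eq[OF X _ int_op_net_mem[OF X Sc s F K] F]) (simp add: colombeau_C_def)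
  have exp_op_in: "exp_op X H F \<in> colombeau X" if F: "F \<in> colombeau X" for F
  proof -
    obtain K where K: "integration_domain X ?S K" using integration_domain_exists[OF X ST] by blast
    obtain s where s: "s \<in> ?S" using colombeau_nonempty[OF o Sc] by blast
    obtain f where f: "f \<in> F" using colombeau_nonempty[OF X F] by blast
    show ?thesis
      unfolding exp_op[OF F f K s]
      by (intro Cl_in_colombeau moderate_nets_add[OF X] colombeau_mem(1)[OF X F f]
          int_op_net_moderate[OF X Sc s F f integration_domainD(1,2)[OF K]])
  qed
  show ?thesis
    by (intro conjI allI impI ballI iter_kernel_1[OF X HC] kernel exI[of _ K0] K0 S op exp_op_in;
        (elim conjE)?; (assumption | rule exp_op mem conv sums[THEN conjunct1] sums[THEN conjunct2])+)
qed

end
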